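(* There is a randomized algorithm which, given an undirected weighted connected graph $G$ on $n$ vertices, a real $\lambda\in(0,2]$ that is a lower bound on $\lambda_2$, an index $i\in\{1,\dots,n\}$, a unit vector $b\in\mathsf{Im}(L_G)$, a precision $\epsilon\in(0,1]$ and an error parameter $\gamma\in(0,1]$, outputs an $\epsilon$-additive approximation of the $i$-th entry of $L_G^\dagger b$ with probability at least $1-\gamma$, and uses $O\big(\log\big(\frac{n\mathfrak d}{\epsilon\lambda}\big)+\log\log(1/\gamma)\big)$ space.
   Context: $G$ has symmetric weights $w(i,j)\ge0$ ($>0$ exactly on edges), degrees $d_i=\sum_jw(i,j)$, $\mathfrak d=\max_id_i/\min_id_i$. The normalized Laplacian $L_G$ has entries $L_G[i,i]=1-w(i,i)/d_i$, $L_G[i,j]=-w(i,j)/\sqrt{d_id_j}$ for $(i,j)\in E$, $i\ne j$, and $0$ otherwise; its eigenvalues are $0=\lambda_1\le\lambda_2\le\dots\le\lambda_n\le2$, with $\lambda_2>0$ since $G$ is connected. $\mathsf{Im}(L_G)$ is the image of $L_G$ and $L_G^\dagger$ its Moore–Penrose pseudo-inverse. A $\epsilon$-additive approximation of a real $b$ is a real $a$ with $|a-b|\le\epsilon$. Computational model: space-bounded randomized algorithm with read-only input and random bits (in particular able to simulate steps of the random walk with transition probabilities $w(i,j)/d_i$); arithmetic on $O(\log m)$-bit reals is done exactly in $O(\log m)$ space. *)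

theory Defs
  imports
    "HOL-Probability.Probability_Mass_Function"
    "HOL-Library.Log_Nat"
    "Jordan_Normal_Form.Char_Poly"
begin

section \<open>Weighted graphs and the normalized Laplacian\<close>

text \<open>
  The vertex set is \<open>{..<n}\<close>; the weight function is only relevant on it. Self-loops are
  allowed.
\<close>

definition weighted_graph :: "nat \<Rightarrow> (nat \<Rightarrow> nat \<Rightarrow> real) \<Rightarrow> bool" where
  "weighted_graph n w \<longleftrightarrow> (\<forall>i<n. \<forall>j<n. w i j = w j i \<and> w i j \<ge> 0)"

definition edges :: "nat \<Rightarrow> (nat \<Rightarrow> nat \<Rightarrow> real) \<Rightarrow> (nat \<times> nat) set" where
  "edges n w = {(i, j). i < n \<and> j < n \<and> w i j > 0}"

definition connected_graph :: "nat \<Rightarrow> (nat \<Rightarrow> nat \<Rightarrow> real) \<Rightarrow> bool" where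
  "connected_graph n w \<longleftrightarrow> (\<forall>i<n. \<forall>j<n. (i, j) \<in> (edges n w)\<^sup>*)"

definition deg :: "nat \<Rightarrow> (nat \<Rightarrow> nat \<Rightarrow> real) \<Rightarrow> nat \<Rightarrow> real" where
  "deg n w i = (\<Sum>j<n. w i j)"

definition deg_ratio :: "nat \<Rightarrow> (nat \<Rightarrow> nat \<Rightarrow> real) \<Rightarrow> real" where
  "deg_ratio n w = Max (deg n w ` {..<n}) / Min (deg n w ` {..<n})"

definition laplacian :: "nat \<Rightarrow> (nat \<Rightarrow> nat \<Rightarrow> real) \<Rightarrow> real mat" where
  "laplacian n w = Matrix.mat n n (\<lambda>(i, j).
     if i = j then 1 - w i i / deg n w i
     else if (i, j) \<in> edges n w then - w i j / sqrt (deg n w i * deg n w j)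
     else 0)"

text \<open>
  The real eigenvalues in increasing order, repeated according to algebraic multiplicity. For a
  symmetric real matrix of size \<open>n\<close> this list has length \<open>n\<close>, and indexing starts at 0.
\<close>

definition eigenvalue_list :: "real mat \<Rightarrow> real list" where
  "eigenvalue_list A = sorted_list_of_multiset (proots (char_poly A))"

definition lambda2 :: "nat \<Rightarrow> (nat \<Rightarrow> nat \<Rightarrow> real) \<Rightarrow> real" where
  "lambda2 n w = eigenvalue_list (laplacian n w) ! 1"

definition mat_image :: "real mat \<Rightarrow> real Matrix.vec set" where
  "mat_image A = {A *\<^sub>v x | x. x \<in> carrier_vec (dim_col A)}"

text \<open>The Moore--Penrose pseudo-inverse, characterised by the four Penrose equations.\<close>

definition pseudo_inverse :: "real mat \<Rightarrow> real mat" where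
  "pseudo_inverse A = (THE X. X \<in> carrier_mat (dim_col A) (dim_row A) \<and>
     A * X * A = A \<and> X * A * X = X \<and>
     transpose_mat (A * X) = A * X \<and> transpose_mat (X * A) = X * A)"

definition additive_approx :: "real \<Rightarrow> real \<Rightarrow> real \<Rightarrow> bool" where
  "additive_approx eps b a \<longleftrightarrow> \<bar>a - b\<bar> \<le> eps"


section \<open>Space-bounded randomized programs\<close>

text \<open>
  A machine has finitely many registers holding integers (the registers mentioned by its program)
  and is charged the total bit length of their contents. A real of \<open>s\<close> bits is held as a
  fixed-point integer. The input can only be read, by the instruction \<open>Read\<close>. Randomness
  comes from fair bits (\<open>Flip\<close>) and from steps of the random walk on the input graph
  (\<open>Walk\<close>). A program is a fixed finite object that does not depend on the input, so the
  model is uniform.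
\<close>

record lap_input =
  size_in :: nat
  weight_in :: "nat \<Rightarrow> nat \<Rightarrow> real"
  gap_in :: real
  index_in :: nat
  rhs_in :: "real Matrix.vec"
  prec_in :: real
  err_in :: real

text \<open>
  The weights are stored in fixed point behind a common power of two, chosen so that the stored
  numbers lie in \<open>[0, 1)\<close> and the largest is at least \<open>1/2\<close>. The Laplacian, the degree ratio and
  the random walk do not change when all weights are multiplied by the same positive number. The
  program has no access to the power of two itself.
\<close>

definition weight_unit :: "nat \<Rightarrow> (nat \<Rightarrow> nat \<Rightarrow> real) \<Rightarrow> real" where
  "weight_unit n w = 2 powr (of_int \<lfloor>log 2 (Max {w i j | i j. i < n \<and> j < n})\<rfloor> + 1)"

type_synonym store = "nat \<Rightarrow> int"

datatype aexp = Const int | Reg nat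
  | Plus aexp aexp | Minus aexp aexp | Times aexp aexp | Div aexp aexp

fun aval :: "aexp \<Rightarrow> store \<Rightarrow> int" where
  "aval (Const c) s = c"
| "aval (Reg x) s = s x"
| "aval (Plus a b) s = aval a s + aval b s"
| "aval (Minus a b) s = aval a s - aval b s"
| "aval (Times a b) s = aval a s * aval b s"
| "aval (Div a b) s = aval a s div aval b s"

datatype source = NumVertices | Weight aexp aexp | GapBound | Index | Entry aexp
  | Precision | ErrorProb

text \<open>Addresses outside the input are read as 0.\<close>

fun source_val :: "lap_input \<Rightarrow> store \<Rightarrow> source \<Rightarrow> real" where
  "source_val I s NumVertices = real (size_in I)"
| "source_val I s (Weight a b) =
     (let i = aval a s; j = aval b s; n = size_in I in
      if 0 \<le> i \<and> i < int n \<and> 0 \<le> j \<and> j < int n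
      then weight_in I (nat i) (nat j) / weight_unit n (weight_in I) else 0)"
| "source_val I s GapBound = gap_in I"
| "source_val I s Index = real (index_in I)"
| "source_val I s (Entry a) =
     (let i = aval a s in
      if 0 \<le> i \<and> i < int (size_in I) then vec_index (rhs_in I) (nat i) else 0)"
| "source_val I s Precision = prec_in I"
| "source_val I s ErrorProb = err_in I"

text \<open>
  One step of the random walk from \<open>v\<close>: vertex \<open>j\<close> has probability \<open>w v j / deg n w v\<close>. The
  side condition makes these numbers a probability distribution; it always holds at vertices of
  connected graphs with at least two vertices.
\<close>

definition walk_pmf :: "nat \<Rightarrow> (nat \<Rightarrow> nat \<Rightarrow> real) \<Rightarrow> nat \<Rightarrow> nat pmf" where
  "walk_pmf n w v =
     (if (\<forall>j<n. w v j \<ge> 0) \<and> deg n w v > 0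
      then embed_pmf (\<lambda>j. if j < n then w v j / deg n w v else 0)
      else return_pmf v)"

lemma pmf_walk_pmf:
  assumes "\<And>j. j < n \<Longrightarrow> w v j \<ge> 0" and pos: "deg n w v > 0"
  shows "pmf (walk_pmf n w v) j = (if j < n then w v j / deg n w v else 0)"
proof -
  let ?f = "\<lambda>j. if j < n then w v j / deg n w v else 0"
  have nonneg: "?f j \<ge> 0" for j
    using assms by auto
  have "(\<integral>\<^sup>+ j. ennreal (?f j) \<partial>count_space UNIV) =
      (\<integral>\<^sup>+ j. ennreal (?f j) * indicator {..<n} j \<partial>count_space UNIV)"
    by (intro nn_integral_cong) (auto simp: indicator_def)
  also have "\<dots> = (\<integral>\<^sup>+ j. ennreal (?f j) \<partial>count_space {..<n})"
    by (subst nn_integral_count_space_indicator[of "{..<n}"])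
       (auto intro!: nn_integral_cong simp: indicator_def)
  also have "\<dots> = (\<Sum>j<n. ennreal (?f j))"
    by (simp add: nn_integral_count_space_finite)
  also have "\<dots> = ennreal (\<Sum>j<n. ?f j)"
    by (rule sum_ennreal) (rule nonneg)
  also have "(\<Sum>j<n. ?f j) = 1"
    using pos by (simp add: sum_divide_distrib[symmetric] deg_def)
  finally have "(\<integral>\<^sup>+ j. ennreal (?f j) \<partial>count_space UNIV) = 1"
    by simp
  then have "pmf (embed_pmf ?f) j = ?f j"
    by (intro pmf_embed_pmf nonneg)
  then show ?thesis
    using assms by (simp add: walk_pmf_def)
qed

text \<open>
  \<open>Read x src k\<close> stores \<open>\<lfloor>2\<^sup>k r\<rfloor>\<close> in register \<open>x\<close>, where \<open>r\<close> is the
  designated input number, that is, its binary expansion up to \<open>k\<close> digits after the point.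
  \<open>Walk x a\<close> stores a random neighbour of vertex \<open>a\<close>. The tests of \<open>If\<close> and
  \<open>While\<close> succeed when the expression is positive.
\<close>

datatype com = Skip
  | Assign nat aexp
  | Read nat source aexp
  | Flip nat
  | Walk nat aexp
  | Seq com com
  | If aexp com com
  | While aexp com

type_synonym config = "com \<times> store"

fun step :: "lap_input \<Rightarrow> config \<Rightarrow> config pmf" where
  "step I (Skip, s) = return_pmf (Skip, s)"
| "step I (Assign x a, s) = return_pmf (Skip, s(x := aval a s))"
| "step I (Read x src a, s) =
     return_pmf (Skip, s(x := \<lfloor>2 ^ nat (aval a s) * source_val I s src\<rfloor>))"
| "step I (Flip x, s) =
     map_pmf (\<lambda>c. (Skip, s(x := of_bool c))) (bernoulli_pmf (1 / 2))"
| "step I (Walk x a, s) =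
     (let v = aval a s in
      if 0 \<le> v \<and> v < int (size_in I)
      then map_pmf (\<lambda>j. (Skip, s(x := int j))) (walk_pmf (size_in I) (weight_in I) (nat v))
      else return_pmf (Skip, s(x := v)))"
| "step I (Seq c d, s) =
     (if c = Skip then return_pmf (d, s)
      else map_pmf (\<lambda>(c', s'). (Seq c' d, s')) (step I (c, s)))"
| "step I (If a c d, s) = return_pmf (if aval a s > 0 then c else d, s)"
| "step I (While a c, s) = return_pmf (If a (Seq c (While a c)) Skip, s)"

text \<open>All registers are initially 0; \<open>run I P t\<close> is the configuration after \<open>t\<close> steps.\<close>

fun run :: "lap_input \<Rightarrow> com \<Rightarrow> nat \<Rightarrow> config pmf" where
  "run I P 0 = return_pmf (P, \<lambda>_. 0)"
| "run I P (Suc t) = bind_pmf (run I P t) (step I)"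

definition halted :: "config \<Rightarrow> bool" where
  "halted cf \<longleftrightarrow> fst cf = Skip"

definition out_val :: "config \<Rightarrow> real" where
  "out_val cf = of_int (snd cf 0) / of_int (snd cf 1)"

text \<open>
  Zero registers are free and signs are not charged; this changes the space by a factor of at
  most 2 and an additive constant depending on the program. The sum is finite by
  \<open>finite_support_run\<close> below. The program point ranges over a finite set fixed by the program, so
  it is not charged either.
\<close>

definition store_bits :: "store \<Rightarrow> int" where
  "store_bits s = (\<Sum>x | s x \<noteq> 0. bitlen \<bar>s x\<bar>)"

lemma finite_support_step:
  assumes "finite {x. s x \<noteq> 0}" and "cf \<in> set_pmf (step I (c, s))"
  shows "finite {x. snd cf x \<noteq> 0}"
proof -
  have upd: "finite {x. (s(y := v)) x \<noteq> 0}" for y v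
    by (rule finite_subset[OF _ finite.insertI[OF assms(1), of y]]) auto
  have "finite {x. snd cf x \<noteq> 0}" if "cf \<in> set_pmf (step I (c, s))" for cf
    using that
  proof (induction c arbitrary: cf)
    case (Seq c d)
    then show ?case
      using assms(1) by (fastforce split: if_splits)
  qed (use assms(1) upd in \<open>auto simp: Let_def simp del: fun_upd_apply split: if_splits\<close>)
  then show ?thesis
    using assms(2) .
qed

lemma finite_support_run:
  "cf \<in> set_pmf (run I P t) \<Longrightarrow> finite {x. snd cf x \<noteq> 0}"
  by (induction t arbitrary: cf) (auto dest: finite_support_step[rotated])

text \<open>
  Both requirements are over all outcomes of the random choices. Halting on every outcome is part
  of the notion of a space-bounded randomized algorithm. A configuration cannot recur in such a
  run, so the running time is at most exponential in the space.
\<close>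

definition halts_by :: "lap_input \<Rightarrow> com \<Rightarrow> nat \<Rightarrow> bool" where
  "halts_by I P t \<longleftrightarrow> (\<forall>cf \<in> set_pmf (run I P t). halted cf)"

definition space_bounded :: "lap_input \<Rightarrow> com \<Rightarrow> real \<Rightarrow> bool" where
  "space_bounded I P S \<longleftrightarrow>
     (\<forall>t. \<forall>cf \<in> set_pmf (run I P t). of_int (store_bits (snd cf)) \<le> S)"

end

theory Submission
  imports Defs "HOL-Analysis.Function_Topology" "HOL-Probability.Hoeffding"
begin

text \<open>
  Let \<open>W = 1 - L / 2\<close> be the transition operator of the lazy random walk, conjugated by the square
  roots of the degrees. If \<open>L x = b\<close> and \<open>x\<close> is orthogonal to the kernel, then
  \<open>x - (\<Sum>k<K. W ^ k b) / 2 = W ^ K x\<close>, which is exponentially small in \<open>K \<lambda>\<close> because of the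
  spectral gap. The \<open>i\<close>-th entry of \<open>W ^ k b\<close> is the expectation of
  \<open>sqrt (d i / d v) * b v\<close> at the position \<open>v\<close> of the lazy walk after \<open>k\<close> steps from \<open>i\<close>.
  The program averages this sum over independent trajectories; by Hoeffding's inequality
  \<open>log (1 / \<gamma>)\<close> times a polynomial in \<open>2 ^ m\<close> many samples suffice, where \<open>2 ^ m\<close> bounds the size,
  the degree ratio, \<open>1 / \<lambda>\<close> and \<open>1 / \<epsilon>\<close>. All numbers are kept with \<open>20 m\<close> binary digits, and \<open>m\<close>
  is found by searching for the first value for which the inputs are distinguishable from zero.
\<close>

section \<open>Executions with bounded registers\<close>

text \<open>Laziness is what lets a gap at the bottom of the spectrum suffice: an eigenvalue of the
  walk at or near -1, as in bipartite graphs, would otherwise stop the powers from decaying.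
  \<open>lambda2\<close> is an entry of a sorted list of roots, while the contraction needs an
  inequality between quadratic forms. The bridge is a minimiser of the Rayleigh quotient on the
  complement of the constants, which exists by compactness: its value is a positive eigenvalue,
  hence an upper bound for \<open>lambda2\<close>, and by minimality a lower bound for the quotient.
  All thresholds are powers of \<open>B = 2 ^ m\<close> and deliberately crude, since a constant
  exponent costs only a constant factor in bits. The precision \<open>eps\<close> is split: a
  quarter each for the truncated series and for rounding, half for sampling. The exponent
  \<open>kg\<close> with \<open>1 \<le> 2 ^ kg * gam\<close> is kept apart from \<open>m\<close>,
  because the number of samples is proportional to \<open>kg + 1\<close> and so contributes only a
  logarithm of \<open>kg + 1\<close> to the space. The bounds \<open>m1\<close> and
  \<open>kg1\<close> computed from the true parameters are known to the analysis alone.\<close>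

definition regs_bounded :: "nat \<Rightarrow> int \<Rightarrow> store \<Rightarrow> bool" where
  "regs_bounded R M s \<longleftrightarrow> (\<forall>x. \<bar>s x\<bar> \<le> (if x < R then M else 0))"

lemma regs_bounded_upd:
  "regs_bounded R M s \<Longrightarrow> x < R \<Longrightarrow> \<bar>v\<bar> \<le> M \<Longrightarrow> regs_bounded R M (s(x := v))"
  unfolding regs_bounded_def by (simp only: fun_upd_apply) (metis abs_zero)

text \<open>A uniform bound per register costs only the factor \<open>R\<close>, a constant of the
  program, so the space analysis reduces to one largest value \<open>M\<close>.\<close>

lemma store_bits_le:
  assumes "regs_bounded R M s"
  shows "store_bits s \<le> int R * bitlen M"
proof -
  have sub: "{x. s x \<noteq> 0} \<subseteq> {..<R}"
  proof
    fix x
    assume "x \<in> {x. s x \<noteq> 0}"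
    moreover have "\<bar>s x\<bar> \<le> (if x < R then M else 0)"
      using assms unfolding regs_bounded_def by blast
    ultimately show "x \<in> {..<R}"
      by (cases "x < R") simp_all
  qed
  have "bitlen \<bar>s x\<bar> \<le> bitlen M" if "x < R" for x
  proof -
    have "\<bar>s x\<bar> \<le> M"
      using assms that unfolding regs_bounded_def by presburger
    then show ?thesis
      unfolding bitlen_def of_nat_le_iff by (intro floorlog_mono nat_mono)
  qed
  moreover have "0 \<le> bitlen \<bar>s x\<bar>" for x
    by (rule bitlen_nonneg)
  ultimately have "(\<Sum>x<R. bitlen \<bar>s x\<bar>) \<le> (\<Sum>x<R. bitlen M)" "store_bits s \<le> (\<Sum>x<R. bitlen \<bar>s x\<bar>)"
    unfolding store_bits_def by (intro sum_mono; simp) (intro sum_mono2[OF _ sub]; simp)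
  then show ?thesis by simp
qed

text \<open>
  The program halts on every outcome when started in the given store, all stores on the way are
  bounded, and the last argument is the distribution of the final store.
\<close>

inductive exec :: "lap_input \<Rightarrow> nat \<Rightarrow> int \<Rightarrow> com \<Rightarrow> store \<Rightarrow> store pmf \<Rightarrow> bool"
  for I R M where
  exec_Skip: "regs_bounded R M s \<Longrightarrow> exec I R M Skip s (return_pmf s)"
| exec_step: "c \<noteq> Skip \<Longrightarrow> regs_bounded R M s \<Longrightarrow>
    (\<And>cf. cf \<in> set_pmf (step I (c, s)) \<Longrightarrow> exec I R M (fst cf) (snd cf) (f cf)) \<Longrightarrow>
    exec I R M c s (bind_pmf (step I (c, s)) f)"

lemma exec_start: "exec I R M c s \<mu> \<Longrightarrow> regs_bounded R M s"
  by (induction rule: exec.induct)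

lemma exec_end: "exec I R M c s \<mu> \<Longrightarrow> s' \<in> set_pmf \<mu> \<Longrightarrow> regs_bounded R M s'"
proof (induction rule: exec.induct)
  case (exec_step c s f)
  from exec_step.prems obtain cf where "cf \<in> set_pmf (step I (c, s))" "s' \<in> set_pmf (f cf)"
    unfolding set_bind_pmf by blast
  then show ?case by (rule exec_step.IH)
qed simp

lemma exec_det_step:
  assumes "c \<noteq> Skip" "regs_bounded R M s" "step I (c, s) = return_pmf (d, s')" "exec I R M d s' \<mu>"
  shows "exec I R M c s \<mu>"
  using exec_step[of c R M s I "\<lambda>_. \<mu>"] assms by (simp add: bind_return_pmf)

lemma exec_Seq:
  assumes "exec I R M c s \<mu>" "\<And>s'. s' \<in> set_pmf \<mu> \<Longrightarrow> exec I R M d s' (\<nu> s')"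
  shows "exec I R M (Seq c d) s (bind_pmf \<mu> \<nu>)"
  using assms
proof (induction rule: exec.induct)
  case (exec_Skip s)
  then show ?case
    by (intro exec_det_step[of "Seq Skip d"]) (auto simp: bind_return_pmf)
next
  case (exec_step c s f)
  \<comment> \<open>\<open>exec_step\<close> takes a continuation defined on all configurations. The
    reachable ones have the shape \<open>Seq c' d\<close>; the other branch is a dummy.\<close>
  define g where
    "g = (\<lambda>cf. case fst cf of Seq c' _ \<Rightarrow> bind_pmf (f (c', snd cf)) \<nu> | _ \<Rightarrow> return_pmf (snd cf))"
  have "exec I R M (Seq c d) s (bind_pmf (step I (Seq c d, s)) g)"
  proof (rule exec.exec_step)
    fix cf
    assume "cf \<in> set_pmf (step I (Seq c d, s))"
    then obtain c' s' where cf: "cf = (Seq c' d, s')" "(c', s') \<in> set_pmf (step I (c, s))"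
      using exec_step.hyps(1) by auto
    have "exec I R M (Seq c' d) s' (bind_pmf (f (c', s')) \<nu>)"
      using exec_step.IH[OF cf(2)] exec_step.prems cf(2) by auto
    then show "exec I R M (fst cf) (snd cf) (g cf)"
      by (simp add: cf(1) g_def)
  qed (use exec_step.hyps in auto)
  also have "bind_pmf (step I (Seq c d, s)) g = bind_pmf (bind_pmf (step I (c, s)) f) \<nu>"
    using exec_step.hyps(1)
    by (simp add: bind_map_pmf bind_assoc_pmf g_def case_prod_unfold)
  finally show ?case .
qed

lemma exec_Seq_det:
  assumes "exec I R M c s (return_pmf s')" "exec I R M d s' \<nu>"
  shows "exec I R M (Seq c d) s \<nu>"
  using exec_Seq[OF assms(1), of d "\<lambda>_. \<nu>"] assms(2) by (simp add: bind_return_pmf)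

text \<open>The continuation is indexed by the store \<open>f x\<close> and not by \<open>x\<close>:
  later commands know the random outcome only through the registers. Concrete instances of
  \<open>\<nu>\<close> read it back from a register.\<close>

lemma exec_Seq_map:
  assumes "exec I R M c s (map_pmf f p)"
    "\<And>x. x \<in> set_pmf p \<Longrightarrow> exec I R M d (f x) (\<nu> (f x))"
  shows "exec I R M (Seq c d) s (bind_pmf p (\<lambda>x. \<nu> (f x)))"
  using exec_Seq[OF assms(1), of d \<nu>] assms(2) by (auto simp: bind_map_pmf)

lemma exec_Seq_map_det:
  assumes "exec I R M c s (map_pmf f p)"
    "\<And>x. x \<in> set_pmf p \<Longrightarrow> exec I R M d (f x) (return_pmf (g (f x)))"
  shows "exec I R M (Seq c d) s (map_pmf (\<lambda>x. g (f x)) p)"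
  unfolding map_pmf_def by (rule exec_Seq_map[OF assms])

lemma exec_Assign:
  assumes "regs_bounded R M s" "x < R" "\<bar>aval a s\<bar> \<le> M"
  shows "exec I R M (Assign x a) s (return_pmf (s(x := aval a s)))"
  by (rule exec_det_step) (auto intro!: exec_Skip regs_bounded_upd assms)

lemma exec_Read:
  assumes "regs_bounded R M s" "x < R" "\<bar>\<lfloor>2 ^ nat (aval a s) * source_val I s src\<rfloor>\<bar> \<le> M"
  shows "exec I R M (Read x src a) s
    (return_pmf (s(x := \<lfloor>2 ^ nat (aval a s) * source_val I s src\<rfloor>)))"
  by (rule exec_det_step) (auto intro!: exec_Skip regs_bounded_upd assms)

lemma exec_Flip:
  assumes "regs_bounded R M s" "x < R" "1 \<le> M"
  shows "exec I R M (Flip x) s (map_pmf (\<lambda>c. s(x := of_bool c)) (bernoulli_pmf (1 / 2)))"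
proof -
  have "exec I R M (Flip x) s (bind_pmf (step I (Flip x, s)) (\<lambda>cf. return_pmf (snd cf)))"
  proof (rule exec_step)
    fix cf
    assume "cf \<in> set_pmf (step I (Flip x, s))"
    then obtain c where "cf = (Skip, s(x := of_bool c))"
      by auto
    moreover have "regs_bounded R M (s(x := of_bool c))"
      using assms by (intro regs_bounded_upd) auto
    ultimately show "exec I R M (fst cf) (snd cf) (return_pmf (snd cf))"
      using exec_Skip by simp
  qed (use assms in auto)
  then show ?thesis
    by (simp add: map_pmf_def[symmetric] map_pmf_comp)
qed

lemma exec_Walk:
  assumes "regs_bounded R M s" "x < R" "int (size_in I) \<le> M"
    and v: "aval a s = int v" "v < size_in I"
    and set: "set_pmf (walk_pmf (size_in I) (weight_in I) v) \<subseteq> {..<size_in I}"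
  shows "exec I R M (Walk x a) s
    (map_pmf (\<lambda>j. s(x := int j)) (walk_pmf (size_in I) (weight_in I) v))"
proof -
  have "exec I R M (Walk x a) s (bind_pmf (step I (Walk x a, s)) (\<lambda>cf. return_pmf (snd cf)))"
  proof (rule exec_step)
    fix cf
    assume "cf \<in> set_pmf (step I (Walk x a, s))"
    then obtain j where "cf = (Skip, s(x := int j))" "j < size_in I"
      using v set by auto
    moreover from this have "regs_bounded R M (s(x := int j))"
      using assms(1-3) by (intro regs_bounded_upd) auto
    ultimately show "exec I R M (fst cf) (snd cf) (return_pmf (snd cf))"
      using exec_Skip by simp
  qed (use assms in auto)
  then show ?thesis
    using v by (simp add: map_pmf_def[symmetric] map_pmf_comp)
qed

lemma exec_If_true:
  "regs_bounded R M s \<Longrightarrow> aval a s > 0 \<Longrightarrow> exec I R M c s \<mu> \<Longrightarrow> exec I R M (If a c d) s \<mu>"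
  by (rule exec_det_step) auto

lemma exec_If_false:
  "regs_bounded R M s \<Longrightarrow> aval a s \<le> 0 \<Longrightarrow> exec I R M d s \<mu> \<Longrightarrow> exec I R M (If a c d) s \<mu>"
  by (rule exec_det_step) auto

lemma exec_While_false:
  "regs_bounded R M s \<Longrightarrow> aval a s \<le> 0 \<Longrightarrow> exec I R M (While a c) s (return_pmf s)"
  by (rule exec_det_step) (auto intro!: exec_If_false exec_Skip)

lemma exec_While_true:
  assumes "aval a s > 0" "exec I R M (Seq c (While a c)) s \<mu>"
  shows "exec I R M (While a c) s \<mu>"
  using exec_start[OF assms(2)]
  by (intro exec_det_step[OF _ _ _ exec_If_true[OF _ assms]]) auto

lemma exec_While_det:
  assumes body: "\<And>j. j < k \<Longrightarrow> aval a (f j) > 0 \<and> exec I R M c (f j) (return_pmf (f (Suc j)))"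
    and last: "aval a (f k) \<le> 0" "regs_bounded R M (f k)"
    and s: "s = f 0"
  shows "exec I R M (While a c) s (return_pmf (f k))"
proof -
  \<comment> \<open>Induction backwards from the exit: \<open>j\<close> is the number of rounds
    still to come.\<close>
  have "exec I R M (While a c) (f (k - j)) (return_pmf (f k))" if "j \<le> k" for j
    using that
  proof (induction j)
    case 0
    then show ?case using last by (auto intro!: exec_While_false)
  next
    case (Suc j)
    then have eq: "Suc (k - Suc j) = k - j" and less: "k - Suc j < k"
      by auto
    have "exec I R M c (f (k - Suc j)) (return_pmf (f (k - j)))"
      using body[OF less] unfolding eq by blast
    moreover have "exec I R M (While a c) (f (k - j)) (return_pmf (f k))"
      using Suc by auto
    ultimately show ?case
      using body[OF less] exec_While_true[OF _ exec_Seq_det] by blast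
  qed
  from this[of k] show ?thesis by (simp add: s)
qed

section \<open>Derivations of \<open>exec\<close> and the steps of \<open>run\<close>\<close>

fun run_from :: "lap_input \<Rightarrow> nat \<Rightarrow> config \<Rightarrow> config pmf" where
  "run_from I 0 cf = return_pmf cf"
| "run_from I (Suc t) cf = bind_pmf (step I cf) (run_from I t)"

text \<open>\<open>run\<close> appends a step at the end, whereas a derivation of
  \<open>exec\<close> peels off the first one. Associativity of \<open>bind_pmf\<close> reconciles
  the two.\<close>

lemma bind_run_from_step: "bind_pmf (run_from I t cf) (step I) = run_from I (Suc t) cf"
proof (induction t arbitrary: cf)
  case 0
  have "run_from I 0 = return_pmf" by (rule ext) simp
  then show ?case by (simp add: bind_return_pmf bind_return_pmf')
next
  case (Suc t)
  then show ?case by (simp add: bind_assoc_pmf cong: bind_pmf_cong)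
qed

lemma run_eq_run_from: "run I P t = run_from I t (P, \<lambda>_. 0)"
  by (induction t) (simp_all only: run.simps bind_run_from_step run_from.simps(1))

lemma run_from_Skip: "run_from I t (Skip, s) = return_pmf (Skip, s)"
  by (induction t) (simp_all add: bind_return_pmf)

lemma finite_set_walk_pmf: "finite (set_pmf (walk_pmf n w v))"
proof (cases "(\<forall>j<n. w v j \<ge> 0) \<and> deg n w v > 0")
  case True
  then have "set_pmf (walk_pmf n w v) \<subseteq> {..<n}"
    by (auto simp: set_pmf_iff pmf_walk_pmf split: if_splits)
  then show ?thesis by (rule finite_subset) simp
next
  case False
  then have "walk_pmf n w v = return_pmf v"
    unfolding walk_pmf_def by (rule if_not_P)
  then show ?thesis by simp
qed

text \<open>Finite branching turns the halting times of the individual successors into one halting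
  time, their maximum.\<close>

lemma finite_set_step: "finite (set_pmf (step I (c, s)))"
proof (induction c)
  case (Seq c d)
  then show ?case by simp
qed (auto simp: finite_set_walk_pmf Let_def)

text \<open>The first claim speaks of all late \<open>t\<close>, because successors may halt at
  different times and have to be compared at a common one.\<close>

lemma exec_run_from:
  assumes "exec I R M c s \<mu>"
  shows "\<exists>T. \<forall>t\<ge>T. run_from I t (c, s) = map_pmf (Pair Skip) \<mu>"
    and "cf \<in> set_pmf (run_from I t (c, s)) \<Longrightarrow> regs_bounded R M (snd cf)"
proof -
  show "\<exists>T. \<forall>t\<ge>T. run_from I t (c, s) = map_pmf (Pair Skip) \<mu>"
    using assms
  proof (induction rule: exec.induct)
    case (exec_Skip s)
    then show ?case by (simp add: run_from_Skip)
  next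
    case (exec_step c s f)
    let ?X = "set_pmf (step I (c, s))"
    obtain T where T: "\<And>cf t. cf \<in> ?X \<Longrightarrow> t \<ge> T cf \<Longrightarrow>
        run_from I t cf = map_pmf (Pair Skip) (f cf)"
      using exec_step.IH by (metis prod.collapse)
    have "run_from I t (c, s) = map_pmf (Pair Skip) (bind_pmf (step I (c, s)) f)"
      if t: "t \<ge> Suc (Max (T ` ?X))" for t
    proof -
      obtain t' where t': "t = Suc t'" "t' \<ge> Max (T ` ?X)"
        using t by (cases t) auto
      have "t' \<ge> T cf" if "cf \<in> ?X" for cf
        using t'(2) that by (meson Max_ge finite_imageI finite_set_step imageI le_trans)
      then show ?thesis
        using T by (auto simp: t'(1) map_bind_pmf intro!: bind_pmf_cong)
    qed
    then show ?case by blast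
  qed
  show "regs_bounded R M (snd cf)" if "cf \<in> set_pmf (run_from I t (c, s))" for cf t
    using assms that
  proof (induction arbitrary: cf t rule: exec.induct)
    case (exec_Skip s)
    then show ?case by (simp add: run_from_Skip)
  next
    case (exec_step c s f)
    show ?case
    proof (cases t)
      case 0
      then show ?thesis using exec_step by simp
    next
      case (Suc t')
      then obtain cf' where "cf' \<in> set_pmf (step I (c, s))" "cf \<in> set_pmf (run_from I t' cf')"
        using exec_step.prems by auto
      then show ?thesis
        using exec_step.IH by (metis prod.collapse)
    qed
  qed
qed

lemma exec_program:
  assumes "exec I R M P (\<lambda>_. 0) \<mu>"
  shows "\<exists>t. halts_by I P t \<and> run I P t = map_pmf (Pair Skip) \<mu>"
    and "real_of_int (int R * bitlen M) \<le> S \<Longrightarrow> space_bounded I P S"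
proof -
  obtain t where "run I P t = map_pmf (Pair Skip) \<mu>"
    using exec_run_from(1)[OF assms] unfolding run_eq_run_from by blast
  then show "\<exists>t. halts_by I P t \<and> run I P t = map_pmf (Pair Skip) \<mu>"
    by (intro exI[of _ t]) (auto simp: halts_by_def halted_def)
  assume S: "real_of_int (int R * bitlen M) \<le> S"
  show "space_bounded I P S"
    unfolding space_bounded_def
  proof (intro allI ballI)
    fix t cf
    assume "cf \<in> set_pmf (run I P t)"
    then have "regs_bounded R M (snd cf)"
      using exec_run_from(2)[OF assms] unfolding run_eq_run_from by blast
    then show "real_of_int (store_bits (snd cf)) \<le> S"
      using S store_bits_le by (meson of_int_le_iff order_trans)
  qed
qed

section \<open>The lazy random walk on a connected graph\<close>

text \<open>A second vertex makes position 1 of the eigenvalue list exist and, with connectedness,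
  gives every vertex an edge to leave by, hence a positive degree.\<close>

locale connected_weighted_graph =
  fixes n :: nat and w :: "nat \<Rightarrow> nat \<Rightarrow> real"
  assumes n2: "2 \<le> n" and weighted: "weighted_graph n w" and connected: "connected_graph n w"
begin

abbreviation d :: "nat \<Rightarrow> real" where "d \<equiv> deg n w"

lemma w_nonneg: "i < n \<Longrightarrow> j < n \<Longrightarrow> 0 \<le> w i j"
  and w_sym: "i < n \<Longrightarrow> j < n \<Longrightarrow> w i j = w j i"
  using weighted by (auto simp: weighted_graph_def)

lemma ex_neighbour:
  assumes "i < n"
  shows "\<exists>j<n. w i j > 0"
proof -
  obtain k where k: "k < n" "k \<noteq> i"
    using n2 that[of "if i = 0 then 1 else 0"] by auto
  then have "(i, k) \<in> (edges n w)\<^sup>*"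
    using connected assms by (simp add: connected_graph_def)
  then obtain j where "(i, j) \<in> edges n w"
    using k by (metis converse_rtranclE)
  then show ?thesis by (auto simp: edges_def)
qed

lemma d_pos:
  assumes "i < n"
  shows "0 < d i"
proof -
  obtain j where j: "j < n" "w i j > 0"
    using ex_neighbour[OF assms] by blast
  then have "w i j \<le> d i"
    unfolding deg_def using assms by (intro member_le_sum) (auto intro: w_nonneg)
  with j show ?thesis by simp
qed

definition avg :: "(nat \<Rightarrow> real) \<Rightarrow> nat \<Rightarrow> real" where
  "avg f i = (\<Sum>j<n. w i j / d i * f j)"

definition lazy :: "(nat \<Rightarrow> real) \<Rightarrow> nat \<Rightarrow> real" where
  "lazy f i = (f i + avg f i) / 2"

text \<open>The degrees are the unnormalised stationary distribution; this weighting makes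
  \<open>avg\<close> self-adjoint, see \<open>ip_avg_commute\<close>.\<close>

definition ip :: "(nat \<Rightarrow> real) \<Rightarrow> (nat \<Rightarrow> real) \<Rightarrow> real" where
  "ip f g = (\<Sum>i<n. d i * f i * g i)"

definition dirichlet :: "(nat \<Rightarrow> real) \<Rightarrow> real" where
  "dirichlet f = (\<Sum>i<n. \<Sum>j<n. w i j * (f i - f j)\<^sup>2) / 2"

lemma ip_commute: "ip f g = ip g f"
  by (simp add: ip_def ac_simps)

lemma ip_add: "ip f (\<lambda>i. g i + h i) = ip f g + ip f h"
  by (simp add: ip_def algebra_simps sum.distrib)

lemma ip_diff: "ip f (\<lambda>i. g i - h i) = ip f g - ip f h"
  by (simp add: ip_def algebra_simps sum_subtractf)

lemma ip_scale: "ip f (\<lambda>i. c * g i) = c * ip f g"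
  by (simp add: ip_def algebra_simps sum_distrib_left)

lemma ip_add_left: "ip (\<lambda>i. g i + h i) f = ip g f + ip h f"
  by (simp add: ip_def algebra_simps sum.distrib)

lemma ip_diff_left: "ip (\<lambda>i. g i - h i) f = ip g f - ip h f"
  by (simp add: ip_def algebra_simps sum_subtractf)

lemma ip_scale_left: "ip (\<lambda>i. c * g i) f = c * ip g f"
  by (simp add: ip_def algebra_simps sum_distrib_left)

lemma ip_nonneg: "0 \<le> ip f f"
  unfolding ip_def by (intro sum_nonneg) (simp add: d_pos less_imp_le mult.assoc)

lemma ip_cong: "(\<And>i. i < n \<Longrightarrow> f i = f' i) \<Longrightarrow> (\<And>i. i < n \<Longrightarrow> g i = g' i) \<Longrightarrow> ip f g = ip f' g'"
  by (simp add: ip_def)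

lemma entry_le_ip:
  assumes "i < n"
  shows "d i * (f i)\<^sup>2 \<le> ip f f"
proof -
  have "d i * f i * f i \<le> (\<Sum>i<n. d i * f i * f i)"
    using assms by (intro member_le_sum) (auto simp: mult.assoc d_pos less_imp_le)
  then show ?thesis by (simp add: ip_def power2_eq_square mult.assoc)
qed

lemma ip_eq_0D:
  assumes "ip f f = 0" "i < n"
  shows "f i = 0"
proof -
  have "d i * (f i)\<^sup>2 \<le> 0"
    using entry_le_ip[of i f] assms by simp
  moreover have "0 \<le> d i * (f i)\<^sup>2"
    using d_pos[OF assms(2)] by simp
  ultimately show ?thesis
    using d_pos[OF assms(2)] by simp
qed

lemma ip_avg: "ip f (avg g) = (\<Sum>i<n. \<Sum>j<n. w i j * (f i * g j))"
proof -
  have "d i * f i * (w i j / d i * g j) = w i j * (f i * g j)" if "i < n" for i j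
    using d_pos[OF that] by simp
  then show ?thesis
    by (simp add: ip_def avg_def sum_distrib_left)
qed

lemma ip_avg_commute: "ip f (avg g) = ip g (avg f)"
  unfolding ip_avg by (subst sum.swap) (simp add: w_sym mult.commute)

lemma sum_w_left: "(\<Sum>i<n. \<Sum>j<n. w i j * (f i)\<^sup>2) = ip f f"
  by (simp add: ip_def deg_def sum_distrib_right[symmetric] power2_eq_square mult.assoc)

lemma sum_w_right: "(\<Sum>i<n. \<Sum>j<n. w i j * (f j)\<^sup>2) = ip f f"
  unfolding sum_w_left[symmetric] by (subst sum.swap) (simp add: w_sym)

lemma dirichlet_eq: "dirichlet f = ip f f - ip f (avg f)"
proof -
  have "w i j * (f i - f j)\<^sup>2 = w i j * (f i)\<^sup>2 + w i j * (f j)\<^sup>2 - 2 * (w i j * (f i * f j))" for i j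
    by (simp add: power2_eq_square algebra_simps)
  then have "(\<Sum>i<n. \<Sum>j<n. w i j * (f i - f j)\<^sup>2) = ip f f + ip f f - 2 * ip f (avg f)"
    by (simp add: sum.distrib sum_subtractf sum_w_left sum_w_right ip_avg sum_distrib_left)
  then show ?thesis by (simp add: dirichlet_def)
qed

lemma dirichlet_nonneg: "0 \<le> dirichlet f"
  unfolding dirichlet_def by (auto intro!: sum_nonneg divide_nonneg_nonneg mult_nonneg_nonneg w_nonneg)

lemma avg_const: "i < n \<Longrightarrow> avg (\<lambda>_. c) i = c"
  using d_pos[of i] by (simp add: avg_def sum_divide_distrib[symmetric] sum_distrib_right[symmetric] deg_def)

lemma ip_one_avg: "ip (\<lambda>_. 1) (avg f) = ip (\<lambda>_. 1) f"
proof -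
  have "ip (\<lambda>_. 1) (avg f) = ip f (avg (\<lambda>_. 1))"
    by (rule ip_avg_commute)
  also have "\<dots> = ip f (\<lambda>_. 1)"
    by (rule ip_cong) (simp_all add: avg_const)
  finally show ?thesis by (simp add: ip_commute)
qed

lemma ip_one_lazy: "ip (\<lambda>_. 1) (lazy f) = ip (\<lambda>_. 1) f"
proof -
  have "lazy f = (\<lambda>i. 1 / 2 * (f i + avg f i))"
    by (auto simp: lazy_def)
  then show ?thesis
    by (simp only: ip_scale ip_add ip_one_avg) simp
qed

text \<open>\<open>2 * x * y \<le> x\<^sup>2 + y\<^sup>2\<close> with \<open>x = avg f i\<close> and
  \<open>y = f j\<close> is summed against the weights; one copy of the left side reappears on the
  right and cancels.\<close>

lemma avg_contraction: "ip (avg f) (avg f) \<le> ip f f"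
proof -
  have "2 * ip (avg f) (avg f) = (\<Sum>i<n. \<Sum>j<n. 2 * (w i j * (avg f i * f j)))"
    by (simp add: ip_avg sum_distrib_left)
  also have "\<dots> \<le> (\<Sum>i<n. \<Sum>j<n. w i j * (avg f i)\<^sup>2 + w i j * (f j)\<^sup>2)"
  proof (intro sum_mono)
    fix i j assume ij: "i \<in> {..<n}" "j \<in> {..<n}"
    have "2 * (avg f i * f j) \<le> (avg f i)\<^sup>2 + (f j)\<^sup>2"
      using sum_squares_bound[of "avg f i" "f j"] by simp
    then have "w i j * (2 * (avg f i * f j)) \<le> w i j * ((avg f i)\<^sup>2 + (f j)\<^sup>2)"
      using ij by (intro mult_left_mono) (auto simp: w_nonneg)
    then show "2 * (w i j * (avg f i * f j)) \<le> w i j * (avg f i)\<^sup>2 + w i j * (f j)\<^sup>2"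
      by (simp add: algebra_simps)
  qed
  also have "\<dots> = ip (avg f) (avg f) + ip f f"
    by (simp add: sum.distrib sum_w_left sum_w_right)
  finally show ?thesis by simp
qed

text \<open>Expanding the square of \<open>(f + avg f) / 2\<close> leaves
  \<open>ip (avg f) (avg f)\<close>, at most \<open>ip f f\<close>, and
  \<open>ip f (avg f) = ip f f - dirichlet f\<close>. Only the Dirichlet form remains, so the
  negative part of the spectrum is harmless.\<close>

lemma lazy_contraction: "ip (lazy f) (lazy f) \<le> ip f f - dirichlet f / 2"
proof -
  have eq: "lazy f = (\<lambda>i. 1 / 2 * (f i + avg f i))"
    by (auto simp: lazy_def)
  have "ip (lazy f) (lazy f) = (ip f f + 2 * ip f (avg f) + ip (avg f) (avg f)) / 4"
    unfolding eq
    by (simp only: ip_scale ip_scale_left ip_add ip_add_left ip_commute[of "avg f" f])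
       (simp add: field_simps)
  then show ?thesis
    using avg_contraction[of f] by (simp add: dirichlet_eq field_simps)
qed

lemma dirichlet_0_const:
  assumes "dirichlet f = 0" "i < n" "j < n"
  shows "f i = f j"
proof -
  have nonneg: "0 \<le> w i j * (f i - f j)\<^sup>2" if "i < n" "j < n" for i j
    using that by (simp add: w_nonneg)
  have "(\<Sum>i<n. \<Sum>j<n. w i j * (f i - f j)\<^sup>2) = 0"
    using assms(1) by (simp add: dirichlet_def)
  then have "\<forall>i\<in>{..<n}. (\<Sum>j<n. w i j * (f i - f j)\<^sup>2) = 0"
    by (subst (asm) sum_nonneg_eq_0_iff) (auto intro!: sum_nonneg nonneg)
  then have 0: "w i j * (f i - f j)\<^sup>2 = 0" if "i < n" "j < n" for i j
    using that sum_nonneg_0[of "{..<n}" "\<lambda>j. w i j * (f i - f j)\<^sup>2" j] nonneg by simp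
  have "(i, j) \<in> (edges n w)\<^sup>*"
    using connected assms by (simp add: connected_graph_def)
  then show ?thesis
    by (induction rule: rtrancl_induct) (use 0 in \<open>force simp: edges_def\<close>)+
qed

end

section \<open>The spectral gap as the minimum of a Rayleigh quotient\<close>

lemma linear_term_zero:
  fixes a b :: real
  assumes "\<And>t. 0 \<le> 2 * t * a + t\<^sup>2 * b"
  shows "a = 0"
proof (rule ccontr)
  assume a: "a \<noteq> 0"
  \<comment> \<open>At \<open>t = - a / c\<close> the quadratic is
    \<open>a\<^sup>2 / c * (b / c - 2)\<close>, which is negative as soon as \<open>c\<close> is
    positive and exceeds \<open>b\<close>.\<close>
  define c where "c = \<bar>b\<bar> + 1"
  have c: "c > 0" "b < c" by (simp_all add: c_def)
  have "2 * (- a / c) * a + (- a / c)\<^sup>2 * b = a\<^sup>2 / c * (b / c - 2)"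
    using c by (simp add: power2_eq_square field_simps)
  also have "\<dots> < 0"
    using a c by (intro mult_pos_neg) (auto simp: field_simps)
  finally show False
    using assms[of "- a / c"] by simp
qed

context connected_weighted_graph
begin

text \<open>Functions on all of \<open>nat\<close> stand for vectors; fixing the values outside
  \<open>{..<n}\<close> to 0 makes the set compact in the product topology.\<close>

definition unit_orth :: "(nat \<Rightarrow> real) set" where
  "unit_orth = {f. (\<forall>i\<ge>n. f i = 0) \<and> ip f f = 1 \<and> ip (\<lambda>_. 1) f = 0}"

text \<open>A closed subset of a product of intervals, compact by Tychonoff; the radius
  \<open>1 / sqrt (d i)\<close> comes from \<open>d i * (f i)\<^sup>2 \<le> ip f f\<close>.\<close>

lemma compact_unit_orth: "compact unit_orth"
proof -
  let ?B = "PiE UNIV (\<lambda>i. if i < n then {- (1 / sqrt (d i))..1 / sqrt (d i)} else {0::real})"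
  have "compactin (product_topology (\<lambda>_. euclidean) UNIV) ?B"
    unfolding compactin_PiE by auto
  then have "compact ?B"
    by (simp add: euclidean_product_topology)
  moreover have "closed unit_orth"
  proof -
    have "unit_orth = (\<Inter>i\<in>{n..}. {f. f i = 0}) \<inter> {f. ip f f = 1} \<inter> {f. ip (\<lambda>_. 1) f = 0}"
      by (auto simp: unit_orth_def)
    moreover have "closed {f::nat \<Rightarrow> real. f i = 0}" for i
      by (intro closed_Collect_eq continuous_on_product_coordinates continuous_intros)
    ultimately show ?thesis
      unfolding ip_def
      by (auto intro!: closed_Int closed_INT closed_Collect_eq continuous_intros
        continuous_on_product_coordinates)
  qed
  moreover have "unit_orth \<subseteq> ?B"
  proof
    fix f assume f: "f \<in> unit_orth"
    have "\<bar>f i\<bar> \<le> 1 / sqrt (d i)" if "i < n" for i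
    proof -
      have "d i * (f i)\<^sup>2 \<le> 1"
        using entry_le_ip[OF that, of f] f by (simp add: unit_orth_def)
      then have "sqrt ((f i)\<^sup>2) \<le> sqrt (1 / d i)"
        using d_pos[OF that] by (intro real_sqrt_le_mono) (simp add: field_simps)
      then show ?thesis by (simp add: real_sqrt_divide)
    qed
    then show "f \<in> ?B"
      using f by (auto simp: unit_orth_def abs_le_iff minus_le_iff)
  qed
  ultimately show ?thesis
    using closed_Int_compact[of unit_orth ?B] by (simp add: Int_absorb2)
qed

text \<open>The linear coefficient identifies \<open>f - avg f\<close> as half the gradient of the
  form with respect to \<open>ip\<close>. It supplies the first variation at a minimiser.\<close>

lemma dirichlet_add:
  "dirichlet (\<lambda>i. f i + t * g i) = dirichlet f + 2 * t * ip (\<lambda>i. f i - avg f i) g + t\<^sup>2 * dirichlet g"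
proof -
  have "(\<Sum>i<n. \<Sum>j<n. w i j * ((f i - f j) * (g i - g j))) = 2 * ip (\<lambda>i. f i - avg f i) g"
  proof -
    have "w i j * ((f i - f j) * (g i - g j))
        = (w i j * (f i * g i) + w i j * (f j * g j)) - (w i j * (f i * g j) + w i j * (g i * f j))" for i j
      by (simp add: algebra_simps)
    moreover have "(\<Sum>i<n. \<Sum>j<n. w i j * (f i * g i)) = ip f g"
      by (simp add: ip_def deg_def sum_distrib_right[symmetric] mult.assoc)
    moreover from this have "(\<Sum>i<n. \<Sum>j<n. w i j * (f j * g j)) = ip f g"
      by (subst sum.swap) (simp add: w_sym)
    moreover have "ip (\<lambda>i. f i - avg f i) g = ip f g - ip f (avg g)"
      by (simp only: ip_diff_left ip_commute[of "avg f" g] ip_avg_commute[of g f])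
    ultimately show ?thesis
      by (simp add: sum.distrib sum_subtractf ip_avg[symmetric] ip_avg_commute[of g f])
  qed
  moreover have "w i j * (f i + t * g i - (f j + t * g j))\<^sup>2 = w i j * (f i - f j)\<^sup>2
      + (2 * t) * (w i j * ((f i - f j) * (g i - g j))) + t\<^sup>2 * (w i j * (g i - g j)\<^sup>2)" for i j
    by (simp add: power2_eq_square algebra_simps)
  ultimately show ?thesis
    by (simp add: dirichlet_def sum.distrib sum_distrib_left[symmetric] add_divide_distrib)
qed

lemma dirichlet_scale: "dirichlet (\<lambda>i. c * f i) = c\<^sup>2 * dirichlet f"
  by (simp add: dirichlet_def sum_distrib_left power2_eq_square algebra_simps)

lemma ip_add_scaled: "ip (\<lambda>i. f i + t * g i) (\<lambda>i. f i + t * g i) = ip f f + 2 * t * ip f g + t\<^sup>2 * ip g g"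
  by (simp add: ip_def power2_eq_square algebra_simps sum.distrib sum_distrib_left)

text \<open>A minimiser of the Rayleigh quotient on the orthogonal complement of the constants is an
  eigenvector of the random walk.\<close>

lemma poincare_eigenvector:
  assumes "ip f f \<noteq> 0" "ip (\<lambda>_. 1) f = 0"
  obtains g \<mu> where "ip g g = 1" "ip (\<lambda>_. 1) g = 0" "dirichlet g = \<mu>"
    "\<And>i. i < n \<Longrightarrow> g i - avg g i = \<mu> * g i"
    "\<And>f. ip (\<lambda>_. 1) f = 0 \<Longrightarrow> \<mu> * ip f f \<le> dirichlet f"
proof -
  \<comment> \<open>Normalising and cutting off outside the vertex set moves a competitor into
    \<open>unit_orth\<close> without changing its Rayleigh quotient.\<close>
  define res :: "(nat \<Rightarrow> real) \<Rightarrow> nat \<Rightarrow> real" where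
    "res f = (\<lambda>i. if i < n then 1 / sqrt (ip f f) * f i else 0)" for f
  have ip_res: "ip (res f) (res f) = 1" "ip (\<lambda>_. 1) (res f) = 0"
    "dirichlet (res f) = dirichlet f / ip f f"
    if "ip f f \<noteq> 0" "ip (\<lambda>_. 1) f = 0" for f
  proof -
    have 1: "ip (res f) (res f) = ip (\<lambda>i. 1 / sqrt (ip f f) * f i) (\<lambda>i. 1 / sqrt (ip f f) * f i)"
      by (rule ip_cong) (auto simp: res_def)
    show "ip (res f) (res f) = 1"
      unfolding 1 using that ip_nonneg[of f]
      by (simp only: ip_scale ip_scale_left) (simp add: field_simps)
    have 2: "ip (\<lambda>_. 1) (res f) = ip (\<lambda>_. 1) (\<lambda>i. 1 / sqrt (ip f f) * f i)"
      by (rule ip_cong) (auto simp: res_def)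
    then show "ip (\<lambda>_. 1) (res f) = 0"
      by (simp only: ip_scale that)
    have "dirichlet (res f) = dirichlet (\<lambda>i. 1 / sqrt (ip f f) * f i)"
      by (simp add: dirichlet_def res_def)
    then show "dirichlet (res f) = dirichlet f / ip f f"
      using ip_nonneg[of f] by (simp only: dirichlet_scale) (simp add: power_divide)
  qed
  have "res f \<in> unit_orth"
    using ip_res[OF assms] by (auto simp: unit_orth_def res_def)
  moreover have "continuous_on unit_orth dirichlet"
    unfolding dirichlet_def
    by (auto intro!: continuous_intros continuous_on_subset[OF continuous_on_product_coordinates])
  ultimately obtain g where g: "g \<in> unit_orth" and min: "\<And>f. f \<in> unit_orth \<Longrightarrow> dirichlet g \<le> dirichlet f"
    using continuous_attains_inf[OF compact_unit_orth] by blast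
  define \<mu> where "\<mu> = dirichlet g"
  have g1: "ip g g = 1" "ip (\<lambda>_. 1) g = 0"
    using g by (auto simp: unit_orth_def)
  have poin: "\<mu> * ip f f \<le> dirichlet f" if "ip (\<lambda>_. 1) f = 0" for f
  proof (cases "ip f f = 0")
    case False
    then have "\<mu> \<le> dirichlet f / ip f f"
      using min[of "res f"] ip_res[OF False that] by (auto simp: unit_orth_def res_def \<mu>_def)
    then show ?thesis
      using False ip_nonneg[of f] by (simp add: field_simps)
  qed (use dirichlet_nonneg in auto)
  \<comment> \<open>The residual of the eigenvalue equation. By the first variation it is orthogonal
    to every \<open>y\<close> in the complement of the constants; it lies there itself, so
    \<open>y = h\<close> forces \<open>ip h h = 0\<close>.\<close>
  define h where "h = (\<lambda>i. (g i - avg g i) - \<mu> * g i)"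
  have h_orth: "ip (\<lambda>_. 1) h = 0"
    unfolding h_def by (simp only: ip_diff ip_scale ip_one_avg g1)
  have "ip h y = 0" if y: "ip (\<lambda>_. 1) y = 0" for y
  proof (rule linear_term_zero)
    fix t :: real
    have "ip (\<lambda>_. 1) (\<lambda>i. g i + t * y i) = 0"
      by (simp only: ip_add ip_scale y g1)
    from poin[OF this]
    have "\<mu> * (1 + 2 * t * ip g y + t\<^sup>2 * ip y y)
        \<le> \<mu> + 2 * t * ip (\<lambda>i. g i - avg g i) y + t\<^sup>2 * dirichlet y"
      unfolding dirichlet_add ip_add_scaled by (simp add: g1 \<mu>_def)
    moreover have "ip h y = ip (\<lambda>i. g i - avg g i) y - \<mu> * ip g y"
      unfolding h_def by (simp only: ip_diff_left ip_scale_left)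
    ultimately show "0 \<le> 2 * t * ip h y + t\<^sup>2 * (dirichlet y - \<mu> * ip y y)"
      by (simp only:) (simp add: algebra_simps)
  qed
  from ip_eq_0D[OF this[OF h_orth]] have "g i - avg g i = \<mu> * g i" if "i < n" for i
    using that by (simp add: h_def)
  then show ?thesis
    using g1 poin that \<mu>_def by blast
qed

end

section \<open>The normalized Laplacian and its pseudo-inverse\<close>

text \<open>An entry that exceeds another one cannot stand at position 0 of a sorted list. Used with
  \<open>x = 0\<close> and a positive eigenvalue \<open>y\<close>.\<close>

lemma sorted_nth_1_le:
  assumes "sorted xs" "x \<in> set xs" "y \<in> set xs" "x < (y::real)"
  shows "xs ! 1 \<le> y"
proof -
  obtain a b where a: "a < length xs" "xs ! a = x" and b: "b < length xs" "xs ! b = y"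
    using assms(2,3) by (auto simp: in_set_conv_nth)
  have "1 \<le> b"
  proof (rule ccontr)
    assume "\<not> 1 \<le> b"
    then have "y \<le> x"
      using sorted_nth_mono[OF assms(1), of b a] a b by simp
    with assms(4) show False by simp
  qed
  then show ?thesis
    using sorted_nth_mono[OF assms(1), of 1 b] b by simp
qed

lemma zero_mult_vec:
  fixes v :: "real Matrix.vec"
  assumes "v \<in> carrier_vec n"
  shows "0\<^sub>m m n *\<^sub>v v = 0\<^sub>v m"
  using assms by (intro eq_vecI) (auto simp: scalar_prod_def)

lemma mult_zero_vec:
  fixes A :: "real mat"
  assumes "A \<in> carrier_mat m n"
  shows "A *\<^sub>v 0\<^sub>v n = 0\<^sub>v m"
  using assms by (intro eq_vecI) (auto simp: scalar_prod_def)

lemma minus_zero_mat: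
  fixes A :: "real mat"
  assumes "A \<in> carrier_mat m n"
  shows "A - 0\<^sub>m m n = A"
  using assms by (intro eq_matI) auto

context connected_weighted_graph
begin

text \<open>Conjugation by the square roots of the degrees: it carries the normalized Laplacian to
  \<open>f - avg f\<close> and the Euclidean inner product to \<open>ip\<close>.\<close>

definition scaled :: "real Matrix.vec \<Rightarrow> nat \<Rightarrow> real" where
  "scaled x i = x $ i / sqrt (d i)"

lemma laplacian_carrier [simp]: "laplacian n w \<in> carrier_mat n n"
  by (simp add: laplacian_def)

lemma laplacian_index:
  assumes "i < n" "j < n"
  shows "laplacian n w $$ (i, j) = (if i = j then 1 else 0) - w i j / (sqrt (d i) * sqrt (d j))"
proof (cases "i = j")
  case True
  then show ?thesis
    using assms d_pos[of i] by (simp add: laplacian_def)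
next
  case False
  then show ?thesis
    using assms w_nonneg[of i j] by (auto simp: laplacian_def edges_def real_sqrt_mult)
qed

lemma laplacian_mult:
  assumes x: "x \<in> carrier_vec n" and i: "i < n"
  shows "(laplacian n w *\<^sub>v x) $ i = sqrt (d i) * (scaled x i - avg (scaled x) i)"
proof -
  have sq: "sqrt (d j) > 0" if "j < n" for j
    using d_pos[OF that] by simp
  have "(laplacian n w *\<^sub>v x) $ i = (\<Sum>j<n. laplacian n w $$ (i, j) * x $ j)"
    using x i by (auto simp: scalar_prod_def lessThan_atLeast0 carrier_matD[OF laplacian_carrier] intro!: sum.cong)
  also have "\<dots> = (\<Sum>j<n. (if i = j then x $ j else 0) - w i j / (sqrt (d i) * sqrt (d j)) * x $ j)"
    using i by (intro sum.cong) (auto simp: laplacian_index algebra_simps)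
  also have "\<dots> = x $ i - (\<Sum>j<n. w i j / (sqrt (d i) * sqrt (d j)) * x $ j)"
    using i by (simp add: sum_subtractf)
  also have "(\<Sum>j<n. w i j / (sqrt (d i) * sqrt (d j)) * x $ j)
      = (\<Sum>j<n. sqrt (d i) * (w i j / d i * scaled x j))"
  proof (intro sum.cong refl)
    fix j assume j: "j \<in> {..<n}"
    have "d i = sqrt (d i) * sqrt (d i)"
      using d_pos[OF i] by simp
    then have "w i j / d i = w i j / (sqrt (d i) * sqrt (d i))"
      by simp
    then show "w i j / (sqrt (d i) * sqrt (d j)) * x $ j = sqrt (d i) * (w i j / d i * scaled x j)"
      using sq[of j] sq[OF i] j by (simp add: scaled_def field_simps)
  qed
  also have "\<dots> = sqrt (d i) * avg (scaled x) i"
    by (simp add: avg_def sum_distrib_left)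
  also have "x $ i = sqrt (d i) * scaled x i"
    using sq[OF i] by (simp add: scaled_def)
  finally show ?thesis
    by (simp add: right_diff_distrib)
qed

lemma scaled_vec:
  assumes "i < n"
  shows "scaled (Matrix.vec n (\<lambda>i. sqrt (d i) * g i)) i = g i"
  using assms d_pos[OF assms] by (simp add: scaled_def)

lemma avg_cong: "(\<And>j. j < n \<Longrightarrow> f j = g j) \<Longrightarrow> avg f i = avg g i"
  by (simp add: avg_def)

lemma eigenvalue_laplacian:
  assumes g: "\<And>i. i < n \<Longrightarrow> g i - avg g i = \<mu> * g i" and i: "i < n" "g i \<noteq> 0"
  shows "eigenvalue (laplacian n w) \<mu>"
proof -
  let ?v = "Matrix.vec n (\<lambda>i. sqrt (d i) * g i)"
  have "laplacian n w *\<^sub>v ?v = \<mu> \<cdot>\<^sub>v ?v"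
  proof (rule eq_vecI)
    fix j assume "j < dim_vec (\<mu> \<cdot>\<^sub>v ?v)"
    then have j: "j < n" by simp
    have "avg (scaled ?v) j = avg g j"
      by (rule avg_cong) (rule scaled_vec)
    then show "(laplacian n w *\<^sub>v ?v) $ j = (\<mu> \<cdot>\<^sub>v ?v) $ j"
      using j g[OF j] by (simp add: laplacian_mult scaled_vec)
  qed (simp add: carrier_matD[OF laplacian_carrier])
  moreover have "?v \<noteq> 0\<^sub>v n"
  proof
    assume "?v = 0\<^sub>v n"
    then have "?v $ i = 0\<^sub>v n $ i" by (rule arg_cong)
    then show False using i d_pos[of i] by simp
  qed
  ultimately show ?thesis
    unfolding eigenvalue_def eigenvector_def
    by (intro exI[of _ ?v]) (simp add: carrier_matD[OF laplacian_carrier])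
qed

text \<open>The constants give the eigenvalue 0, so a positive eigenvalue is preceded by another
  entry in the sorted list. The lemma is applied to the Rayleigh minimum.\<close>

lemma lambda2_le:
  assumes "eigenvalue (laplacian n w) \<mu>" "0 < \<mu>"
  shows "lambda2 n w \<le> \<mu>"
proof -
  have "eigenvalue (laplacian n w) 0"
    by (rule eigenvalue_laplacian[of "\<lambda>_. 1" 0 0]) (use n2 in \<open>auto simp: avg_const\<close>)
  moreover have "char_poly (laplacian n w) \<noteq> 0"
    using degree_monic_char_poly[OF laplacian_carrier] n2 by auto
  ultimately show ?thesis
    unfolding lambda2_def eigenvalue_list_def using assms
    by (intro sorted_nth_1_le[of _ 0])
       (auto simp: eigenvalue_root_char_poly[OF laplacian_carrier])
qed

text \<open>The Rayleigh minimum is an eigenvalue. Were it 0, connectedness would make its minimiser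
  constant, and orthogonality to the constants would make it vanish; so it is positive and
  \<open>lambda2_le\<close> applies.\<close>

lemma poincare:
  assumes "ip (\<lambda>_. 1) f = 0"
  shows "lambda2 n w * ip f f \<le> dirichlet f"
proof (cases "ip f f = 0")
  case False
  then obtain g \<mu> where g: "ip g g = 1" "ip (\<lambda>_. 1) g = 0" "dirichlet g = \<mu>"
    "\<And>i. i < n \<Longrightarrow> g i - avg g i = \<mu> * g i"
    and poin: "\<And>f. ip (\<lambda>_. 1) f = 0 \<Longrightarrow> \<mu> * ip f f \<le> dirichlet f"
    using poincare_eigenvector[OF _ assms] by blast
  obtain i where i: "i < n" "g i \<noteq> 0"
  proof (rule ccontr)
    assume "\<not> thesis"
    with that have "ip g g = ip (\<lambda>_. 0) (\<lambda>_. 0)"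
      by (intro ip_cong) auto
    with g show False by (simp add: ip_def)
  qed
  have "\<mu> \<noteq> 0"
  proof
    assume "\<mu> = 0"
    then have "g j = g i" if "j < n" for j
      using dirichlet_0_const g(3) that i(1) by blast
    then have "ip (\<lambda>_. 1) g = ip (\<lambda>_. 1) (\<lambda>_. g i)"
      by (intro ip_cong) auto
    also have "\<dots> = g i * (\<Sum>j<n. d j)"
      by (simp add: ip_def sum_distrib_left mult.commute)
    finally have "(\<Sum>j<n. d j) = 0"
      using g i by simp
    moreover have "(\<Sum>j<n. d j) > 0"
      using n2 by (intro sum_pos) (auto simp: d_pos lessThan_empty_iff)
    ultimately show False by simp
  qed
  then have "\<mu> > 0"
    using dirichlet_nonneg[of g] g(3) by simp
  then have "lambda2 n w \<le> \<mu>"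
    using lambda2_le eigenvalue_laplacian[OF g(4) i] by simp
  then have "lambda2 n w * ip f f \<le> \<mu> * ip f f"
    by (intro mult_right_mono ip_nonneg)
  with poin[OF assms] show ?thesis by simp
qed (simp add: dirichlet_nonneg)

section \<open>The kernel of the Laplacian and its orthogonal projection\<close>

lemma ip_one_scaled: "ip (\<lambda>_. 1) (scaled x) = (\<Sum>i<n. sqrt (d i) * x $ i)"
  unfolding ip_def scaled_def
proof (intro sum.cong refl)
  fix i assume "i \<in> {..<n}"
  then have "0 < d i" by (simp add: d_pos)
  then have "d i / sqrt (d i) = sqrt (d i)" by (rule real_div_sqrt[OF less_imp_le])
  moreover have "d i * 1 * (x $ i / sqrt (d i)) = d i / sqrt (d i) * x $ i"
    by simp
  ultimately show "d i * 1 * (x $ i / sqrt (d i)) = sqrt (d i) * x $ i"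
    by simp
qed

lemma ip_scaled: "ip (scaled x) (scaled x) = (\<Sum>i<n. (x $ i)\<^sup>2)"
  unfolding ip_def scaled_def
proof (intro sum.cong refl)
  fix i assume "i \<in> {..<n}"
  then have "0 < d i" by (simp add: d_pos)
  then show "d i * (x $ i / sqrt (d i)) * (x $ i / sqrt (d i)) = (x $ i)\<^sup>2"
    by (simp add: field_simps power2_eq_square)
qed

lemma laplacian_symmetric: "transpose_mat (laplacian n w) = laplacian n w"
  by (rule eq_matI) (auto simp: laplacian_index w_sym mult.commute carrier_matD[OF laplacian_carrier])

text \<open>The projection onto the kernel of the Laplacian, which is spanned by the square roots of
  the degrees.\<close>

definition kernel_proj :: "real mat" where
  "kernel_proj = Matrix.mat n n (\<lambda>(i, j). sqrt (d i) * sqrt (d j) / (\<Sum>k<n. d k))"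

lemma kernel_proj_carrier [simp]: "kernel_proj \<in> carrier_mat n n"
  by (simp add: kernel_proj_def)

lemma kernel_proj_symmetric: "transpose_mat kernel_proj = kernel_proj"
  by (rule eq_matI) (auto simp: kernel_proj_def mult.commute)

lemma sum_d_pos: "(\<Sum>j<n. d j) > 0"
  using n2 by (intro sum_pos) (auto simp: d_pos lessThan_empty_iff)

lemma kernel_proj_mult:
  assumes "x \<in> carrier_vec n" "i < n"
  shows "(kernel_proj *\<^sub>v x) $ i = sqrt (d i) * (ip (\<lambda>_. 1) (scaled x) / (\<Sum>k<n. d k))"
  unfolding ip_one_scaled using assms
  by (simp add: kernel_proj_def scalar_prod_def lessThan_atLeast0 sum_distrib_left sum_divide_distrib mult.assoc)

lemma laplacian_kernel_proj: "laplacian n w * kernel_proj = 0\<^sub>m n n"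
proof (rule eq_matI)
  fix i j assume "i < dim_row (0\<^sub>m n n :: real mat)" "j < dim_col (0\<^sub>m n n :: real mat)"
  then have ij: "i < n" "j < n" by auto
  have col: "col kernel_proj j = Matrix.vec n (\<lambda>i. sqrt (d i) * (sqrt (d j) / (\<Sum>k<n. d k)))"
    using ij by (intro eq_vecI) (auto simp: kernel_proj_def)
  have "(laplacian n w *\<^sub>v col kernel_proj j) $ i = 0"
  proof -
    have "avg (scaled (col kernel_proj j)) i = avg (\<lambda>_. sqrt (d j) / (\<Sum>k<n. d k)) i"
      unfolding col by (rule avg_cong) (rule scaled_vec)
    then show ?thesis
      using ij unfolding col
      by (subst laplacian_mult) (simp_all add: scaled_vec[where g = "\<lambda>_. sqrt (d j) / (\<Sum>k<n. d k)"] avg_const del: times_divide_eq_right)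
  qed
  then show "(laplacian n w * kernel_proj) $$ (i, j) = 0\<^sub>m n n $$ (i, j)"
    using ij by (simp add: carrier_matD[OF laplacian_carrier] carrier_matD[OF kernel_proj_carrier])
qed (simp_all add: carrier_matD[OF laplacian_carrier] carrier_matD[OF kernel_proj_carrier])

lemma kernel_proj_idem: "kernel_proj * kernel_proj = kernel_proj"
proof (rule eq_matI)
  fix i j assume "i < dim_row kernel_proj" "j < dim_col kernel_proj"
  then have ij: "i < n" "j < n" by (auto simp: carrier_matD[OF kernel_proj_carrier])
  have "(kernel_proj * kernel_proj) $$ (i, j)
      = (\<Sum>k<n. sqrt (d i) * sqrt (d j) / (\<Sum>k<n. d k) / (\<Sum>k<n. d k) * d k)"
    using ij d_pos by (simp add: kernel_proj_def scalar_prod_def lessThan_atLeast0)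
      (intro sum.cong; simp add: less_imp_le)
  also have "\<dots> = sqrt (d i) * sqrt (d j) / (\<Sum>k<n. d k) / (\<Sum>k<n. d k) * (\<Sum>k<n. d k)"
    by (simp only: sum_distrib_left)
  also have "\<dots> = kernel_proj $$ (i, j)"
    using ij sum_d_pos by (simp add: kernel_proj_def)
  finally show "(kernel_proj * kernel_proj) $$ (i, j) = kernel_proj $$ (i, j)" .
qed (simp_all add: carrier_matD[OF kernel_proj_carrier])

lemma kernel_proj_laplacian: "kernel_proj * laplacian n w = 0\<^sub>m n n"
proof -
  have "kernel_proj * laplacian n w = transpose_mat (laplacian n w * kernel_proj)"
    by (simp add: transpose_mult[OF laplacian_carrier kernel_proj_carrier]
      kernel_proj_symmetric laplacian_symmetric)
  then show ?thesis by (simp add: laplacian_kernel_proj)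
qed

text \<open>Applying the projection to the equation kills the Laplacian, so both parts vanish: after
  scaling, \<open>v\<close> is constant by connectedness and orthogonal to the constants.
  Invertibility of the sum is the key to an explicit pseudo-inverse.\<close>

lemma laplacian_plus_proj_inj:
  assumes v: "v \<in> carrier_vec n" and 0: "(laplacian n w + kernel_proj) *\<^sub>v v = 0\<^sub>v n"
  shows "v = 0\<^sub>v n"
proof -
  let ?A = "laplacian n w" and ?J = kernel_proj
  have sum: "?A *\<^sub>v v + ?J *\<^sub>v v = 0\<^sub>v n"
    using 0 v by (simp add: add_mult_distrib_mat_vec[OF laplacian_carrier kernel_proj_carrier])
  have Jv: "?J *\<^sub>v v \<in> carrier_vec n" and Av: "?A *\<^sub>v v \<in> carrier_vec n"
    using mult_mat_vec_carrier[OF kernel_proj_carrier v] mult_mat_vec_carrier[OF laplacian_carrier v]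
    by auto
  have "?J *\<^sub>v (?A *\<^sub>v v + ?J *\<^sub>v v) = (?J * ?A) *\<^sub>v v + (?J * ?J) *\<^sub>v v"
    using v Jv Av
    by (simp add: mult_add_distrib_mat_vec[OF kernel_proj_carrier]
      assoc_mult_mat_vec[OF kernel_proj_carrier laplacian_carrier]
      assoc_mult_mat_vec[OF kernel_proj_carrier kernel_proj_carrier])
  then have J0: "?J *\<^sub>v v = 0\<^sub>v n"
    using v Jv unfolding sum kernel_proj_laplacian kernel_proj_idem
    by (simp add: zero_mult_vec mult_zero_vec[OF kernel_proj_carrier])
  with sum Av have A0: "?A *\<^sub>v v = 0\<^sub>v n"
    by simp
  have harm: "scaled v i - avg (scaled v) i = 0" if "i < n" for i
    using laplacian_mult[OF v that] that d_pos[OF that] unfolding A0 by simp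
  have "dirichlet (scaled v) = ip (scaled v) (\<lambda>i. scaled v i - avg (scaled v) i)"
    unfolding dirichlet_eq ip_diff ..
  also have "\<dots> = ip (scaled v) (\<lambda>_. 0)"
    by (rule ip_cong) (simp_all add: harm)
  finally have "dirichlet (scaled v) = 0"
    by (simp add: ip_def)
  then have const: "scaled v i = scaled v 0" if "i < n" for i
    using dirichlet_0_const[OF _ that, of "scaled v" 0] n2 by simp
  have "sqrt (d 0) * (ip (\<lambda>_. 1) (scaled v) / (\<Sum>k<n. d k)) = 0"
    using kernel_proj_mult[OF v, of 0] n2 unfolding J0 by simp
  then have "ip (\<lambda>_. 1) (scaled v) = 0"
    using sum_d_pos d_pos[of 0] n2 by simp
  moreover have "ip (\<lambda>_. 1) (scaled v) = ip (\<lambda>_. 1) (\<lambda>_. scaled v 0)"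
    by (intro ip_cong const refl)
  moreover have "\<dots> = scaled v 0 * (\<Sum>j<n. d j)"
    by (simp add: ip_def sum_distrib_left mult.commute)
  ultimately have "scaled v 0 = 0"
    using sum_d_pos by simp
  then have 0: "scaled v i = 0" if "i < n" for i
    using const[OF that] by (rule trans[rotated])
  have "v $ i = 0" if "i < n" for i
    using 0[OF that] d_pos[OF that] by (simp add: scaled_def)
  then show ?thesis
    using v by (intro eq_vecI) auto
qed

end

text \<open>This makes the description in \<open>pseudo_inverse\<close> definite.
  \<open>A * X\<close> and \<open>A * Y\<close> are orthogonal projections with the same image, so
  they agree; \<open>X * A\<close> and \<open>Y * A\<close> agree likewise. Then
  \<open>X = X * A * X = X * A * Y = Y * A * Y = Y\<close>.\<close>

lemma penrose_unique:
  fixes A :: "real mat"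
  assumes A: "A \<in> carrier_mat n n" and X: "X \<in> carrier_mat n n" and Y: "Y \<in> carrier_mat n n"
    and X1: "A * X * A = A" and X2: "X * A * X = X"
    and X3: "transpose_mat (A * X) = A * X" and X4: "transpose_mat (X * A) = X * A"
    and Y1: "A * Y * A = A" and Y2: "Y * A * Y = Y"
    and Y3: "transpose_mat (A * Y) = A * Y" and Y4: "transpose_mat (Y * A) = Y * A"
  shows "X = Y"
proof -
  note [simp] = A X Y mult_carrier_mat[of _ n n _ n] and assoc = assoc_mult_mat[of _ n n _ n _ n]
  have "A * X = (A * Y * A) * X" by (simp only: Y1)
  also have "\<dots> = (A * Y) * (A * X)" by (rule assoc) simp_all
  also have "\<dots> = transpose_mat ((A * X) * (A * Y))"
    by (simp only: X3 Y3 transpose_mult[OF mult_carrier_mat[OF A X] mult_carrier_mat[OF A Y]])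
  also have "(A * X) * (A * Y) = (A * X * A) * Y" by (rule assoc[symmetric]) simp_all
  finally have 1: "A * X = A * Y" by (simp only: X1 Y3)
  have "X * A = X * (A * (Y * A))"
    by (simp only: assoc[of A Y A, symmetric] A Y Y1)
  also have "\<dots> = (X * A) * (Y * A)" by (rule assoc[symmetric]) simp_all
  also have "\<dots> = transpose_mat ((Y * A) * (X * A))"
    by (simp only: X4 Y4 transpose_mult[OF mult_carrier_mat[OF Y A] mult_carrier_mat[OF X A]])
  also have "(Y * A) * (X * A) = Y * (A * (X * A))" by (rule assoc) simp_all
  also have "A * (X * A) = A" by (simp only: assoc[of A X A, symmetric] A X X1)
  finally have 2: "X * A = Y * A" by (simp only: Y4)
  have "X = X * (A * X)" by (simp only: assoc[of X A X, symmetric] A X X2)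
  also have "\<dots> = X * A * Y" by (simp only: 1 assoc[of X A Y, symmetric] A X Y)
  also have "\<dots> = Y" by (simp only: 2 Y2)
  finally show ?thesis .
qed

context connected_weighted_graph
begin

text \<open>With \<open>L\<close> the Laplacian and \<open>J\<close> the projection, the witness is
  the inverse of \<open>L + J\<close> minus \<open>J\<close>: its products with \<open>L\<close> on
  either side are \<open>1 - J\<close>, and the Penrose equations follow. The last conclusion serves
  to put solutions in the complement of the kernel.\<close>

lemma pseudo_inverse_laplacian:
  obtains X where "pseudo_inverse (laplacian n w) = X" "X \<in> carrier_mat n n"
    "laplacian n w * X * laplacian n w = laplacian n w" "kernel_proj * X = 0\<^sub>m n n"
proof -
  let ?A = "laplacian n w" and ?J = kernel_proj
  let ?N = "?A + ?J"
  note A = laplacian_carrier and J = kernel_proj_carrier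
  have N: "?N \<in> carrier_mat n n"
    using A J by simp
  have "det ?N \<noteq> 0"
    unfolding det_0_iff_vec_prod_zero_field[OF N] using laplacian_plus_proj_inj by auto
  from det_non_zero_imp_unit[OF N this, of undefined]
  obtain M where M: "M \<in> carrier_mat n n" "M * ?N = 1\<^sub>m n" "?N * M = 1\<^sub>m n"
    unfolding Units_def ring_mat_simps by blast
  have JN: "?J * ?N = ?J" and NJ: "?N * ?J = ?J"
    using A J by (simp_all add: mult_add_distrib_mat[of _ n n _ n] add_mult_distrib_mat[of _ n n _ _ n]
      kernel_proj_laplacian laplacian_kernel_proj kernel_proj_idem)
  have JM: "?J * M = ?J"
  proof -
    have "?J * M = ?J * ?N * M" unfolding JN ..
    also have "\<dots> = ?J * (?N * M)" by (rule assoc_mult_mat[OF J N M(1)])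
    finally show ?thesis using J by (simp add: M)
  qed
  have MJ: "M * ?J = ?J"
  proof -
    have "M * ?J = M * (?N * ?J)" unfolding NJ ..
    also have "\<dots> = M * ?N * ?J" by (rule assoc_mult_mat[OF M(1) N J, symmetric])
    finally show ?thesis using J by (simp add: M)
  qed
  define X where "X = M - ?J"
  have X: "X \<in> carrier_mat n n"
    unfolding X_def by (rule minus_carrier_mat[OF J])
  have AN: "?A = ?N - ?J"
    using carrier_matD[OF A] carrier_matD[OF J] by (intro eq_matI) auto
  have one: "1\<^sub>m n \<in> carrier_mat n n" by simp
  note minus0 = minus_zero_mat[OF A] minus_zero_mat[OF X] minus_zero_mat[OF minus_carrier_mat[OF J]]
  have "?A * M = 1\<^sub>m n - ?J"
    by (subst AN) (simp add: minus_mult_distrib_mat[OF N J M(1)] M JM)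
  moreover have "?A * X = ?A * M - ?A * ?J"
    unfolding X_def by (rule mult_minus_distrib_mat[OF A M(1) J])
  ultimately have AX: "?A * X = 1\<^sub>m n - ?J"
    by (simp add: laplacian_kernel_proj minus0)
  have "M * ?A = 1\<^sub>m n - ?J"
    by (subst AN) (simp add: mult_minus_distrib_mat[OF M(1) N J] M MJ)
  moreover have "X * ?A = M * ?A - ?J * ?A"
    unfolding X_def by (rule minus_mult_distrib_mat[OF M(1) J A])
  ultimately have XA: "X * ?A = 1\<^sub>m n - ?J"
    by (simp add: kernel_proj_laplacian minus0)
  have JX: "?J * X = 0\<^sub>m n n"
    unfolding X_def mult_minus_distrib_mat[OF J M(1) J] JM kernel_proj_idem
    using carrier_matD[OF J] by (intro eq_matI) auto
  have 1: "?A * X * ?A = ?A"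
    unfolding AX minus_mult_distrib_mat[OF one J A] kernel_proj_laplacian
    by (simp only: left_mult_one_mat[OF A] minus0)
  have 2: "X * ?A * X = X"
    unfolding XA minus_mult_distrib_mat[OF one J X] JX
    by (simp only: left_mult_one_mat[OF X] minus0)
  have sym: "transpose_mat (1\<^sub>m n - ?J) = 1\<^sub>m n - ?J"
    using J kernel_proj_symmetric by (simp add: transpose_minus[OF one J])
  have "pseudo_inverse ?A = X"
    unfolding pseudo_inverse_def carrier_matD[OF A]
  proof (rule the_equality)
    show "X \<in> carrier_mat n n \<and> ?A * X * ?A = ?A \<and> X * ?A * X = X \<and>
      transpose_mat (?A * X) = ?A * X \<and> transpose_mat (X * ?A) = X * ?A"
      using X 1 2 sym AX XA by simp
  qed (use penrose_unique[OF A _ X _ _ _ _ 1 2] sym AX XA in auto)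
  then show ?thesis
    using that X 1 JX by blast
qed

text \<open>Since \<open>b\<close> is in the image, \<open>A * X * A = A\<close> gives a solution;
  the pseudo-inverse picks the one orthogonal to the kernel, to which the contraction
  applies.\<close>

lemma pseudo_inverse_solution:
  assumes b: "b \<in> mat_image (laplacian n w)"
  defines "x \<equiv> pseudo_inverse (laplacian n w) *\<^sub>v b"
  shows "\<And>i. i < n \<Longrightarrow> scaled x i - avg (scaled x) i = scaled b i" "ip (\<lambda>_. 1) (scaled x) = 0"
proof -
  let ?A = "laplacian n w"
  note A = laplacian_carrier and J = kernel_proj_carrier
  obtain X where X: "pseudo_inverse ?A = X" "X \<in> carrier_mat n n" "?A * X * ?A = ?A"
    "kernel_proj * X = 0\<^sub>m n n"
    using pseudo_inverse_laplacian by blast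
  obtain z where z: "z \<in> carrier_vec n" "b = ?A *\<^sub>v z"
    using b by (auto simp: mat_image_def carrier_matD[OF A])
  have bc: "b \<in> carrier_vec n"
    using z mult_mat_vec_carrier[OF A] by simp
  have xc: "x \<in> carrier_vec n"
    using mult_mat_vec_carrier[OF X(2) bc] by (simp add: x_def X(1))
  have "?A *\<^sub>v x = (?A * X) *\<^sub>v b"
    unfolding x_def X(1) by (rule assoc_mult_mat_vec[OF A X(2) bc, symmetric])
  also have "\<dots> = (?A * X * ?A) *\<^sub>v z"
    unfolding z(2) by (rule assoc_mult_mat_vec[OF mult_carrier_mat[OF A X(2)] A z(1), symmetric])
  finally have Ax: "?A *\<^sub>v x = b"
    by (simp add: X(3) z(2))
  show "scaled x i - avg (scaled x) i = scaled b i" if "i < n" for i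
    using laplacian_mult[OF xc that] d_pos[OF that] unfolding Ax by (simp add: scaled_def)
  have "kernel_proj *\<^sub>v x = (kernel_proj * X) *\<^sub>v b"
    unfolding x_def X(1) by (rule assoc_mult_mat_vec[OF J X(2) bc, symmetric])
  also have "\<dots> = 0\<^sub>v n"
    using bc by (simp add: X(4) zero_mult_vec)
  finally have "(kernel_proj *\<^sub>v x) $ 0 = 0"
    using n2 by simp
  then show "ip (\<lambda>_. 1) (scaled x) = 0"
    using kernel_proj_mult[OF xc, of 0] n2 sum_d_pos d_pos[of 0] by simp
qed

section \<open>Decay of the truncated series\<close>

lemma lazy_pow_contraction:
  assumes "ip (\<lambda>_. 1) f = 0" "lam \<le> lambda2 n w" "lam \<le> 2"
  shows "ip (\<lambda>_. 1) ((lazy ^^ K) f) = 0 \<and>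
    ip ((lazy ^^ K) f) ((lazy ^^ K) f) \<le> (1 - lam / 2) ^ K * ip f f"
proof (induction K)
  case 0
  then show ?case using assms by simp
next
  case (Suc K)
  let ?g = "(lazy ^^ K) f"
  have "lam * ip ?g ?g \<le> lambda2 n w * ip ?g ?g"
    by (intro mult_right_mono assms ip_nonneg)
  \<comment> \<open>Poincare's inequality is available on the complement of the constants, which is
    why orthogonality is part of the induction.\<close>
  also have "\<dots> \<le> dirichlet ?g"
    using Suc by (intro poincare) simp
  finally have "ip (lazy ?g) (lazy ?g) \<le> (1 - lam / 2) * ip ?g ?g"
    using lazy_contraction[of ?g] by (simp add: left_diff_distrib)
  also have "\<dots> \<le> (1 - lam / 2) * ((1 - lam / 2) ^ K * ip f f)"
    using Suc assms by (intro mult_left_mono) auto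
  finally show ?case
    using Suc by (simp add: ip_one_lazy mult.assoc)
qed

lemma lazy_linear:
  assumes "\<And>i. i < n \<Longrightarrow> f i = 2 * (g i - h i)" "i < n"
  shows "lazy f i = 2 * (lazy g i - lazy h i)"
proof -
  have "avg f i = 2 * (avg g i - avg h i)"
    using assms(1) by (simp add: avg_def sum_distrib_left right_diff_distrib sum_subtractf
      mult.left_commute[of _ 2])
  then show ?thesis
    by (simp add: lazy_def assms field_simps)
qed

text \<open>\<open>y - avg y = f\<close> means \<open>f = 2 * (y - lazy y)\<close>. The equation is
  given at vertices only, so \<open>lazy_linear\<close> pushes it through the powers
  pointwise.\<close>

lemma sum_lazy_telescope:
  assumes "\<And>i. i < n \<Longrightarrow> y i - avg y i = f i" "i < n"
  shows "(\<Sum>k<K. (lazy ^^ k) f i) = 2 * (y i - (lazy ^^ K) y i)"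
proof -
  have "(lazy ^^ k) f i = 2 * ((lazy ^^ k) y i - (lazy ^^ Suc k) y i)" if "i < n" for i k
    using that
  proof (induction k arbitrary: i)
    case 0
    then show ?case using assms(1)[of i] by (simp add: lazy_def field_simps)
  next
    case (Suc k)
    then show ?case using lazy_linear[of "(lazy ^^ k) f"] by simp
  qed
  then have "(\<Sum>k<K. (lazy ^^ k) f i) = 2 * (\<Sum>k<K. (lazy ^^ k) y i - (lazy ^^ Suc k) y i)"
    using assms(2) by (simp add: sum_distrib_left)
  also have "(\<Sum>k<K. (lazy ^^ k) y i - (lazy ^^ Suc k) y i) = y i - (lazy ^^ K) y i"
    by (subst sum_lessThan_telescope') simp
  finally show ?thesis .
qed

lemma ip_solution_le:
  assumes "ip (\<lambda>_. 1) y = 0" "0 < lam" "lam \<le> lambda2 n w"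
    "\<And>i. i < n \<Longrightarrow> y i - avg y i = f i"
  shows "ip y y \<le> ip f f / lam\<^sup>2"
proof -
  have "lam * ip y y \<le> lambda2 n w * ip y y"
    by (intro mult_right_mono assms ip_nonneg)
  also have "\<dots> \<le> dirichlet y"
    using assms by (intro poincare)
  also have "dirichlet y = ip y (\<lambda>i. y i - avg y i)"
    unfolding dirichlet_eq ip_diff ..
  also have "\<dots> = ip y f"
    by (rule ip_cong) (simp_all add: assms)
  finally have 1: "lam * ip y y \<le> ip y f" .
  \<comment> \<open>A completed square in place of Cauchy-Schwarz; the coefficient
    \<open>lam\<close> is chosen so that together with the preceding inequality it leaves
    \<open>lam\<^sup>2 * ip y y \<le> ip f f\<close>.\<close>
  have "0 \<le> ip (\<lambda>i. f i + - lam * y i) (\<lambda>i. f i + - lam * y i)"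
    by (rule ip_nonneg)
  also have "\<dots> = ip f f - 2 * lam * ip y f + lam\<^sup>2 * ip y y"
    by (subst ip_add_scaled) (simp add: ip_commute[of f y])
  finally have "2 * lam * ip y f \<le> ip f f + lam\<^sup>2 * ip y y"
    by simp
  moreover have "2 * lam * (lam * ip y y) \<le> 2 * lam * ip y f"
    using assms(2) 1 by (intro mult_left_mono) auto
  ultimately have "lam\<^sup>2 * ip y y \<le> ip f f"
    by (simp add: power2_eq_square)
  then show ?thesis
    using assms(2) by (simp add: field_simps)
qed

text \<open>The error is \<open>sqrt (d i)\<close> times an entry of the contracted solution, and
  \<open>entry_le_ip\<close> absorbs the degree. Squares are kept because the contraction is one of
  squared norms.\<close>

lemma truncated_series_error:
  assumes b: "b \<in> mat_image (laplacian n w)" "(\<Sum>i<n. (b $ i)\<^sup>2) = 1"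
    and lam: "0 < lam" "lam \<le> lambda2 n w" "lam \<le> 2" and i: "i < n"
  shows "((pseudo_inverse (laplacian n w) *\<^sub>v b) $ i
      - sqrt (d i) / 2 * (\<Sum>k<K. (lazy ^^ k) (scaled b) i))\<^sup>2 \<le> (1 - lam / 2) ^ K / lam\<^sup>2"
proof -
  define x where "x = pseudo_inverse (laplacian n w) *\<^sub>v b"
  note sol = pseudo_inverse_solution[OF b(1), folded x_def]
  have "x $ i = sqrt (d i) * scaled x i"
    using d_pos[OF i] by (simp add: scaled_def)
  then have "x $ i - sqrt (d i) / 2 * (\<Sum>k<K. (lazy ^^ k) (scaled b) i)
      = sqrt (d i) * (lazy ^^ K) (scaled x) i"
    by (subst sum_lazy_telescope[OF sol(1) i]) (simp_all add: algebra_simps)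
  then have "(x $ i - sqrt (d i) / 2 * (\<Sum>k<K. (lazy ^^ k) (scaled b) i))\<^sup>2
      = d i * ((lazy ^^ K) (scaled x) i)\<^sup>2"
    using d_pos[OF i] by (simp add: power_mult_distrib)
  also have "\<dots> \<le> (1 - lam / 2) ^ K * ip (scaled x) (scaled x)"
    using entry_le_ip[OF i] lazy_pow_contraction[OF sol(2) lam(2,3)] by (rule order_trans[OF _ conjunct2])
  also have "\<dots> \<le> (1 - lam / 2) ^ K * (1 / lam\<^sup>2)"
    using ip_solution_le[OF sol(2) lam(1,2) sol(1)] lam(3)
    by (intro mult_left_mono) (simp_all add: ip_scaled b(2))
  finally show ?thesis by (simp add: x_def)
qed

end

section \<open>Concentration of sums of independent samples\<close>

text \<open>Written with an accumulator so as to unfold like the sampling loop.\<close>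

fun iid_sum :: "int pmf \<Rightarrow> nat \<Rightarrow> int \<Rightarrow> int pmf" where
  "iid_sum Y 0 a = return_pmf a"
| "iid_sum Y (Suc N) a = bind_pmf Y (\<lambda>y. iid_sum Y N (a + y))"

text \<open>Each sample contributes one factor by Hoeffding's lemma. The sign
  \<open>\<sigma>\<close> treats both tails at once; nonnegative integrals keep integrability
  conditions out of the induction.\<close>

lemma iid_sum_mgf:
  fixes A h \<sigma> :: real
  assumes A: "\<And>y. y \<in> set_pmf Y \<Longrightarrow> \<bar>real_of_int y\<bar> \<le> A" and h: "h > 0" and \<sigma>: "\<bar>\<sigma>\<bar> = 1"
  defines "\<mu> \<equiv> measure_pmf.expectation Y real_of_int"
  shows "(\<integral>\<^sup>+s. ennreal (exp (h * (\<sigma> * (of_int s - of_int a - real N * \<mu>)))) \<partial>iid_sum Y N a)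
    \<le> ennreal (exp (h\<^sup>2 * A\<^sup>2 / 2)) ^ N"
proof (induction N arbitrary: a)
  case 0
  then show ?case by simp
next
  case (Suc N)
  interpret interval_bounded_random_variable "measure_pmf Y" "\<lambda>y. \<sigma> * of_int y" "- A" A
  proof
    show "AE y in measure_pmf Y. \<sigma> * of_int y \<in> {- A..A}"
    proof (rule AE_pmfI)
      fix y assume "y \<in> set_pmf Y"
      from A[OF this] have "\<bar>\<sigma> * real_of_int y\<bar> \<le> A"
        by (simp add: abs_mult \<sigma>)
      then show "\<sigma> * of_int y \<in> {- A..A}"
        by auto
    qed
  qed simp
  have split: "exp (h * (\<sigma> * (of_int s - of_int a - real (Suc N) * \<mu>)))
      = exp (h * (\<sigma> * of_int y - \<sigma> * \<mu>)) * exp (h * (\<sigma> * (of_int s - of_int (a + y) - real N * \<mu>)))" for s y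
    by (simp add: exp_add[symmetric] algebra_simps)
  have "(\<integral>\<^sup>+s. ennreal (exp (h * (\<sigma> * (of_int s - of_int a - real (Suc N) * \<mu>)))) \<partial>iid_sum Y (Suc N) a)
      = (\<integral>\<^sup>+y. ennreal (exp (h * (\<sigma> * of_int y - \<sigma> * \<mu>))) *
          (\<integral>\<^sup>+s. ennreal (exp (h * (\<sigma> * (of_int s - of_int (a + y) - real N * \<mu>)))) \<partial>iid_sum Y N (a + y)) \<partial>Y)"
    unfolding iid_sum.simps nn_integral_bind_pmf
  proof (intro nn_integral_cong)
    fix y
    show "(\<integral>\<^sup>+s. ennreal (exp (h * (\<sigma> * (of_int s - of_int a - real (Suc N) * \<mu>)))) \<partial>iid_sum Y N (a + y))
      = ennreal (exp (h * (\<sigma> * of_int y - \<sigma> * \<mu>))) *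
        (\<integral>\<^sup>+s. ennreal (exp (h * (\<sigma> * (of_int s - of_int (a + y) - real N * \<mu>)))) \<partial>iid_sum Y N (a + y))"
      unfolding split[of _ y] by (subst nn_integral_cmult[symmetric]) (simp_all add: ennreal_mult)
  qed
  also have "\<dots> \<le> (\<integral>\<^sup>+y. ennreal (exp (h * (\<sigma> * of_int y - \<sigma> * \<mu>))) * ennreal (exp (h\<^sup>2 * A\<^sup>2 / 2)) ^ N \<partial>Y)"
    by (intro nn_integral_mono mult_left_mono Suc.IH) auto
  also have "\<dots> = (\<integral>\<^sup>+y. ennreal (exp (h * (\<sigma> * of_int y - \<sigma> * \<mu>))) \<partial>Y) * ennreal (exp (h\<^sup>2 * A\<^sup>2 / 2)) ^ N"
    by (intro nn_integral_multc) auto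
  also have "\<dots> \<le> ennreal (exp (h\<^sup>2 * A\<^sup>2 / 2)) * ennreal (exp (h\<^sup>2 * A\<^sup>2 / 2)) ^ N"
  proof (intro mult_right_mono)
    have E: "measure_pmf.expectation Y (\<lambda>y. \<sigma> * of_int y) = \<sigma> * \<mu>"
      by (simp add: \<mu>_def)
    \<comment> \<open>The interval \<open>{- A..A}\<close> has length \<open>2 * A\<close>, which
      turns the 8 of Hoeffding's lemma into 2.\<close>
    have c: "h\<^sup>2 * (A - - A)\<^sup>2 / 8 = h\<^sup>2 * A\<^sup>2 / 2"
      by (simp add: power2_eq_square)
    show "(\<integral>\<^sup>+y. ennreal (exp (h * (\<sigma> * of_int y - \<sigma> * \<mu>))) \<partial>Y) \<le> ennreal (exp (h\<^sup>2 * A\<^sup>2 / 2))"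
      using Hoeffdings_lemma_nn_integral[OF h] unfolding E c .
  qed simp
  finally show ?case by simp
qed

lemma iid_sum_tail:
  fixes A t \<sigma> :: real
  assumes A: "\<And>y. y \<in> set_pmf Y \<Longrightarrow> \<bar>real_of_int y\<bar> \<le> A" and A0: "A > 0"
    and t: "t > 0" and N: "N > 0" and \<sigma>: "\<bar>\<sigma>\<bar> = 1"
  defines "\<mu> \<equiv> measure_pmf.expectation Y real_of_int"
  shows "measure_pmf.prob (iid_sum Y N 0) {s. \<sigma> * (of_int s - real N * \<mu>) \<ge> real N * t}
    \<le> exp (- (real N * t\<^sup>2 / (2 * A\<^sup>2)))"
proof -
  \<comment> \<open>Chernoff bound: this \<open>h\<close> minimises
    \<open>N * h\<^sup>2 * A\<^sup>2 / 2 - h * N * t\<close>.\<close>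
  define h where "h = t / A\<^sup>2"
  have h: "h > 0" using t A0 by (simp add: h_def)
  let ?S = "{s. \<sigma> * (of_int s - real N * \<mu>) \<ge> real N * t}"
  let ?g = "\<lambda>s. exp (h * (\<sigma> * (of_int s - real N * \<mu>)))"
  have "ennreal (exp (h * (real N * t))) * emeasure (measure_pmf (iid_sum Y N 0)) ?S
      = (\<integral>\<^sup>+s. ennreal (exp (h * (real N * t))) * indicator ?S s \<partial>iid_sum Y N 0)"
    by (simp add: nn_integral_cmult_indicator)
  also have "\<dots> \<le> (\<integral>\<^sup>+s. ennreal (?g s) \<partial>iid_sum Y N 0)"
    using h by (intro nn_integral_mono) (auto simp: indicator_def intro!: ennreal_leI)
  also have "\<dots> \<le> ennreal (exp (h\<^sup>2 * A\<^sup>2 / 2)) ^ N"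
    using iid_sum_mgf[OF A h \<sigma>, where a = 0 and N = N] by (simp add: \<mu>_def)
  also have "\<dots> = ennreal (exp (real N * (h\<^sup>2 * A\<^sup>2 / 2)))"
    by (simp add: ennreal_power exp_of_nat_mult[symmetric])
  finally have "exp (h * (real N * t)) * measure_pmf.prob (iid_sum Y N 0) ?S
      \<le> exp (real N * (h\<^sup>2 * A\<^sup>2 / 2))"
    by (simp add: measure_pmf.emeasure_eq_measure ennreal_mult[symmetric])
  then have "measure_pmf.prob (iid_sum Y N 0) ?S
      \<le> exp (real N * (h\<^sup>2 * A\<^sup>2 / 2) - h * (real N * t))"
    by (simp only: exp_diff pos_le_divide_eq[OF exp_gt_zero] mult.commute)
  also have "real N * (h\<^sup>2 * A\<^sup>2 / 2) - h * (real N * t) = - (real N * t\<^sup>2 / (2 * A\<^sup>2))"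
    using A0 by (simp add: h_def field_simps power2_eq_square)
  finally show ?thesis .
qed

lemma iid_sum_concentration:
  fixes A t :: real
  assumes A: "\<And>y. y \<in> set_pmf Y \<Longrightarrow> \<bar>real_of_int y\<bar> \<le> A" and A0: "A > 0"
    and t: "t > 0" and N: "N > 0"
  defines "\<mu> \<equiv> measure_pmf.expectation Y real_of_int"
  shows "measure_pmf.prob (iid_sum Y N 0) {s. \<bar>of_int s / real N - \<mu>\<bar> < t}
    \<ge> 1 - 2 * exp (- (real N * t\<^sup>2 / (2 * A\<^sup>2)))"
proof -
  let ?p = "iid_sum Y N 0"
  let ?S = "\<lambda>\<sigma>. {s. \<sigma> * (of_int s - real N * \<mu>) \<ge> real N * t}"
  have sub: "- {s. \<bar>of_int s / real N - \<mu>\<bar> < t} \<subseteq> ?S 1 \<union> ?S (- 1)"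
  proof
    fix s assume "s \<in> - {s. \<bar>real_of_int s / real N - \<mu>\<bar> < t}"
    then have "t \<le> \<bar>of_int s / real N - \<mu>\<bar>" by simp
    then have "real N * t \<le> real N * \<bar>of_int s / real N - \<mu>\<bar>"
      by (intro mult_left_mono) auto
    also have "\<dots> = \<bar>real N * (of_int s / real N - \<mu>)\<bar>"
      by (simp add: abs_mult)
    also have "real N * (of_int s / real N - \<mu>) = of_int s - real N * \<mu>"
      using N by (simp add: right_diff_distrib)
    finally show "s \<in> ?S 1 \<union> ?S (- 1)"
      by auto
  qed
  have "1 - measure_pmf.prob ?p {s. \<bar>of_int s / real N - \<mu>\<bar> < t}
      = measure_pmf.prob ?p (- {s. \<bar>of_int s / real N - \<mu>\<bar> < t})"
    by (simp add: measure_pmf.prob_compl[symmetric] Compl_eq_Diff_UNIV)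
  also have "\<dots> \<le> measure_pmf.prob ?p (?S 1 \<union> ?S (- 1))"
    by (intro measure_pmf.finite_measure_mono sub) simp
  also have "\<dots> \<le> measure_pmf.prob ?p (?S 1) + measure_pmf.prob ?p (?S (- 1))"
    by (intro measure_Un_le) auto
  also have "\<dots> \<le> 2 * exp (- (real N * t\<^sup>2 / (2 * A\<^sup>2)))"
    using iid_sum_tail[OF A A0 t N, where Y = Y and \<sigma> = 1] iid_sum_tail[OF A A0 t N, where Y = Y and \<sigma> = "- 1"]
    by (simp add: \<mu>_def)
  finally show ?thesis by simp
qed

section \<open>Random walk trajectories\<close>

lemma expectation_bind_pmf_finite:
  fixes h :: "'b \<Rightarrow> real"
  assumes "finite (set_pmf p)" "\<And>x. x \<in> set_pmf p \<Longrightarrow> finite (set_pmf (f x))"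
  shows "measure_pmf.expectation (bind_pmf p f) h
    = measure_pmf.expectation p (\<lambda>x. measure_pmf.expectation (f x) h)"
  using assms by (subst pmf_expectation_bind[of "set_pmf p"]) (auto simp: integral_measure_pmf[of "set_pmf p"])

context connected_weighted_graph
begin

lemma pmf_walk:
  assumes "v < n"
  shows "pmf (walk_pmf n w v) j = (if j < n then w v j / d v else 0)"
  using assms by (intro pmf_walk_pmf) (auto simp: w_nonneg d_pos)

lemma set_walk: "v < n \<Longrightarrow> set_pmf (walk_pmf n w v) \<subseteq> {..<n}"
  by (auto simp: set_pmf_iff pmf_walk split: if_splits)

lemma expectation_walk:
  assumes "v < n"
  shows "measure_pmf.expectation (walk_pmf n w v) f = avg f v"
  using set_walk[OF assms]
  by (subst integral_measure_pmf_real[of "{..<n}"])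
     (auto simp: avg_def pmf_walk[OF assms] mult.commute)

definition lazy_walk :: "nat \<Rightarrow> nat pmf" where
  "lazy_walk v = bind_pmf (bernoulli_pmf (1 / 2)) (\<lambda>c. if c then walk_pmf n w v else return_pmf v)"

lemma set_lazy_walk: "v < n \<Longrightarrow> set_pmf (lazy_walk v) \<subseteq> {..<n}"
  using subsetD[OF set_walk] by (auto simp: lazy_walk_def split: if_splits)

lemma expectation_lazy_walk:
  assumes "v < n"
  shows "measure_pmf.expectation (lazy_walk v) f = lazy f v"
proof -
  have fin: "finite (set_pmf (walk_pmf n w v))"
    using finite_subset[OF set_walk[OF assms]] by simp
  show ?thesis
    unfolding lazy_walk_def
    by (subst expectation_bind_pmf_finite)
       (auto simp: fin expectation_walk[OF assms] lazy_def field_simps split: if_splits)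
qed

text \<open>The value is added before the move, so \<open>k\<close> steps count the positions at
  times 0 to \<open>k - 1\<close>, as in the truncated series. The last vertex belongs to the
  outcome because the store still holds it when the loop ends.\<close>

fun trajectory_sum :: "(nat \<Rightarrow> int) \<Rightarrow> nat \<Rightarrow> int \<Rightarrow> nat \<Rightarrow> (int \<times> nat) pmf" where
  "trajectory_sum F 0 a v = return_pmf (a, v)"
| "trajectory_sum F (Suc k) a v = bind_pmf (lazy_walk v) (trajectory_sum F k (a + F v))"

lemma trajectory_sum_bound:
  assumes "\<And>v. v < n \<Longrightarrow> \<bar>F v\<bar> \<le> c" "v < n" "(s, u) \<in> set_pmf (trajectory_sum F k a v)"
  shows "\<bar>s - a\<bar> \<le> int k * c \<and> u < n"
  using assms(2,3)
proof (induction k arbitrary: a v)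
  case 0
  then show ?case by simp
next
  case (Suc k)
  then obtain v' where v': "v' \<in> set_pmf (lazy_walk v)" "(s, u) \<in> set_pmf (trajectory_sum F k (a + F v) v')"
    by auto
  then have "v' < n"
    using set_lazy_walk[OF Suc.prems(1)] by auto
  from Suc.IH[OF this v'(2)] have 1: "\<bar>s - (a + F v)\<bar> \<le> int k * c" "u < n"
    by auto
  have "\<bar>s - a\<bar> \<le> \<bar>s - (a + F v)\<bar> + \<bar>F v\<bar>"
    by simp
  with 1 assms(1)[OF Suc.prems(1)] show ?case
    by (simp add: algebra_simps)
qed

lemma finite_trajectory_sum: "v < n \<Longrightarrow> finite (set_pmf (trajectory_sum F k a v))"
proof (induction k arbitrary: a v)
  case (Suc k)
  then show ?case
    using set_lazy_walk[OF Suc.prems] finite_subset[OF set_lazy_walk[OF Suc.prems]] by auto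
qed simp

text \<open>Successive trajectories add to one register; translation lets each of them be read as an
  independent draw from the same distribution.\<close>

lemma trajectory_sum_shift:
  "trajectory_sum F k a v = map_pmf (\<lambda>(s, u). (a + s, u)) (trajectory_sum F k 0 v)"
proof (induction k arbitrary: a v)
  case (Suc k)
  have "trajectory_sum F k (a + F v) = (\<lambda>v'. map_pmf (\<lambda>(s, u). (a + s, u)) (trajectory_sum F k (F v) v'))"
  proof
    fix v'
    show "trajectory_sum F k (a + F v) v' = map_pmf (\<lambda>(s, u). (a + s, u)) (trajectory_sum F k (F v) v')"
      unfolding Suc.IH[of "a + F v" v'] Suc.IH[of "F v" v'] map_pmf_comp
      by (intro map_pmf_cong) auto
  qed
  then show ?case by (simp add: map_bind_pmf)
qed simp

text \<open>Conditioning on the first move applies \<open>lazy\<close> once more, which shifts the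
  powers by one.\<close>

lemma expectation_trajectory_sum:
  assumes "v < n"
  shows "measure_pmf.expectation (trajectory_sum F K a v) (\<lambda>x. real_of_int (fst x))
    = of_int a + (\<Sum>k<K. (lazy ^^ k) (\<lambda>u. of_int (F u)) v)"
  using assms
proof (induction K arbitrary: a v)
  case (Suc K)
  let ?F = "\<lambda>u. real_of_int (F u)"
  note fin = finite_subset[OF set_lazy_walk[OF Suc.prems]]
  have "measure_pmf.expectation (trajectory_sum F (Suc K) a v) (\<lambda>x. real_of_int (fst x))
      = measure_pmf.expectation (lazy_walk v) (\<lambda>v'. measure_pmf.expectation
          (trajectory_sum F K (a + F v) v') (\<lambda>x. real_of_int (fst x)))"
    using fin set_lazy_walk[OF Suc.prems]
    by (subst trajectory_sum.simps, subst expectation_bind_pmf_finite)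
       (auto intro: finite_trajectory_sum)
  also have "\<dots> = measure_pmf.expectation (lazy_walk v)
      (\<lambda>v'. of_int (a + F v) + (\<Sum>k<K. (lazy ^^ k) ?F v'))"
    using set_lazy_walk[OF Suc.prems] Suc.IH
    by (intro integral_cong_AE) (auto simp: AE_measure_pmf_iff)
  also have "\<dots> = of_int (a + F v) + measure_pmf.expectation (lazy_walk v)
      (\<lambda>v'. \<Sum>k<K. (lazy ^^ k) ?F v')"
    using fin by (subst Bochner_Integration.integral_add) (auto intro: integrable_measure_pmf_finite)
  also have "measure_pmf.expectation (lazy_walk v) (\<lambda>v'. \<Sum>k<K. (lazy ^^ k) ?F v')
      = (\<Sum>k<K. measure_pmf.expectation (lazy_walk v) ((lazy ^^ k) ?F))"
    using fin by (subst Bochner_Integration.integral_sum) (auto intro: integrable_measure_pmf_finite)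
  also have "\<dots> = (\<Sum>k<K. (lazy ^^ Suc k) ?F v)"
    by (simp add: expectation_lazy_walk[OF Suc.prems])
  also have "of_int (a + F v) + (\<Sum>k<K. (lazy ^^ Suc k) ?F v)
      = of_int a + (\<Sum>k<Suc K. (lazy ^^ k) ?F v)"
    by (simp only: sum.lessThan_Suc_shift) simp
  finally show ?case .
qed simp

end

section \<open>Accuracy of the estimator\<close>

text \<open>Subadditivity makes the square root Hoelder continuous with exponent 1/2. It halves the
  number of correct digits.\<close>

lemma abs_sqrt_diff_le:
  assumes "0 \<le> a" "0 \<le> b"
  shows "\<bar>sqrt a - sqrt b\<bar> \<le> sqrt \<bar>a - b\<bar>"
proof -
  have "sqrt c \<le> sqrt e + sqrt (c - e)" if "0 \<le> e" "e \<le> c" for c e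
    using sqrt_add_le_add_sqrt[of e "c - e"] that by simp
  from this[of a b] this[of b a] show ?thesis
    using assms by (cases "a \<le> b") (auto simp: abs_real_def)
qed

text \<open>\<open>x\<close>, \<open>y\<close> are normalized degrees and \<open>X\<close>,
  \<open>Y\<close> their truncations, off by at most \<open>B\<close> units of \<open>1 / Q\<close>.
  The ratio is then off by at most \<open>4 * B ^ 4 / Q\<close>, which for \<open>Q = B ^ 20\<close>
  is the square of \<open>2 / B ^ 8\<close>.\<close>

lemma sqrt_ratio_approx:
  fixes B Q x y X Y :: real
  assumes B: "B \<ge> 32" and Q: "Q = B ^ 20"
    and x: "1 / B \<le> x" "x \<le> B" "x - B / Q \<le> X" "X \<le> x"
    and y: "1 / B \<le> y" "y \<le> B" "y - B / Q \<le> Y" "Y \<le> y"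
  shows "\<bar>sqrt (X / Y) - sqrt (x / y)\<bar> \<le> 2 / B ^ 8" "1 / (2 * B) \<le> Y" "0 \<le> X"
    "sqrt (x / y) \<le> B"
proof -
  have B0: "B > 0" and y0: "y > 0"
    using B y by (auto intro: less_le_trans[rotated])
  have "B * (2 * B) \<le> B ^ 20"
  proof -
    have "B * (2 * B) \<le> B * (B * B)" using B by (intro mult_left_mono mult_right_mono) auto
    also have "\<dots> = B ^ 3" by (simp add: power3_eq_cube mult.assoc)
    also have "\<dots> \<le> B ^ 20" using B by (intro power_increasing) auto
    finally show ?thesis .
  qed
  then have BQ: "B / Q \<le> 1 / (2 * B)"
    using B0 by (simp add: Q field_simps)
  have half: "1 / B - 1 / (2 * B) = 1 / (2 * B)"
    using B0 by (simp add: field_simps)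
  show Y: "1 / (2 * B) \<le> Y"
    using y BQ half by linarith
  show X: "0 \<le> X"
  proof -
    have "0 < 1 / (2 * B)" using B0 by simp
    then show ?thesis using x BQ half by linarith
  qed
  have Y0: "Y > 0"
  proof -
    have "0 < 1 / (2 * B)" using B0 by simp
    then show ?thesis using Y by linarith
  qed
  have x0: "0 \<le> x" using x X by linarith
  have xy: "x / y \<le> B\<^sup>2"
  proof -
    have "x / y \<le> B / (1 / B)"
      using x y B0 x0 by (intro frac_le) auto
    then show ?thesis by (simp add: power2_eq_square)
  qed
  then have "sqrt (x / y) \<le> sqrt (B\<^sup>2)"
    by (rule real_sqrt_le_mono)
  then show "sqrt (x / y) \<le> B"
    using B0 by simp
  have eq: "X / Y - x / y = ((X - x) * y + x * (y - Y)) / (Y * y)"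
    using Y0 y0 by (simp add: field_simps)
  have "\<bar>(X - x) * y + x * (y - Y)\<bar> \<le> \<bar>X - x\<bar> * y + x * \<bar>y - Y\<bar>"
    using x0 y0 abs_triangle_ineq[of "(X - x) * y" "x * (y - Y)"] by (simp add: abs_mult)
  also have "\<dots> \<le> B / Q * y + x * (B / Q)"
    using x y x0 y0 by (intro add_mono mult_left_mono mult_right_mono) auto
  finally have "\<bar>X / Y - x / y\<bar> \<le> (B / Q * y + x * (B / Q)) / (Y * y)"
    unfolding eq abs_divide using Y0 y0 by (simp add: abs_mult divide_right_mono)
  also have "\<dots> = B / Q * (1 + x / y) * (1 / Y)"
  proof -
    have "(c * y + x * c) / (Y * y) = c * (1 + x / y) * (1 / Y)" for c
      using Y0 y0 by (simp add: field_simps)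
    then show ?thesis .
  qed
  also have "\<dots> \<le> B / Q * (1 + B\<^sup>2) * (2 * B)"
  proof (intro mult_mono)
    show "1 / Y \<le> 2 * B" using Y Y0 B0 by (simp add: field_simps)
  qed (use xy x0 y0 Y0 B0 Q in auto)
  also have "\<dots> \<le> B / Q * (2 * B\<^sup>2) * (2 * B)"
    using B B0 Q by (intro mult_left_mono mult_right_mono) (auto simp: power2_eq_square intro: order_trans[OF _ mult_mono[of 1 B 1 B]])
  also have "\<dots> = (2 / B ^ 8)\<^sup>2"
    using B0 by (simp add: Q field_simps power2_eq_square eval_nat_numeral)
  finally have "sqrt \<bar>X / Y - x / y\<bar> \<le> sqrt ((2 / B ^ 8)\<^sup>2)"
    by (rule real_sqrt_le_mono)
  then have "sqrt \<bar>X / Y - x / y\<bar> \<le> 2 / B ^ 8"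
    using B0 by simp
  moreover have "\<bar>sqrt (X / Y) - sqrt (x / y)\<bar> \<le> sqrt \<bar>X / Y - x / y\<bar>"
    using X Y0 x0 y0 by (intro abs_sqrt_diff_le) auto
  ultimately show "\<bar>sqrt (X / Y) - sqrt (x / y)\<bar> \<le> 2 / B ^ 8"
    by linarith
qed

text \<open>\<open>\<sigma>\<close> is the root of the truncated ratio and \<open>r\<close> its own
  truncation; \<open>q\<close> truncates the entry \<open>\<beta>\<close>. The target
  \<open>1 / (2 * B ^ 7)\<close> is such that \<open>B ^ 6\<close> of these errors add up to
  \<open>1 / (2 * B)\<close>.\<close>

lemma fixed_point_product_error:
  fixes B Q \<rho> \<beta> \<sigma> r q :: real
  assumes B: "B \<ge> 32" and Q: "Q = B ^ 20" and \<rho>: "0 \<le> \<rho>" "\<rho> \<le> B" and \<beta>: "\<bar>\<beta>\<bar> \<le> 1"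
    and \<sigma>: "\<bar>\<sigma> - \<rho>\<bar> \<le> 2 / B ^ 8" and r: "\<bar>r - \<sigma>\<bar> \<le> 1 / Q" and q: "\<bar>q - \<beta>\<bar> \<le> 1 / Q" "\<bar>q\<bar> \<le> 1"
  shows "\<bar>r * q - \<rho> * \<beta>\<bar> \<le> 1 / (2 * B ^ 7)"
proof -
  have B0: "B > 0" using B by simp
  have Q8: "1 / Q \<le> 1 / B ^ 9"
    unfolding Q using B by (intro divide_left_mono power_increasing) auto
  have "r * q - \<rho> * \<beta> = (r - \<rho>) * q + \<rho> * (q - \<beta>)"
    by (simp add: algebra_simps)
  then have "\<bar>r * q - \<rho> * \<beta>\<bar> \<le> \<bar>r - \<rho>\<bar> * \<bar>q\<bar> + \<rho> * \<bar>q - \<beta>\<bar>"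
    using \<rho>(1) abs_triangle_ineq[of "(r - \<rho>) * q" "\<rho> * (q - \<beta>)"] by (simp add: abs_mult)
  also have "\<dots> \<le> (1 / B ^ 9 + 2 / B ^ 8) * 1 + B * (1 / B ^ 9)"
  proof (intro add_mono mult_mono)
    show "\<bar>r - \<rho>\<bar> \<le> 1 / B ^ 9 + 2 / B ^ 8" using r \<sigma> Q8 by linarith
    show "\<bar>q - \<beta>\<bar> \<le> 1 / B ^ 9" using q Q8 by linarith
  qed (use q \<rho> B0 in auto)
  also have "\<dots> = (1 / B + 3) / B * (1 / B ^ 7)"
    using B0 by (simp add: field_simps eval_nat_numeral)
  also have "\<dots> \<le> 1 / 2 * (1 / B ^ 7)"
  proof (intro mult_right_mono)
    have "(1 / B + 3) / B \<le> (1 + 3) / 32"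
      using B by (intro frac_le add_mono) auto
    also have "(1 + 3) / 32 \<le> 1 / (2::real)" by simp
    finally show "(1 / B + 3) / B \<le> 1 / 2" .
  qed (use B0 in auto)
  finally show ?thesis by simp
qed

text \<open>The weak estimate \<open>exp (- z) \<le> 1 / z\<close> at
  \<open>z \<ge> B ^ 5 / 2\<close> gives \<open>2 / B ^ 5\<close>; the division by
  \<open>lam\<^sup>2\<close> costs \<open>B\<^sup>2\<close>. The threshold 32 is where
  \<open>2 / B\<close> drops to \<open>1 / 16\<close>.\<close>

lemma decay_bound:
  fixes B lam :: real
  assumes B: "B \<ge> 32" and lam: "1 / B \<le> lam" "lam \<le> 2" and K: "real K = B ^ 6"
  shows "(1 - lam / 2) ^ K / lam\<^sup>2 \<le> (1 / (4 * B))\<^sup>2"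
proof -
  have B0: "B > 0" using B by simp
  have l0: "lam > 0" using lam B0 by (smt (verit) divide_pos_pos)
  define z where "z = real K * (lam / 2)"
  have z: "z \<ge> B ^ 5 / 2"
  proof -
    have "B ^ 6 * (1 / B / 2) \<le> B ^ 6 * (lam / 2)"
      using lam B0 by (intro mult_left_mono) auto
    then show ?thesis using B0 by (simp add: z_def K eval_nat_numeral)
  qed
  have "(1 - lam / 2) ^ K \<le> exp (- (lam / 2)) ^ K"
    using lam exp_ge_add_one_self[of "- (lam / 2)"] by (intro power_mono) auto
  also have "\<dots> = exp (- z)"
    by (simp add: z_def exp_of_nat_mult[symmetric])
  also have "\<dots> \<le> 1 / z"
  proof -
    have "z \<le> exp z" using exp_ge_add_one_self[of z] by linarith
    moreover have "z > 0" using z B0 by (smt (verit) divide_pos_pos zero_less_power)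
    ultimately show ?thesis by (simp add: exp_minus field_simps)
  qed
  also have "\<dots> \<le> 1 / (B ^ 5 / 2)"
    using z B0 by (intro divide_left_mono mult_pos_pos) (auto intro: less_le_trans[OF _ z])
  finally have pow: "(1 - lam / 2) ^ K \<le> 2 / B ^ 5" by simp
  have "1 / B\<^sup>2 \<le> lam\<^sup>2"
    using power_mono[OF lam(1), of 2] B0 by (simp add: power_divide)
  with pow have "(1 - lam / 2) ^ K / lam\<^sup>2 \<le> (2 / B ^ 5) / (1 / B\<^sup>2)"
    using B0 by (intro frac_le) auto
  also have "\<dots> = 2 / B * (1 / B\<^sup>2)"
    using B0 by (simp add: field_simps eval_nat_numeral)
  also have "\<dots> \<le> 1 / 16 * (1 / B\<^sup>2)"
    using B B0 by (intro mult_right_mono) (auto simp: field_simps)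
  also have "\<dots> = (1 / (4 * B))\<^sup>2"
    by (simp add: power2_eq_square)
  finally show ?thesis .
qed

lemma diff_divide_le:
  fixes q x c r :: real
  assumes "0 < q" "q * x - c \<le> r"
  shows "x - c / q \<le> r / q"
proof -
  have "x - c / q = (q * x - c) / q"
    using assms(1) by (simp add: diff_divide_distrib)
  with assms show ?thesis
    by (simp add: divide_right_mono)
qed

lemma abs_divide_diff_le:
  fixes q x r :: real
  assumes "0 < q" "q * x - 1 \<le> r" "r \<le> q * x"
  shows "\<bar>r / q - x\<bar> \<le> 1 / q"
proof -
  have "r / q \<le> q * x / q"
    using assms by (intro divide_right_mono) auto
  then have "r / q \<le> x"
    using assms(1) by simp
  moreover have "x - 1 / q \<le> r / q"
    using assms by (intro diff_divide_le)
  ultimately show ?thesis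
    by (simp add: abs_le_iff) 
qed

section \<open>Truncated degrees and the stability of the walk operator\<close>

context connected_weighted_graph
begin

abbreviation unit_weight :: real where "unit_weight \<equiv> weight_unit n w"

text \<open>Truncation happens before summation because the program reads the weights one by
  one.\<close>

definition idegree :: "nat \<Rightarrow> nat \<Rightarrow> int" where
  "idegree p v = (\<Sum>j<n. \<lfloor>2 ^ p * (w v j / unit_weight)\<rfloor>)"

lemma weight_unit_bounds:
  shows "unit_weight > 0" "\<And>i j. i < n \<Longrightarrow> j < n \<Longrightarrow> w i j < unit_weight"
    "\<exists>i<n. \<exists>j<n. unit_weight \<le> 2 * w i j"
proof -
  let ?W = "{w i j |i j. i < n \<and> j < n}"
  have W: "?W = (\<lambda>(i, j). w i j) ` ({..<n} \<times> {..<n})"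
    by auto
  have fin: "finite ?W"
    unfolding W by simp
  obtain j where "j < n" "w 0 j > 0"
    using ex_neighbour[of 0] n2 by auto
  moreover from this have in0: "w 0 j \<in> ?W"
    using n2 by fastforce
  ultimately have pos: "Max ?W > 0"
    using Max_ge[OF fin in0] by linarith
  let ?l = "log 2 (Max ?W)"
  have ul: "unit_weight = 2 powr (of_int \<lfloor>?l\<rfloor> + 1)"
    by (simp add: weight_unit_def)
  then show "unit_weight > 0" by simp
  have "Max ?W = 2 powr ?l"
    using pos by simp
  also have "\<dots> < unit_weight"
    unfolding ul by (intro powr_less_mono) linarith+
  finally have less: "Max ?W < unit_weight" .
  show "w i j < unit_weight" if "i < n" "j < n" for i j
    using Max_ge[OF fin, of "w i j"] that less by fastforce
  have "unit_weight \<le> 2 powr (?l + 1)"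
    unfolding ul by (intro powr_mono) auto
  also have "\<dots> = 2 * Max ?W"
    using pos by (simp add: powr_add)
  finally have "unit_weight \<le> 2 * Max ?W" .
  moreover have "Max ?W \<in> ?W"
    using in0 by (intro Max_in fin) auto
  then obtain i j where "i < n" "j < n" "Max ?W = w i j"
    by blast
  ultimately show "\<exists>i<n. \<exists>j<n. unit_weight \<le> 2 * w i j"
    by auto
qed

lemma idegree_le: "real_of_int (idegree p v) \<le> 2 ^ p * (d v / unit_weight)"
proof -
  have "real_of_int (idegree p v) \<le> (\<Sum>j<n. 2 ^ p * (w v j / unit_weight))"
    unfolding idegree_def of_int_sum by (intro sum_mono) simp
  then show ?thesis by (simp add: deg_def sum_distrib_left sum_divide_distrib)
qed

lemma idegree_ge: "2 ^ p * (d v / unit_weight) - real n \<le> real_of_int (idegree p v)"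
proof -
  have "(\<Sum>j<n. 2 ^ p * (w v j / unit_weight) - 1) \<le> real_of_int (idegree p v)"
    unfolding idegree_def of_int_sum by (intro sum_mono) linarith
  then show ?thesis by (simp add: deg_def sum_distrib_left sum_divide_distrib sum_subtractf)
qed

lemma d_le: "v < n \<Longrightarrow> d v / unit_weight \<le> real n"
proof -
  assume v: "v < n"
  have "d v / unit_weight = (\<Sum>j<n. w v j / unit_weight)"
    by (simp add: deg_def sum_divide_distrib)
  also have "\<dots> \<le> (\<Sum>j<n. 1)"
  proof (intro sum_mono)
    fix j assume "j \<in> {..<n}"
    then have "w v j \<le> unit_weight"
      using weight_unit_bounds(2)[OF v, of j] by simp
    then show "w v j / unit_weight \<le> 1"
      using weight_unit_bounds(1) by simp
  qed
  finally show ?thesis by simp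
qed

text \<open>\<open>lazy\<close> averages with nonnegative coefficients of sum 1, so a rounding error
  does not grow along the walk.\<close>

lemma lazy_diff_bound:
  assumes "\<And>v. v < n \<Longrightarrow> \<bar>f v - g v\<bar> \<le> c" "v < n"
  shows "\<bar>(lazy ^^ k) f v - (lazy ^^ k) g v\<bar> \<le> c"
  using assms(2)
proof (induction k arbitrary: v)
  case 0
  then show ?case by (simp add: assms(1))
next
  case (Suc k)
  let ?f = "(lazy ^^ k) f" and ?g = "(lazy ^^ k) g"
  have eq: "avg ?f v - avg ?g v = (\<Sum>j<n. w v j / d v * (?f j - ?g j))"
    by (simp only: avg_def right_diff_distrib sum_subtractf)
  have "\<bar>avg ?f v - avg ?g v\<bar> \<le> (\<Sum>j<n. \<bar>w v j / d v * (?f j - ?g j)\<bar>)"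
    unfolding eq by (rule sum_abs)
  also have "\<dots> \<le> (\<Sum>j<n. w v j / d v * c)"
  proof (rule sum_mono)
    fix j assume "j \<in> {..<n}"
    then have j: "j < n" by simp
    have "0 \<le> w v j / d v"
      using w_nonneg[OF Suc.prems j] d_pos[OF Suc.prems] by (intro divide_nonneg_nonneg) auto
    then show "\<bar>w v j / d v * (?f j - ?g j)\<bar> \<le> w v j / d v * c"
      unfolding abs_mult abs_of_nonneg[OF \<open>0 \<le> w v j / d v\<close>]
      by (rule mult_left_mono[OF Suc.IH[OF j]])
  qed
  also have "\<dots> = avg (\<lambda>_. c) v"
    by (simp add: avg_def)
  also have "\<dots> = c"
    by (rule avg_const[OF Suc.prems])
  finally have "\<bar>avg ?f v - avg ?g v\<bar> \<le> c" .
  moreover have "\<bar>?f v - ?g v\<bar> \<le> c"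
    by (rule Suc.IH[OF Suc.prems])
  moreover have "lazy ?f v - lazy ?g v = ((?f v - ?g v) + (avg ?f v - avg ?g v)) / 2"
    by (simp add: lazy_def diff_divide_distrib add_divide_distrib)
  ultimately show ?case by simp
qed

end

text \<open>The parameters which the program finds by search: \<open>2 ^ m\<close> dominates the size, the inverses of
  the spectral bound and of the precision, and the inverses of all normalized degrees.\<close>

locale laplacian_parameters = connected_weighted_graph +
  fixes i :: nat and b :: "real Matrix.vec" and lam eps gam :: real and m kg :: nat
  assumes i: "i < n"
    and b: "b \<in> mat_image (laplacian n w)" "(\<Sum>v<n. (b $ v)\<^sup>2) = 1"
    and lam: "lam \<le> lambda2 n w" "lam \<le> 2" "1 \<le> 2 ^ m * lam"
    and eps: "1 \<le> 2 ^ m * eps" and gam: "1 \<le> 2 ^ kg * gam"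
    and m: "5 \<le> m" "n \<le> 2 ^ m" "\<And>v. v < n \<Longrightarrow> 1 \<le> idegree m v"
begin

definition B :: int where "B = 2 ^ m"
definition Q :: int where "Q = B ^ 20"
definition K :: nat where "K = (2 ^ m) ^ 6"
text \<open>With the sample bound \<open>A = 2 * B ^ 7 * Q\<^sup>2\<close> and the least tolerance
  \<open>t = Q\<^sup>2 / B\<close>, the factor \<open>8 * B ^ 16\<close> is
  \<open>2 * (A / t)\<^sup>2\<close>, so the Hoeffding exponent is at least
  \<open>kg + 1\<close>.\<close>

definition N :: nat where "N = 8 * (2 ^ m) ^ 16 * (kg + 1)"
definition floor_ratio :: "nat \<Rightarrow> int" where
  "floor_ratio v = \<lfloor>of_int Q * sqrt (of_int (idegree (20 * m) i) / of_int (idegree (20 * m) v))\<rfloor>"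
text \<open>A fixed-point value of \<open>sqrt (d i) * scaled b v\<close>, carrying the scale
  \<open>Q\<^sup>2\<close> as a product of two numbers of scale \<open>Q\<close>.\<close>

definition F :: "nat \<Rightarrow> int" where "F v = floor_ratio v * \<lfloor>2 ^ (20 * m) * b $ v\<rfloor>"

lemma real_B: "real_of_int B = 2 ^ m"
  by (simp add: B_def)

lemma real_Q: "real_of_int Q = real_of_int B ^ 20" "real_of_int Q = 2 ^ (20 * m)"
  using power_mult[of "2::real" m 20] by (simp_all add: Q_def B_def mult.commute[of 20 m])

lemma real_K: "real K = real_of_int B ^ 6"
  by (simp add: K_def B_def)

lemma B_ge: "32 \<le> B" "32 \<le> real_of_int B"
proof -
  show 1: "32 \<le> B"
    using power_increasing[OF m(1), of "2::int"] by (simp add: B_def)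
  show "32 \<le> real_of_int B"
    using 1 by linarith
qed

lemma abs_b_le: "v < n \<Longrightarrow> \<bar>b $ v\<bar> \<le> 1"
proof -
  assume "v < n"
  then have "(b $ v)\<^sup>2 \<le> (\<Sum>v<n. (b $ v)\<^sup>2)"
    by (intro member_le_sum) auto
  then show ?thesis by (simp add: b abs_square_le_1)
qed

lemma n_le_B: "real n \<le> real_of_int B"
proof -
  have "real n \<le> real (2 ^ m)"
    using m(2) of_nat_mono by blast
  then show ?thesis by (simp add: B_def)
qed

text \<open>These are the hypotheses of \<open>sqrt_ratio_approx\<close>. The lower bound holds
  because the degree is visible already at the coarse precision of \<open>m\<close> digits, which
  the search ensures.\<close>

lemma degree_bounds:
  assumes v: "v < n"
  defines "x \<equiv> d v / unit_weight" and "X \<equiv> real_of_int (idegree (20 * m) v) / real_of_int Q"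
  shows "1 / real_of_int B \<le> x" "x \<le> real_of_int B" "x - real_of_int B / real_of_int Q \<le> X" "X \<le> x"
proof -
  have Q0: "real_of_int Q > 0" and B0: "real_of_int B > 0"
    using B_ge by (simp_all add: real_Q)
  have "1 \<le> real_of_int (idegree m v)"
    using m(3)[OF v] by simp
  also have "\<dots> \<le> real_of_int B * x"
    using idegree_le[of m v] by (simp add: real_B x_def)
  finally show "1 / real_of_int B \<le> x"
    using B0 by (simp add: field_simps)
  show "x \<le> real_of_int B"
    using d_le[OF v] n_le_B by (simp add: x_def)
  have "real_of_int Q * x - real_of_int B \<le> real_of_int (idegree (20 * m) v)"
    using idegree_ge[of "20 * m" v] n_le_B by (simp add: real_Q(2) x_def)
  then show "x - real_of_int B / real_of_int Q \<le> X"
    unfolding X_def by (intro diff_divide_le Q0)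
  have "real_of_int (idegree (20 * m) v) \<le> real_of_int Q * x"
    using idegree_le[of "20 * m" v] by (simp add: real_Q(2) x_def)
  then show "X \<le> x"
    using Q0 by (simp add: X_def field_simps)
qed

text \<open>One application of \<open>sqrt_ratio_approx\<close> yields both the accuracy of a
  summand and the ranges of the registers that compute it, hence the joint statement.\<close>

lemma
  assumes v: "v < n"
  shows F_error: "\<bar>real_of_int (F v) / (real_of_int Q)\<^sup>2 - sqrt (d i) * scaled b v\<bar> \<le> 1 / (2 * real_of_int B ^ 7)"
    and idegree_pos: "0 < idegree (20 * m) v"
    and idegree_nonneg: "0 \<le> idegree (20 * m) i"
    and root_bounds: "0 \<le> floor_ratio v" "floor_ratio v \<le> 2 * B * Q"
    and abs_F_le: "\<bar>F v\<bar> \<le> 2 * B * Q\<^sup>2"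
proof -
  let ?B = "real_of_int B" and ?Q = "real_of_int Q" and ?U = "unit_weight"
  let ?X = "real_of_int (idegree (20 * m) i) / ?Q" and ?Y = "real_of_int (idegree (20 * m) v) / ?Q"
  note U = weight_unit_bounds(1)
  have Q0: "?Q > 0" and B0: "?B > 0"
    using B_ge by (simp_all add: real_Q)
  note approx = sqrt_ratio_approx[OF B_ge(2) real_Q(1) degree_bounds[OF i] degree_bounds[OF v]]
  have Y0: "?Y > 0"
    using approx(2) B0 by (smt (verit) divide_pos_pos)
  then show pos: "0 < idegree (20 * m) v"
    using Q0 by (simp add: zero_less_divide_iff)
  show nonneg: "0 \<le> idegree (20 * m) i"
    using approx(3) Q0 by (simp add: zero_le_divide_iff)
  have ratio: "real_of_int (idegree (20 * m) i) / real_of_int (idegree (20 * m) v) = ?X / ?Y"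
    using Q0 by simp
  have ratio': "d i / ?U / (d v / ?U) = d i / d v"
    using U by simp
  define \<sigma> where "\<sigma> = sqrt (?X / ?Y)"
  define \<rho> where "\<rho> = sqrt (d i / d v)"
  have \<sigma>\<rho>: "\<bar>\<sigma> - \<rho>\<bar> \<le> 2 / ?B ^ 8" and \<rho>B: "\<rho> \<le> ?B" and \<sigma>0: "0 \<le> \<sigma>"
    using approx(1,4) divide_nonneg_pos[OF approx(3) Y0]
    unfolding ratio' \<sigma>_def \<rho>_def by (simp_all only: real_sqrt_ge_zero)
  have floor_ratio: "floor_ratio v = \<lfloor>?Q * \<sigma>\<rfloor>"
    by (simp only: floor_ratio_def ratio \<sigma>_def)
  have r: "?Q * \<sigma> - 1 \<le> real_of_int (floor_ratio v)" "real_of_int (floor_ratio v) \<le> ?Q * \<sigma>"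
    unfolding floor_ratio by linarith+
  show root0: "0 \<le> floor_ratio v"
    unfolding floor_ratio using Q0 \<sigma>0 by simp
  have "2 / ?B ^ 8 \<le> ?B"
  proof -
    have "2 / ?B ^ 8 \<le> 2 / 1"
      using B_ge(2) by (intro divide_left_mono) (auto intro: one_le_power)
    then show ?thesis using B_ge(2) by linarith
  qed
  then have "\<sigma> \<le> 2 * ?B"
    using \<sigma>\<rho> \<rho>B by linarith
  then have "?Q * \<sigma> \<le> ?Q * (2 * ?B)"
    using Q0 by (intro mult_left_mono) auto
  with r(2) have "real_of_int (floor_ratio v) \<le> real_of_int (2 * B * Q)"
    by (simp add: mult.commute mult.left_commute)
  then show rootB: "floor_ratio v \<le> 2 * B * Q"
    by linarith
  let ?q = "\<lfloor>2 ^ (20 * m) * b $ v\<rfloor>"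
  have q: "?q = \<lfloor>?Q * b $ v\<rfloor>" by (simp add: real_Q(2))
  have "- 1 \<le> b $ v" "b $ v \<le> 1"
    using abs_b_le[OF v] by linarith+
  then have "- ?Q \<le> ?Q * b $ v" "?Q * b $ v \<le> ?Q"
    using Q0 mult_left_mono[of "- 1" "b $ v" ?Q] mult_left_mono[of "b $ v" 1 ?Q] by simp_all
  then have qQ: "\<bar>?q\<bar> \<le> Q"
    unfolding q by (simp add: abs_le_iff floor_le_iff le_floor_iff minus_le_iff)
  have "\<bar>F v\<bar> \<le> (2 * B * Q) * Q"
    unfolding F_def abs_mult using root0 rootB qQ Q0 by (intro mult_mono) auto
  then show "\<bar>F v\<bar> \<le> 2 * B * Q\<^sup>2"
    by (simp add: power2_eq_square)
  have "\<bar>real_of_int (floor_ratio v) / ?Q * (real_of_int ?q / ?Q) - \<rho> * b $ v\<bar> \<le> 1 / (2 * ?B ^ 7)"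
  proof (rule fixed_point_product_error[OF B_ge(2) real_Q(1) _ \<rho>B abs_b_le[OF v] \<sigma>\<rho>])
    show "0 \<le> \<rho>"
      using d_pos[OF i] d_pos[OF v] by (simp add: \<rho>_def)
    show "\<bar>real_of_int (floor_ratio v) / ?Q - \<sigma>\<bar> \<le> 1 / ?Q"
      by (rule abs_divide_diff_le[OF Q0 r])
    have "?Q * b $ v - 1 \<le> real_of_int ?q" "real_of_int ?q \<le> ?Q * b $ v"
      unfolding q by linarith+
    then show "\<bar>real_of_int ?q / ?Q - b $ v\<bar> \<le> 1 / ?Q"
      by (rule abs_divide_diff_le[OF Q0])
    have "\<bar>real_of_int ?q\<bar> \<le> ?Q"
      using qQ by linarith
    then show "\<bar>real_of_int ?q / ?Q\<bar> \<le> 1"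
      using Q0 by simp
  qed
  moreover have "\<rho> * b $ v = sqrt (d i) * scaled b v"
    by (simp add: \<rho>_def scaled_def real_sqrt_divide)
  ultimately show "\<bar>real_of_int (F v) / ?Q\<^sup>2 - sqrt (d i) * scaled b v\<bar> \<le> 1 / (2 * ?B ^ 7)"
    by (simp add: F_def power2_eq_square)
qed

definition sample :: "int pmf" where
  "sample = map_pmf fst (trajectory_sum F K 0 i)"

lemma expectation_sample:
  "measure_pmf.expectation sample real_of_int = (\<Sum>k<K. (lazy ^^ k) (\<lambda>u. of_int (F u)) i)"
  using expectation_trajectory_sum[OF i, of F K 0] by (simp add: sample_def)

lemma sample_bound:
  assumes "y \<in> set_pmf sample"
  shows "\<bar>y\<bar> \<le> int K * (2 * B * Q\<^sup>2)"
proof -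
  from assms obtain u where "(y, u) \<in> set_pmf (trajectory_sum F K 0 i)"
    by (auto simp: sample_def)
  from trajectory_sum_bound[OF abs_F_le i this] show ?thesis by simp
qed

lemma lazy_scale: "lazy (\<lambda>v. c * f v) v = c * lazy f v"
  by (simp add: lazy_def avg_def sum_distrib_left algebra_simps add_divide_distrib)

lemma lazy_pow_scale: "(lazy ^^ k) (\<lambda>v. c * f v) v = c * (lazy ^^ k) f v"
proof (induction k arbitrary: v)
  case (Suc k)
  have "(lazy ^^ k) (\<lambda>v. c * f v) = (\<lambda>v. c * (lazy ^^ k) f v)"
    using Suc by (intro ext)
  then show ?case
    by (simp add: lazy_scale)
qed simp

text \<open>Truncation costs \<open>1 / (4 * B)\<close>. Rounding costs \<open>K\<close> errors of
  \<open>1 / (2 * B ^ 7)\<close>, halved by the factor in front of the lazy series, again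
  \<open>1 / (4 * B)\<close>. Finally \<open>1 / B \<le> eps\<close>.\<close>

lemma bias:
  defines "\<mu> \<equiv> measure_pmf.expectation sample real_of_int"
  shows "\<bar>\<mu> / (2 * (real_of_int Q)\<^sup>2) - (pseudo_inverse (laplacian n w) *\<^sub>v b) $ i\<bar> \<le> eps / 2"
proof -
  let ?B = "real_of_int B" and ?Q = "real_of_int Q"
  let ?x = "(pseudo_inverse (laplacian n w) *\<^sub>v b) $ i"
  let ?s = "\<Sum>k<K. (lazy ^^ k) (scaled b) i"
  have B0: "?B > 0" using B_ge by simp
  have lam0: "1 / ?B \<le> lam" and eps0: "1 / ?B \<le> eps"
    using lam(3) eps B0 by (simp_all add: real_B field_simps)
  have lampos: "0 < lam"
    using lam0 B0 by (smt (verit) divide_pos_pos)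
  have "(?x - sqrt (d i) / 2 * ?s)\<^sup>2 \<le> (1 / (4 * ?B))\<^sup>2"
    using truncated_series_error[OF b lampos lam(1,2) i] decay_bound[OF B_ge(2) lam0 lam(2) real_K]
    by (rule order_trans)
  then have tail: "\<bar>?x - sqrt (d i) / 2 * ?s\<bar> \<le> 1 / (4 * ?B)"
    using B0 by (simp add: abs_le_square_iff[symmetric])
  let ?f = "\<lambda>v. 1 / ?Q\<^sup>2 * real_of_int (F v)" and ?g = "\<lambda>v. sqrt (d i) * scaled b v"
  have eq: "\<mu> / ?Q\<^sup>2 - sqrt (d i) * ?s = (\<Sum>k<K. (lazy ^^ k) ?f i - (lazy ^^ k) ?g i)"
    unfolding sum_subtractf lazy_pow_scale sum_distrib_left[symmetric] \<mu>_def expectation_sample by simp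
  have "\<bar>\<mu> / ?Q\<^sup>2 - sqrt (d i) * ?s\<bar> \<le> (\<Sum>k<K. \<bar>(lazy ^^ k) ?f i - (lazy ^^ k) ?g i\<bar>)"
    unfolding eq by (rule sum_abs)
  also have "\<dots> \<le> (\<Sum>k<K. 1 / (2 * ?B ^ 7))"
    using F_error by (intro sum_mono lazy_diff_bound i) simp
  also have "\<dots> = 1 / (2 * ?B)"
    using B0 by (simp add: real_K eval_nat_numeral)
  finally have "\<bar>\<mu> / ?Q\<^sup>2 - sqrt (d i) * ?s\<bar> \<le> 1 / (2 * ?B)" .
  moreover have "\<mu> / (2 * ?Q\<^sup>2) - sqrt (d i) / 2 * ?s = (\<mu> / ?Q\<^sup>2 - sqrt (d i) * ?s) / 2"
    by (simp add: diff_divide_distrib)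
  ultimately have "\<bar>\<mu> / (2 * ?Q\<^sup>2) - sqrt (d i) / 2 * ?s\<bar> \<le> 1 / (4 * ?B)"
    by simp
  moreover have "1 / (4 * ?B) = 1 / ?B / 4"
    by simp
  ultimately show ?thesis
    using tail eps0 by linarith
qed

lemma estimator_accuracy:
  "measure_pmf.prob (iid_sum sample N 0)
     {s. additive_approx eps ((pseudo_inverse (laplacian n w) *\<^sub>v b) $ i)
           (of_int s / of_int (2 * int N * Q\<^sup>2))} \<ge> 1 - gam"
proof -
  let ?B = "real_of_int B" and ?Q = "real_of_int Q"
  let ?\<mu> = "measure_pmf.expectation sample real_of_int"
  define A where "A = real K * (2 * ?B * ?Q\<^sup>2)"
  \<comment> \<open>After division by \<open>2 * Q\<^sup>2\<close> this is \<open>eps / 2\<close>,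
    the part of the error that the bias leaves over.\<close>
  define t where "t = ?Q\<^sup>2 * eps"
  have B0: "?B > 0" and Q0: "?Q > 0"
    using B_ge by (simp_all add: real_Q)
  have eps0: "1 / ?B \<le> eps"
    using eps B0 by (simp add: real_B field_simps)
  then have e0: "eps > 0"
    using B0 by (smt (verit) divide_pos_pos)
  have A0: "A > 0" and t0: "t > 0" and N0: "N > 0"
    using B0 Q0 e0 by (simp_all add: A_def t_def N_def K_def)
  have A: "\<bar>real_of_int y\<bar> \<le> A" if "y \<in> set_pmf sample" for y
  proof -
    have "real_of_int \<bar>y\<bar> \<le> real_of_int (int K * (2 * B * Q\<^sup>2))"
      using sample_bound[OF that] by (simp only: of_int_le_iff)
    then show ?thesis by (simp add: A_def)
  qed
  have N: "real N = 8 * ?B ^ 16 * real (kg + 1)"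
    by (simp add: N_def real_B algebra_simps)
  have "real (kg + 1) = real N * (?Q\<^sup>2 * (1 / ?B))\<^sup>2 / (2 * A\<^sup>2)"
    unfolding A_def N real_K using B0 Q0 by (simp add: field_simps eval_nat_numeral)
  also have "\<dots> \<le> real N * t\<^sup>2 / (2 * A\<^sup>2)"
    unfolding t_def using eps0 B0 Q0 A0
    by (intro divide_right_mono mult_left_mono power_mono) auto
  finally have expo: "real (kg + 1) \<le> real N * t\<^sup>2 / (2 * A\<^sup>2)" .
  have "2 * exp (- (real N * t\<^sup>2 / (2 * A\<^sup>2))) \<le> 2 * exp (- real (kg + 1))"
    using expo by simp
  also have "exp (- real (kg + 1)) = exp (- 1) ^ (kg + 1)"
    by (simp only: exp_of_nat_mult[symmetric]) simp
  also have "\<dots> \<le> (1 / 2) ^ (kg + 1)"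
    using exp_ge_add_one_self[of 1] by (intro power_mono) (auto simp: exp_minus field_simps)
  \<comment> \<open>The \<open>+ 1\<close> in the number of samples absorbs the factor 2 from the
    two tails.\<close>
  also have "2 * (1 / 2) ^ (kg + 1) \<le> gam"
    using gam by (simp add: field_simps power_divide)
  finally have "1 - gam \<le> 1 - 2 * exp (- (real N * t\<^sup>2 / (2 * A\<^sup>2)))"
    by simp
  also have "\<dots> \<le> measure_pmf.prob (iid_sum sample N 0) {s. \<bar>of_int s / real N - ?\<mu>\<bar> < t}"
    by (rule iid_sum_concentration[OF A A0 t0 N0])
  also have "\<dots> \<le> measure_pmf.prob (iid_sum sample N 0)
     {s. additive_approx eps ((pseudo_inverse (laplacian n w) *\<^sub>v b) $ i)
           (of_int s / of_int (2 * int N * Q\<^sup>2))}"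
  proof (intro measure_pmf.finite_measure_mono subsetI CollectI)
    fix s assume "s \<in> {s. \<bar>real_of_int s / real N - ?\<mu>\<bar> < t}"
    then have s: "\<bar>of_int s / real N - ?\<mu>\<bar> < t" by simp
    have eq: "of_int s / of_int (2 * int N * Q\<^sup>2) - ?\<mu> / (2 * ?Q\<^sup>2) = (of_int s / real N - ?\<mu>) / (2 * ?Q\<^sup>2)"
      by (simp add: diff_divide_distrib)
    have "\<bar>of_int s / of_int (2 * int N * Q\<^sup>2) - ?\<mu> / (2 * ?Q\<^sup>2)\<bar> \<le> t / (2 * ?Q\<^sup>2)"
      unfolding eq using s Q0 by (simp add: abs_divide divide_right_mono)
    also have "\<dots> = eps / 2"
      using Q0 by (simp add: t_def)
    finally show "additive_approx eps ((pseudo_inverse (laplacian n w) *\<^sub>v b) $ i)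
        (of_int s / of_int (2 * int N * Q\<^sup>2))"
      using bias unfolding additive_approx_def by linarith
  qed simp
  finally show ?thesis .
qed

end

section \<open>The program\<close>

fun apow :: "aexp \<Rightarrow> nat \<Rightarrow> aexp" where
  "apow a 0 = Const 1"
| "apow a (Suc k) = Times a (apow a k)"

lemma aval_apow [simp]: "aval (apow a k) s = aval a s ^ k"
  by (induction k) simp_all

abbreviation dec :: "nat \<Rightarrow> com" where
  "dec x \<equiv> Assign x (Minus (Reg x) (Const 1))"

abbreviation clear :: "nat \<Rightarrow> com" where
  "clear x \<equiv> Assign x (Const 0)"

text \<open>
  Registers: 0 accumulator, 1 denominator of the output, 2 size, 3 \<open>m\<close>, 4 \<open>2 ^ m\<close>, 6 \<open>kg\<close>,
  7 remaining samples, 8 remaining steps of the walk, 9 vertex, 10 degree of the start vertex,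
  11 degree of the vertex in 9 or result of a test, 12 summation index, 13 summand, 14 square root,
  15 entry of the right-hand side, 16 coin. Working registers are cleared after use, so that the
  store between two rounds is determined by the accumulator, the counters and the vertex.
\<close>

definition degree_com :: "aexp \<Rightarrow> com" where
  "degree_com p = Seq (clear 11) (Seq (Assign 12 (Reg 2))
     (While (Reg 12) (Seq (dec 12) (Seq (Read 13 (Weight (Reg 9) (Reg 12)) p)
       (Seq (Assign 11 (Plus (Reg 11) (Reg 13))) (clear 13))))))"

text \<open>The test \<open>c\<close> leaves its verdict in register 11, a positive number for
  success. It runs once before the loop because the guard inspects that verdict.\<close>

definition search_com :: "com \<Rightarrow> com" where
  "search_com c = Seq c (Seq (While (Minus (Const 1) (Reg 11))
     (Seq (Assign 3 (Plus (Reg 3) (Const 1))) c)) (clear 11))"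

text \<open>Expressions have no variable exponents, but \<open>Read\<close> shifts by one: reading
  \<open>n\<close> with \<open>m\<close> digits and dividing by \<open>n\<close> produces
  \<open>2 ^ m\<close>. The verdict \<open>2 ^ m + 1 - n\<close> is positive exactly if
  \<open>n \<le> 2 ^ m\<close>.\<close>

definition size_test_com :: com where
  "size_test_com = Seq (Read 11 NumVertices (Reg 3))
     (Assign 11 (Plus (Div (Reg 11) (Reg 2)) (Minus (Const 1) (Reg 2))))"

abbreviation full_precision :: aexp where
  "full_precision \<equiv> Times (Const 20) (Reg 3)"

text \<open>Register 3 is carried from vertex to vertex. It only grows, so by
  \<open>idegree_mono\<close> degrees that were positive stay positive.\<close>

definition degrees_com :: com where
  "degrees_com = While (Reg 9) (Seq (dec 9) (search_com (degree_com (Reg 3))))"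

text \<open>The exponent for \<open>gam\<close> is found with the same counter, saved in register 6,
  and the counter restarts at 5 to give \<open>B \<ge> 32\<close>. From there each search continues
  at the value reached by the previous one, so the final \<open>m\<close> passes all tests.\<close>

definition setup_com :: com where
  "setup_com =
     Seq (Read 2 NumVertices (Const 0))
    (Seq (search_com (Read 11 ErrorProb (Reg 3)))
    (Seq (Assign 6 (Reg 3))
    (Seq (Assign 3 (Const 5))
    (Seq (search_com (Read 11 GapBound (Reg 3)))
    (Seq (search_com (Read 11 Precision (Reg 3)))
    (Seq (search_com size_test_com)
    (Seq (Assign 9 (Reg 2)) degrees_com)))))))"

definition constants_com :: com where
  "constants_com =
     Seq (Read 9 Index (Const 0))
    (Seq (degree_com full_precision)
    (Seq (Assign 10 (Reg 11))
    (Seq (clear 11)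
    (Seq (clear 9)
    (Seq (Read 4 NumVertices (Reg 3))
    (Seq (Assign 4 (Div (Reg 4) (Reg 2)))
    (Seq (Assign 7 (Times (Times (Const 8) (apow (Reg 4) 16)) (Plus (Reg 6) (Const 1))))
         (Assign 1 (Times (Times (Const 2) (Reg 7)) (apow (apow (Reg 4) 20) 2))))))))))"

text \<open>Register 14 counts up to the integer square root, guarded by a comparison of squares
  without division. Counting in unary is affordable because time is not charged.\<close>

definition visit_com :: com where
  "visit_com =
     Seq (degree_com full_precision)
    (Seq (While (Minus (Plus (Times (apow (apow (Reg 4) 20) 2) (Reg 10)) (Const 1))
                   (Times (apow (Plus (Reg 14) (Const 1)) 2) (Reg 11)))
            (Assign 14 (Plus (Reg 14) (Const 1))))
    (Seq (Read 15 (Entry (Reg 9)) full_precision)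
    (Seq (Assign 0 (Plus (Reg 0) (Times (Reg 14) (Reg 15))))
    (Seq (clear 11) (Seq (clear 14) (clear 15))))))"

definition move_com :: com where
  "move_com = Seq (Flip 16) (Seq (If (Reg 16) (Walk 9 (Reg 9)) Skip) (clear 16))"

definition sample_com :: com where
  "sample_com =
     Seq (Read 9 Index (Const 0))
    (Seq (Assign 8 (apow (Reg 4) 6))
    (Seq (While (Reg 8) (Seq visit_com (Seq move_com (dec 8))))
         (clear 9)))"

definition program :: com where
  "program = Seq setup_com (Seq constants_com (While (Reg 7) (Seq sample_com (dec 7))))"

section \<open>Rules for deterministic commands and for the search loop\<close>

lemma det_Assign:
  assumes "regs_bounded R M s" "x < R" "aval a s = v" "\<bar>v\<bar> \<le> M" "s' = s(x := v)"
  shows "exec I R M (Assign x a) s (return_pmf s')"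
  using exec_Assign[OF assms(1,2), of a I] assms(3-5) by simp

lemma det_Read:
  assumes "regs_bounded R M s" "x < R" "\<lfloor>2 ^ nat (aval a s) * source_val I s src\<rfloor> = v"
    "\<bar>v\<bar> \<le> M" "s' = s(x := v)"
  shows "exec I R M (Read x src a) s (return_pmf s')"
  using exec_Read[OF assms(1,2), of a I src] assms(3-5) by simp

text \<open>The bound on the intermediate store is handed to the second command, so it is derived
  once, from the execution of the first.\<close>

lemma det_Seq:
  assumes "exec I R M c s (return_pmf s')" "regs_bounded R M s' \<Longrightarrow> exec I R M d s' \<nu>"
  shows "exec I R M (Seq c d) s \<nu>"
  using exec_Seq_det[OF assms(1)] assms(2) exec_end[OF assms(1)] by simp

text \<open>\<open>g m\<close> is the verdict of the test at \<open>m\<close>. Success at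
  \<open>m1\<close> guarantees that the loop ends, at the least successful value; \<open>m1\<close>
  also bounds the counter, although the program does not know it.\<close>

lemma exec_search:
  assumes s: "s 3 = int m0" "s 11 = 0" and m: "m0 \<le> m1" "0 < g m1" "int m1 \<le> M"
    and rb: "regs_bounded 17 M s"
    and c: "\<And>m x. m0 \<le> m \<Longrightarrow> m \<le> m1 \<Longrightarrow> regs_bounded 17 M (s(3 := int m, 11 := x)) \<Longrightarrow>
      exec I 17 M c (s(3 := int m, 11 := x)) (return_pmf (s(3 := int m, 11 := g m)))"
  shows "\<exists>m. m0 \<le> m \<and> m \<le> m1 \<and> 0 < g m \<and>
    exec I 17 M (search_com c) s (return_pmf (s(3 := int m)))"
proof -
  define m where "m = (LEAST m. m0 \<le> m \<and> 0 < g m)"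
  have gm: "m0 \<le> m" "0 < g m"
    using LeastI[of "\<lambda>m. m0 \<le> m \<and> 0 < g m" m1] m by (auto simp: m_def)
  have le: "m \<le> m1"
    unfolding m_def using m by (intro Least_le) auto
  have least: "g k \<le> 0" if "m0 \<le> k" "k < m" for k
    using not_less_Least[of k "\<lambda>m. m0 \<le> m \<and> 0 < g m"] that by (auto simp: m_def)
  define f where "f j = s(3 := int (m0 + j), 11 := g (m0 + j))" for j
  have s0: "s(3 := int m0, 11 := 0) = s"
    using s by auto
  have first: "exec I 17 M c s (return_pmf (f 0))"
    using c[of m0 0] m rb unfolding s0 f_def by simp
  let ?body = "Seq (Assign 3 (Plus (Reg 3) (Const 1))) c"
  have step: "exec I 17 M ?body (f j) (return_pmf (f (Suc j)))"
    if j: "j < m - m0" and rb: "regs_bounded 17 M (f j)" for j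
  proof -
    have j': "m0 + Suc j \<le> m1"
      using j le by simp
    let ?s1 = "s(3 := int (m0 + Suc j), 11 := g (m0 + j))"
    have "(f j)(3 := int (m0 + Suc j)) = ?s1"
      by (auto simp: f_def)
    then have 1: "exec I 17 M (Assign 3 (Plus (Reg 3) (Const 1))) (f j) (return_pmf ?s1)"
      using j' m(3) by (intro det_Assign[OF rb, where v = "int (m0 + Suc j)"]) (simp_all add: f_def)
    show ?thesis
    proof (rule det_Seq[OF 1])
      assume "regs_bounded 17 M ?s1"
      from c[OF _ j' this] show "exec I 17 M c ?s1 (return_pmf (f (Suc j)))"
        by (simp add: f_def)
    qed
  qed
  \<comment> \<open>Each store is the outcome of an execution, so \<open>exec_end\<close> bounds it;
    the bound in turn allows the next round.\<close>
  have rbf: "regs_bounded 17 M (f j)" if "j \<le> m - m0" for j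
    using that
  proof (induction j)
    case 0
    show ?case by (rule exec_end[OF first]) simp
  next
    case (Suc j)
    show ?case by (rule exec_end[OF step[of j]]) (use Suc in simp_all)
  qed
  have last: "f (m - m0) = s(3 := int m, 11 := g m)"
    using gm by (simp add: f_def)
  have loop: "exec I 17 M (While (Minus (Const 1) (Reg 11)) ?body) (f 0) (return_pmf (f (m - m0)))"
  proof (rule exec_While_det[where f = f])
    fix j assume j: "j < m - m0"
    then have "g (m0 + j) \<le> 0"
      by (intro least) auto
    then have "aval (Minus (Const 1) (Reg 11)) (f j) > 0"
      by (simp add: f_def)
    with step[OF j rbf] j
    show "aval (Minus (Const 1) (Reg 11)) (f j) > 0 \<and> exec I 17 M ?body (f j) (return_pmf (f (Suc j)))"
      by simp
  qed (use gm rbf[of "m - m0"] last in simp_all)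
  have clear: "exec I 17 M (clear 11) (f (m - m0)) (return_pmf (s(3 := int m)))"
    using gm le m(3) s rbf[of "m - m0"] unfolding last by (intro det_Assign) auto
  have "exec I 17 M (search_com c) s (return_pmf (s(3 := int m)))"
    unfolding search_com_def by (rule exec_Seq_det[OF first exec_Seq_det[OF loop clear]])
  with gm le show ?thesis by blast
qed

text \<open>Separated from the parameters because degrees are computed in the search, before
  \<open>m\<close> is settled, as well as while sampling.\<close>

locale laplacian_machine = connected_weighted_graph +
  fixes I :: lap_input and M :: int
  assumes I: "size_in I = n" "weight_in I = w"
begin

lemma summand_bounds:
  assumes "v < n" "j < n"
  shows "0 \<le> \<lfloor>2 ^ q * (w v j / unit_weight)\<rfloor>" "\<lfloor>2 ^ q * (w v j / unit_weight)\<rfloor> \<le> 2 ^ q"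
proof -
  have "0 \<le> w v j / unit_weight" "w v j / unit_weight \<le> 1"
    using weight_unit_bounds(1) weight_unit_bounds(2)[OF assms] w_nonneg[OF assms] by simp_all
  then have "0 \<le> 2 ^ q * (w v j / unit_weight)" "2 ^ q * (w v j / unit_weight) \<le> 2 ^ q * 1"
    by (intro mult_nonneg_nonneg mult_left_mono; simp)+
  then show "0 \<le> \<lfloor>2 ^ q * (w v j / unit_weight)\<rfloor>" "\<lfloor>2 ^ q * (w v j / unit_weight)\<rfloor> \<le> 2 ^ q"
    by (simp_all add: floor_le_iff)
qed

text \<open>The hypothesis on \<open>p\<close> says that the precision is insensitive to the working
  registers. Vertices are visited downwards, so after \<open>t\<close> rounds the partial sum covers
  \<open>{n - t..<n}\<close>.\<close>

lemma exec_degree: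
  assumes rb: "regs_bounded 17 M s"
    and s: "s 2 = int n" "s 9 = int v" "s 12 = 0" "s 13 = 0" and v: "v < n"
    and p: "\<And>x y z. aval p (s(11 := x, 12 := y, 13 := z)) = int q"
    and M: "int n * 2 ^ q \<le> M"
  shows "exec I 17 M (degree_com p) s (return_pmf (s(11 := idegree q v)))"
proof -
  define fl where "fl j = \<lfloor>2 ^ q * (w v j / unit_weight)\<rfloor>" for j
  define G where "G t = (\<Sum>j\<in>{n - t..<n}. fl j)" for t
  have fl: "0 \<le> fl j" "fl j \<le> 2 ^ q" if "j < n" for j
    using summand_bounds[OF v that] by (simp_all add: fl_def)
  have G0: "G 0 = 0" and Gn: "G n = idegree q v"
    by (simp_all add: G_def fl_def idegree_def lessThan_atLeast0)
  have GS: "G (Suc t) = G t + fl (n - Suc t)" if "t < n" for t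
  proof -
    have "{n - Suc t..<n} = insert (n - Suc t) {n - t..<n}"
      using that by auto
    then show ?thesis using that by (simp add: G_def)
  qed
  have Gb: "\<bar>G t\<bar> \<le> M" for t
  proof -
    have "0 \<le> G t"
      unfolding G_def using fl by (intro sum_nonneg) auto
    moreover have "G t \<le> (\<Sum>j\<in>{n - t..<n}. 2 ^ q)"
      unfolding G_def using fl by (intro sum_mono) auto
    moreover have "\<dots> \<le> int n * 2 ^ q"
      by (simp add: mult_right_mono)
    ultimately show ?thesis using M by linarith
  qed
  have nM: "int n \<le> M" and qM: "2 ^ q \<le> M"
    using M n2 order_trans[OF _ M] mult_left_mono[of 1 "2 ^ q" "int n"] mult_right_mono[of 1 "int n" "2 ^ q"]
    by auto
  have M0: "0 \<le> M" using nM by simp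
  define f where "f t = s(11 := G t, 12 := int (n - t))" for t
  have rbf: "regs_bounded 17 M (f t)" for t
    unfolding f_def using rb Gb[of t] nM by (intro regs_bounded_upd) auto
  let ?body = "Seq (dec 12) (Seq (Read 13 (Weight (Reg 9) (Reg 12)) p)
       (Seq (Assign 11 (Plus (Reg 11) (Reg 13))) (clear 13)))"
  have step: "exec I 17 M ?body (f t) (return_pmf (f (Suc t)))" if t: "t < n" for t
  proof -
    let ?j = "n - Suc t"
    let ?s1 = "s(11 := G t, 12 := int ?j)"
    let ?s2 = "s(11 := G t, 12 := int ?j, 13 := fl ?j)"
    let ?s3 = "s(11 := G (Suc t), 12 := int ?j, 13 := fl ?j)"
    show ?thesis
    proof (rule det_Seq)
      have "int (n - t) - 1 = int ?j"
        using t by simp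
      then show "exec I 17 M (dec 12) (f t) (return_pmf ?s1)"
        using t nM by (intro det_Assign[OF rbf[of t]]) (simp_all add: f_def)
      assume rb1: "regs_bounded 17 M ?s1"
      show "exec I 17 M (Seq (Read 13 (Weight (Reg 9) (Reg 12)) p)
        (Seq (Assign 11 (Plus (Reg 11) (Reg 13))) (clear 13))) ?s1 (return_pmf (f (Suc t)))"
      proof (rule det_Seq)
        \<comment> \<open>Register 13 is 0 at this point; writing it as an update brings the store
          into the form that the hypothesis on \<open>p\<close> covers.\<close>
        have eq: "?s1 = s(11 := G t, 12 := int ?j, 13 := 0)"
          using s by auto
        have "aval p ?s1 = int q"
          by (rule trans[OF arg_cong[OF eq, of "aval p"] p])
        moreover have "source_val I ?s1 (Weight (Reg 9) (Reg 12)) = w v ?j / unit_weight"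
          using t v s by (simp add: I Let_def del: of_nat_diff)
        ultimately show "exec I 17 M (Read 13 (Weight (Reg 9) (Reg 12)) p) ?s1 (return_pmf ?s2)"
          using fl[of ?j] t qM by (intro det_Read[OF rb1 _ _ _ refl]) (simp_all add: fl_def)
        assume rb2: "regs_bounded 17 M ?s2"
        show "exec I 17 M (Seq (Assign 11 (Plus (Reg 11) (Reg 13))) (clear 13)) ?s2 (return_pmf (f (Suc t)))"
        proof (rule det_Seq)
          have "?s2(11 := G (Suc t)) = ?s3"
            by auto
          then show "exec I 17 M (Assign 11 (Plus (Reg 11) (Reg 13))) ?s2 (return_pmf ?s3)"
            using Gb[of "Suc t"] GS[OF t] by (intro det_Assign[OF rb2, where v = "G (Suc t)"]) simp_all
          assume rb3: "regs_bounded 17 M ?s3"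
          have "f (Suc t) = ?s3(13 := 0)"
            using s by (auto simp: f_def)
          then show "exec I 17 M (clear 13) ?s3 (return_pmf (f (Suc t)))"
            using M0 by (intro det_Assign[OF rb3]) simp_all
        qed
      qed
    qed
  qed
  have last: "f n = s(11 := idegree q v)"
    using s by (auto simp: Gn f_def)
  have loop: "exec I 17 M (While (Reg 12) ?body) (f 0) (return_pmf (f n))"
  proof (rule exec_While_det[where f = f])
    fix t assume t: "t < n"
    show "aval (Reg 12) (f t) > 0 \<and> exec I 17 M ?body (f t) (return_pmf (f (Suc t)))"
      using step[OF t] t by (simp add: f_def)
  qed (use rbf[of n] in \<open>simp_all add: f_def\<close>)
  have 1: "exec I 17 M (clear 11) s (return_pmf (s(11 := 0)))"
    using M0 by (intro det_Assign[OF rb]) simp_all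
  have rb1: "regs_bounded 17 M (s(11 := 0))"
    by (rule exec_end[OF 1]) simp
  have 2: "exec I 17 M (Assign 12 (Reg 2)) (s(11 := 0)) (return_pmf (f 0))"
    using s nM G0 by (intro det_Assign[OF rb1]) (simp_all add: f_def)
  show ?thesis
    using exec_Seq_det[OF 1 exec_Seq_det[OF 2 loop]] unfolding degree_com_def last .
qed

end

section \<open>The sampling phase, for parameters already found\<close>

locale laplacian_run = laplacian_parameters + laplacian_machine +
  assumes I': "index_in I = i" "rhs_in I = b"
    and M: "16 * (int kg + 1) * B ^ 63 \<le> M"
begin

lemma B0: "0 < B" using B_ge by simp

lemma le_M:
  assumes "c \<le> 16 * (int kg + 1)" "0 \<le> c" "k \<le> 63"
  shows "c * B ^ k \<le> M"
proof -
  have "c * B ^ k \<le> (16 * (int kg + 1)) * B ^ 63"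
    using assms B_ge(1) by (intro mult_mono power_increasing) auto
  with M show ?thesis by simp
qed

lemma pow_le_M: "k \<le> 63 \<Longrightarrow> B ^ k \<le> M"
  using le_M[of 1 k] by simp

lemma M0: "0 \<le> M"
  using pow_le_M[of 0] by simp

lemma n_le: "int n \<le> B"
  using n_le_B by linarith

lemma n_le_M: "int n \<le> M"
  using n_le pow_le_M[of 1] by simp

lemma Q_pow: "2 ^ (20 * m) = Q"
  using power_mult[of "2::int" m 20] by (simp add: Q_def B_def mult.commute[of 20 m])

lemma Q0: "0 < Q"
  unfolding Q_def using B0 by simp

lemma int_K: "int K = B ^ 6"
  by (simp add: K_def B_def)

lemma int_N: "int N = 8 * B ^ 16 * (int kg + 1)"
  by (simp add: N_def B_def algebra_simps)

lemma degree_M: "int n * 2 ^ (20 * m) \<le> M"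
proof -
  have "int n * 2 ^ (20 * m) \<le> B * B ^ 20"
    unfolding Q_pow Q_def using n_le B0 by (intro mult_right_mono) auto
  also have "\<dots> = B ^ 21" by (simp add: eval_nat_numeral)
  also have "\<dots> \<le> M" by (rule pow_le_M) simp
  finally show ?thesis .
qed

lemma idegree_le_M:
  assumes "v < n"
  shows "\<bar>idegree (20 * m) v\<bar> \<le> M"
proof -
  have "0 \<le> idegree (20 * m) v"
    unfolding idegree_def using summand_bounds[OF assms] by (intro sum_nonneg) auto
  moreover have "idegree (20 * m) v \<le> (\<Sum>j<n. 2 ^ (20 * m))"
    unfolding idegree_def using summand_bounds[OF assms] by (intro sum_mono) auto
  ultimately show ?thesis
    using degree_M by simp
qed

text \<open>This bounds the accumulator over all samples and dictates \<open>M\<close>: the exponent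
  63 is \<open>16 + 6 + 1 + 2 * 20\<close>, from \<open>N\<close>, \<open>K\<close>,
  \<open>B\<close> and \<open>Q\<^sup>2\<close>.\<close>

lemma acc_le_M: "int N * (int K * (2 * B * Q\<^sup>2)) \<le> M"
proof -
  have "int N * (int K * (2 * B * Q\<^sup>2)) = 16 * (int kg + 1) * B ^ 63"
  proof -
    have "B ^ 16 * B ^ 6 * B ^ 1 * B ^ (20 * 2) = B ^ 63"
      unfolding power_add[symmetric] by simp
    then have "B ^ 16 * (B ^ 6 * (B * (B ^ 20)\<^sup>2)) = B ^ 63"
      by (simp only: power_mult power_one_right mult.assoc)
    moreover have "8 * x * c * (y * (2 * z * u)) = 16 * c * (x * (y * (z * u)))" for x y z u c :: int
      by simp
    ultimately show ?thesis
      unfolding int_N int_K Q_def by (simp only:)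
  qed
  then show ?thesis using M by simp
qed

definition st :: "int \<Rightarrow> nat \<Rightarrow> nat \<Rightarrow> nat \<Rightarrow> store" where
  "st a v k l = (\<lambda>_. 0)(0 := a, 1 := 2 * int N * Q\<^sup>2, 2 := int n, 3 := int m, 4 := B, 6 := int kg,
     7 := int l, 8 := int k, 9 := int v, 10 := idegree (20 * m) i)"

lemma st_simps [simp]:
  "st a v k l 0 = a" "st a v k l 1 = 2 * int N * Q\<^sup>2" "st a v k l 2 = int n" "st a v k l 3 = int m"
  "st a v k l 4 = B" "st a v k l 6 = int kg" "st a v k l 7 = int l" "st a v k l 8 = int k"
  "st a v k l 9 = int v" "st a v k l 10 = idegree (20 * m) i"
  "st a v k l 11 = 0" "st a v k l 12 = 0" "st a v k l 13 = 0" "st a v k l 14 = 0"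
  "st a v k l 15 = 0" "st a v k l 16 = 0" "st a v k l (Suc 0) = 2 * int N * Q\<^sup>2"
  by (simp_all add: st_def)

lemma st_upd:
  "(st a v k l)(0 := a') = st a' v k l" "(st a v k l)(7 := int l') = st a v k l'"
  "(st a v k l)(8 := int k') = st a v k' l" "(st a v k l)(9 := int v') = st a v' k l"
  by (auto simp: st_def)

text \<open>Squaring and clearing the denominator turns the comparison with a real root into the
  integer comparison made by the guard in \<open>visit_com\<close>.\<close>

lemma le_floor_ratio_iff:
  assumes "v < n"
  shows "int j \<le> floor_ratio v \<longleftrightarrow> (int j)\<^sup>2 * idegree (20 * m) v \<le> Q\<^sup>2 * idegree (20 * m) i"
proof -
  let ?x = "real_of_int (idegree (20 * m) i)" and ?y = "real_of_int (idegree (20 * m) v)"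
  have y: "0 < ?y" and x: "0 \<le> ?x"
    using idegree_pos[OF assms] idegree_nonneg[OF assms] by simp_all
  have Q: "0 < real_of_int Q" using Q0 by simp
  have "int j \<le> floor_ratio v \<longleftrightarrow> real j \<le> real_of_int Q * sqrt (?x / ?y)"
    unfolding floor_ratio_def by (simp add: le_floor_iff)
  also have "\<dots> \<longleftrightarrow> (real j)\<^sup>2 \<le> (real_of_int Q * sqrt (?x / ?y))\<^sup>2"
    using Q x y by (subst abs_le_square_iff[symmetric]) simp
  also have "\<dots> \<longleftrightarrow> (real j)\<^sup>2 \<le> (real_of_int Q)\<^sup>2 * ?x / ?y"
    using x y by (simp add: power_mult_distrib)
  also have "\<dots> \<longleftrightarrow> (real j)\<^sup>2 * ?y \<le> (real_of_int Q)\<^sup>2 * ?x"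
    using y by (simp add: pos_le_divide_eq)
  also have "\<dots> \<longleftrightarrow> real_of_int ((int j)\<^sup>2 * idegree (20 * m) v) \<le> real_of_int (Q\<^sup>2 * idegree (20 * m) i)"
    by simp
  also have "\<dots> \<longleftrightarrow> (int j)\<^sup>2 * idegree (20 * m) v \<le> Q\<^sup>2 * idegree (20 * m) i"
    by (simp only: of_int_le_iff)
  finally show ?thesis .
qed

lemma exec_root:
  assumes v: "v < n" and rb: "regs_bounded 17 M s"
    and s: "s 4 = B" "s 10 = idegree (20 * m) i" "s 11 = idegree (20 * m) v" "s 14 = 0"
  shows "exec I 17 M
    (While (Minus (Plus (Times (apow (apow (Reg 4) 20) 2) (Reg 10)) (Const 1))
                   (Times (apow (Plus (Reg 14) (Const 1)) 2) (Reg 11)))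
            (Assign 14 (Plus (Reg 14) (Const 1)))) s (return_pmf (s(14 := floor_ratio v)))"
    (is "exec I 17 M (While ?a ?c) s _")
proof -
  let ?k = "nat (floor_ratio v)"
  define f where "f j = s(14 := int j)" for j
  have k: "int ?k = floor_ratio v"
    using root_bounds(1)[OF v] by simp
  have bound: "int j \<le> M" if "j \<le> ?k" for j
  proof -
    have "int j \<le> 2 * B * Q"
      using that root_bounds(2)[OF v] k by linarith
    also have "\<dots> = 2 * B ^ 21" by (simp add: Q_def eval_nat_numeral)
    also have "\<dots> \<le> M" by (rule le_M) auto
    finally show ?thesis .
  qed
  have rbf: "regs_bounded 17 M (f j)" if "j \<le> ?k" for j
    unfolding f_def using bound[OF that] by (intro regs_bounded_upd[OF rb]) auto
  \<comment> \<open>Over the integers the \<open>+ 1\<close> turns the strict test into a non-strict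
    comparison. The guard at \<open>j\<close> asks about \<open>j + 1\<close>, so the loop stops at
    the floor itself.\<close>
  have cond: "aval ?a (f j) > 0 \<longleftrightarrow> int (Suc j) \<le> floor_ratio v" for j
    unfolding le_floor_ratio_iff[OF v] by (simp add: f_def s Q_def[symmetric] add.commute) linarith
  have "exec I 17 M (While ?a ?c) s (return_pmf (f ?k))"
  proof (rule exec_While_det[where f = f])
    fix j assume j: "j < ?k"
    have "exec I 17 M ?c (f j) (return_pmf (f (Suc j)))"
      using j bound[of "Suc j"] by (intro det_Assign[OF rbf[of j], where v = "int (Suc j)"]) (simp_all add: f_def)
    moreover have "int (Suc j) \<le> floor_ratio v"
      using j k by linarith
    ultimately show "aval ?a (f j) > 0 \<and> exec I 17 M ?c (f j) (return_pmf (f (Suc j)))"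
      using cond by blast
  next
    have "\<not> int (Suc ?k) \<le> floor_ratio v"
      using k by linarith
    then show "aval ?a (f ?k) \<le> 0"
      using cond[of ?k] by linarith
  next
    show "s = f 0" using s by (auto simp: f_def)
  qed (rule rbf, simp)
  then show ?thesis unfolding f_def k .
qed

lemma exec_visit:
  assumes v: "v < n" and a: "\<bar>a + F v\<bar> \<le> M" and rb: "regs_bounded 17 M (st a v k l)"
  shows "exec I 17 M visit_com (st a v k l) (return_pmf (st (a + F v) v k l))"
proof -
  let ?s = "st a v k l" and ?D = "idegree (20 * m) v" and ?q = "\<lfloor>2 ^ (20 * m) * b $ v\<rfloor>"
  have 1: "exec I 17 M (degree_com full_precision) ?s (return_pmf (?s(11 := ?D)))"
    using degree_M by (intro exec_degree[OF rb]) (auto simp: v)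
  have q: "\<bar>?q\<bar> \<le> M"
  proof -
    have "- 1 \<le> b $ v" "b $ v \<le> 1"
      using abs_b_le[OF v] by linarith+
    then have "- real_of_int Q \<le> real_of_int Q * b $ v" "real_of_int Q * b $ v \<le> real_of_int Q"
      using Q0 mult_left_mono[of "- 1" "b $ v" "real_of_int Q"] mult_left_mono[of "b $ v" 1 "real_of_int Q"]
      by simp_all
    then have "\<bar>?q\<bar> \<le> Q"
      unfolding real_Q(2)[symmetric] by (simp add: abs_le_iff floor_le_iff le_floor_iff minus_le_iff)
    also have "Q \<le> M"
      unfolding Q_def by (rule pow_le_M) simp
    finally show ?thesis .
  qed
  show ?thesis
    unfolding visit_com_def
  proof (rule det_Seq[OF 1])
    assume "regs_bounded 17 M (?s(11 := ?D))"
    note 2 = exec_root[OF v this]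
    show "exec I 17 M (Seq (While (Minus (Plus (Times (apow (apow (Reg 4) 20) 2) (Reg 10)) (Const 1))
                   (Times (apow (Plus (Reg 14) (Const 1)) 2) (Reg 11)))
            (Assign 14 (Plus (Reg 14) (Const 1))))
    (Seq (Read 15 (Entry (Reg 9)) full_precision)
    (Seq (Assign 0 (Plus (Reg 0) (Times (Reg 14) (Reg 15))))
    (Seq (clear 11) (Seq (clear 14) (clear 15)))))) (?s(11 := ?D)) (return_pmf (st (a + F v) v k l))"
    proof (rule det_Seq[OF 2])
      let ?s2 = "?s(11 := ?D, 14 := floor_ratio v)"
      assume rb2: "regs_bounded 17 M ?s2"
      show "exec I 17 M (Seq (Read 15 (Entry (Reg 9)) full_precision)
        (Seq (Assign 0 (Plus (Reg 0) (Times (Reg 14) (Reg 15))))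
        (Seq (clear 11) (Seq (clear 14) (clear 15))))) ?s2 (return_pmf (st (a + F v) v k l))"
      proof (rule det_Seq)
        show "exec I 17 M (Read 15 (Entry (Reg 9)) full_precision) ?s2 (return_pmf (?s2(15 := ?q)))"
          using q v by (intro det_Read[OF rb2, where v = ?q]) (simp_all add: I I' Let_def nat_mult_distrib)
        assume rb3: "regs_bounded 17 M (?s2(15 := ?q))"
        show "exec I 17 M (Seq (Assign 0 (Plus (Reg 0) (Times (Reg 14) (Reg 15))))
          (Seq (clear 11) (Seq (clear 14) (clear 15)))) (?s2(15 := ?q)) (return_pmf (st (a + F v) v k l))"
        proof (rule det_Seq)
          let ?s4 = "(st (a + F v) v k l)(11 := ?D, 14 := floor_ratio v, 15 := ?q)"
          have "?s2(15 := ?q, 0 := a + F v) = ?s4"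
            by (auto simp: st_def)
          then show "exec I 17 M (Assign 0 (Plus (Reg 0) (Times (Reg 14) (Reg 15)))) (?s2(15 := ?q)) (return_pmf ?s4)"
            using a by (intro det_Assign[OF rb3, where v = "a + F v"]) (simp_all add: F_def)
          assume rb4: "regs_bounded 17 M ?s4"
          show "exec I 17 M (Seq (clear 11) (Seq (clear 14) (clear 15))) ?s4 (return_pmf (st (a + F v) v k l))"
          proof (rule det_Seq)
            let ?s5 = "(st (a + F v) v k l)(14 := floor_ratio v, 15 := ?q)"
            have "?s5 = ?s4(11 := 0)" by (auto simp: st_def)
            then show "exec I 17 M (clear 11) ?s4 (return_pmf ?s5)"
              using M0 by (intro det_Assign[OF rb4, where v = 0]) simp_all
            assume rb5: "regs_bounded 17 M ?s5"
            show "exec I 17 M (Seq (clear 14) (clear 15)) ?s5 (return_pmf (st (a + F v) v k l))"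
            proof (rule det_Seq)
              let ?s6 = "(st (a + F v) v k l)(15 := ?q)"
              have "?s6 = ?s5(14 := 0)" by (auto simp: st_def)
              then show "exec I 17 M (clear 14) ?s5 (return_pmf ?s6)"
                using M0 by (intro det_Assign[OF rb5, where v = 0]) simp_all
              assume rb6: "regs_bounded 17 M ?s6"
              have "st (a + F v) v k l = ?s6(15 := 0)" by (auto simp: st_def)
              then show "exec I 17 M (clear 15) ?s6 (return_pmf (st (a + F v) v k l))"
                using M0 by (intro det_Assign[OF rb6, where v = 0]) simp_all
            qed
          qed
        qed
      qed
    qed simp_all
  qed
qed

lemma exec_move:
  assumes v: "v < n" and rb: "regs_bounded 17 M (st a v k l)"
  shows "exec I 17 M move_com (st a v k l) (map_pmf (\<lambda>v'. st a v' k l) (lazy_walk v))"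
proof -
  let ?s = "st a v k l"
  define \<nu> where "\<nu> c = map_pmf (\<lambda>v'. st a v' k l) (if c then walk_pmf n w v else return_pmf v)" for c
  have M1: "1 \<le> M" using pow_le_M[of 0] by simp
  have branch: "exec I 17 M (Seq (If (Reg 16) (Walk 9 (Reg 9)) Skip) (clear 16)) (?s(16 := of_bool c)) (\<nu> c)" for c
  proof -
    let ?\<mu> = "map_pmf (\<lambda>v'. (st a v' k l)(16 := of_bool c)) (if c then walk_pmf n w v else return_pmf v)"
    have rbc: "regs_bounded 17 M (?s(16 := of_bool c))"
      using M1 by (intro regs_bounded_upd[OF rb]) auto
    have "exec I 17 M (If (Reg 16) (Walk 9 (Reg 9)) Skip) (?s(16 := of_bool c)) ?\<mu>"
    proof (cases c)
      case True
      have "(\<lambda>j. (?s(16 := of_bool c))(9 := int j)) = (\<lambda>v'. (st a v' k l)(16 := of_bool c))"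
        by (intro ext) (auto simp: st_def)
      then have "exec I 17 M (Walk 9 (Reg 9)) (?s(16 := of_bool c)) ?\<mu>"
        using exec_Walk[OF rbc, of 9 I "Reg 9" v] n_le_M v set_walk[OF v] True by (simp add: I)
      then show ?thesis
        using True by (intro exec_If_true[OF rbc]) auto
    next
      case False
      then show ?thesis
        using exec_Skip[OF rbc] by (intro exec_If_false[OF rbc]) auto
    qed
    then have "exec I 17 M (Seq (If (Reg 16) (Walk 9 (Reg 9)) Skip) (clear 16)) (?s(16 := of_bool c))
        (bind_pmf ?\<mu> (\<lambda>s. return_pmf (s(16 := 0))))"
    proof (rule exec_Seq)
      fix s assume "s \<in> set_pmf ?\<mu>"
      then have "regs_bounded 17 M s"
        using exec_end[OF \<open>exec I 17 M (If (Reg 16) (Walk 9 (Reg 9)) Skip) (?s(16 := of_bool c)) ?\<mu>\<close>] by blast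
      then show "exec I 17 M (clear 16) s (return_pmf (s(16 := 0)))"
        using M0 by (intro det_Assign) auto
    qed
    also have "bind_pmf ?\<mu> (\<lambda>s. return_pmf (s(16 := 0))) = \<nu> c"
    proof -
      have "((\<lambda>s. s(16 := 0)) \<circ> (\<lambda>v'. (st a v' k l)(16 := of_bool c))) = (\<lambda>v'. st a v' k l)"
        by (intro ext) (auto simp: st_def)
      then show ?thesis
        by (simp only: \<nu>_def map_pmf_def[symmetric] pmf.map_comp)
    qed
    finally show ?thesis .
  qed
  \<comment> \<open>The coin is recovered from register 16, because the continuation sees only the
    store.\<close>
  have "exec I 17 M move_com ?s (bind_pmf (map_pmf (\<lambda>c. ?s(16 := of_bool c)) (bernoulli_pmf (1 / 2)))
      (\<lambda>s. \<nu> (s 16 > 0)))"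
    unfolding move_com_def
  proof (rule exec_Seq)
    show "exec I 17 M (Flip 16) ?s (map_pmf (\<lambda>c. ?s(16 := of_bool c)) (bernoulli_pmf (1 / 2)))"
      by (rule exec_Flip[OF rb _ M1]) simp
    fix s' assume "s' \<in> set_pmf (map_pmf (\<lambda>c. ?s(16 := of_bool c)) (bernoulli_pmf (1 / 2)))"
    then obtain c where s': "s' = ?s(16 := of_bool c)"
      by auto
    have "(s' 16 > 0) = c" by (simp add: s')
    then show "exec I 17 M (Seq (If (Reg 16) (Walk 9 (Reg 9)) Skip) (clear 16)) s' (\<nu> (s' 16 > 0))"
      using branch[of c] by (simp add: s')
  qed
  also have "bind_pmf (map_pmf (\<lambda>c. ?s(16 := of_bool c)) (bernoulli_pmf (1 / 2))) (\<lambda>s. \<nu> (s 16 > 0))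
      = map_pmf (\<lambda>v'. st a v' k l) (lazy_walk v)"
    by (simp add: bind_map_pmf lazy_walk_def map_bind_pmf \<nu>_def)
  finally show ?thesis .
qed

text \<open>The room left in the accumulator is the invariant: each visit consumes at most
  \<open>2 * B * Q\<^sup>2\<close> of it.\<close>

lemma exec_walk_loop:
  assumes "v < n" "\<bar>a\<bar> + int k * (2 * B * Q\<^sup>2) \<le> M" "regs_bounded 17 M (st a v k l)"
  shows "exec I 17 M (While (Reg 8) (Seq visit_com (Seq move_com (dec 8)))) (st a v k l)
    (map_pmf (\<lambda>(a', v'). st a' v' 0 l) (trajectory_sum F k a v))"
  using assms
proof (induction k arbitrary: a v)
  case 0
  then show ?case
    using exec_While_false[of 17 M "st a v 0 l" "Reg 8" I] by simp
next
  case (Suc k)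
  let ?W = "While (Reg 8) (Seq visit_com (Seq move_com (dec 8)))"
  have FB: "\<bar>F v\<bar> \<le> 2 * B * Q\<^sup>2"
    by (rule abs_F_le[OF Suc.prems(1)])
  have sum: "int (Suc k) * (2 * B * Q\<^sup>2) = 2 * B * Q\<^sup>2 + int k * (2 * B * Q\<^sup>2)"
    by (simp add: algebra_simps)
  have aF: "\<bar>a + F v\<bar> + int k * (2 * B * Q\<^sup>2) \<le> M"
    using Suc.prems(2) FB unfolding sum by linarith
  moreover have "0 \<le> int k * (2 * B * Q\<^sup>2)"
    using B0 by simp
  ultimately have aFM: "\<bar>a + F v\<bar> \<le> M"
    by linarith
  note 1 = exec_visit[OF Suc.prems(1) aFM Suc.prems(3)]
  have rb1: "regs_bounded 17 M (st (a + F v) v (Suc k) l)"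
    by (rule exec_end[OF 1]) simp
  note 2 = exec_move[OF Suc.prems(1) rb1]
  have rb_dec: "regs_bounded 17 M (st (a + F v) v' (Suc k) l)" if "v' \<in> set_pmf (lazy_walk v)" for v'
    by (rule exec_end[OF 2]) (use that in auto)
  have 3: "exec I 17 M (dec 8) (st (a + F v) v' (Suc k) l) (return_pmf (st (a + F v) v' k l))"
    if "v' \<in> set_pmf (lazy_walk v)" for v'
  proof -
    \<comment> \<open>The store is already known to be bounded, so its register 8 yields the bound
      on the counter.\<close>
    have "int (Suc k) \<le> M"
      using rb_dec[OF that] unfolding regs_bounded_def by (auto dest!: spec[of _ 8])
    then show ?thesis
      by (intro det_Assign[OF rb_dec[OF that], where v = "int k"]) (simp_all add: st_upd)
  qed
  have "exec I 17 M (Seq move_com (dec 8)) (st (a + F v) v (Suc k) l)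
      (map_pmf (\<lambda>v'. (st (a + F v) v' (Suc k) l)(8 := int k)) (lazy_walk v))"
    by (rule exec_Seq_map_det[OF 2]) (use 3 in \<open>simp add: st_upd\<close>)
  then have "exec I 17 M (Seq move_com (dec 8)) (st (a + F v) v (Suc k) l)
      (map_pmf (\<lambda>v'. st (a + F v) v' k l) (lazy_walk v))"
    by (simp only: st_upd)
  from exec_Seq_det[OF 1 this]
  have body: "exec I 17 M (Seq visit_com (Seq move_com (dec 8))) (st a v (Suc k) l)
      (map_pmf (\<lambda>v'. st (a + F v) v' k l) (lazy_walk v))" .
  define \<nu> where "\<nu> s = map_pmf (\<lambda>(a', v'). st a' v' 0 l) (trajectory_sum F k (a + F v) (nat (s 9)))"
    for s :: store
  have "exec I 17 M ?W (st a v (Suc k) l) (bind_pmf (lazy_walk v) (\<lambda>v'. \<nu> (st (a + F v) v' k l)))"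
  proof (rule exec_While_true[OF _ exec_Seq_map[OF body]])
    fix v' assume v': "v' \<in> set_pmf (lazy_walk v)"
    then have "v' < n"
      using set_lazy_walk[OF Suc.prems(1)] by auto
    moreover have "regs_bounded 17 M (st (a + F v) v' k l)"
      by (rule exec_end[OF body]) (use v' in auto)
    ultimately show "exec I 17 M ?W (st (a + F v) v' k l) (\<nu> (st (a + F v) v' k l))"
      using Suc.IH[OF _ aF] by (simp add: \<nu>_def)
  qed simp
  then show ?case
    by (simp add: map_bind_pmf \<nu>_def)
qed

text \<open>Erasing the final vertex leaves a store that depends on the trajectory through its sum
  alone, and \<open>trajectory_sum_shift\<close> splits off the old accumulator. This makes the
  rounds independent samples.\<close>

lemma exec_sample:
  assumes "\<bar>a\<bar> + int K * (2 * B * Q\<^sup>2) \<le> M" "regs_bounded 17 M (st a 0 0 l)"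
  shows "exec I 17 M sample_com (st a 0 0 l) (map_pmf (\<lambda>y. st (a + y) 0 0 l) sample)"
proof -
  have KM: "int K \<le> M"
    unfolding int_K by (rule pow_le_M) simp
  have iM: "int i \<le> M"
    using i n_le_M by linarith
  have 1: "exec I 17 M (Read 9 Index (Const 0)) (st a 0 0 l) (return_pmf (st a i 0 l))"
    using iM by (intro det_Read[OF assms(2), where v = "int i"]) (simp_all add: I' st_upd)
  have rb1: "regs_bounded 17 M (st a i 0 l)"
    by (rule exec_end[OF 1]) simp
  have 2: "exec I 17 M (Assign 8 (apow (Reg 4) 6)) (st a i 0 l) (return_pmf (st a i K l))"
    using KM by (intro det_Assign[OF rb1, where v = "int K"]) (simp_all add: st_upd, simp add: int_K)
  have rb2: "regs_bounded 17 M (st a i K l)"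
    by (rule exec_end[OF 2]) simp
  note 3 = exec_walk_loop[OF i assms(1) rb2]
  have "map_pmf (\<lambda>(a', v'). st a' v' 0 l) (trajectory_sum F K a i)
      = map_pmf (\<lambda>x. st (fst x) (snd x) 0 l) (trajectory_sum F K a i)"
    by (simp add: case_prod_unfold)
  note loop = 3[unfolded this]
  have clear: "(st a' v' 0 l)(9 := 0) = st a' 0 0 l" for a' v'
    using st_upd(4)[of a' v' 0 l 0] by simp
  have "exec I 17 M (Seq (While (Reg 8) (Seq visit_com (Seq move_com (dec 8)))) (clear 9)) (st a i K l)
      (map_pmf (\<lambda>x. (st (fst x) (snd x) 0 l)(9 := 0)) (trajectory_sum F K a i))"
  proof (rule exec_Seq_map_det[OF loop])
    fix x assume x: "x \<in> set_pmf (trajectory_sum F K a i)"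
    have "regs_bounded 17 M (st (fst x) (snd x) 0 l)"
      by (rule exec_end[OF loop]) (use x in auto)
    then show "exec I 17 M (clear 9) (st (fst x) (snd x) 0 l)
        (return_pmf ((st (fst x) (snd x) 0 l)(9 := 0)))"
      using M0 by (intro det_Assign) auto
  qed
  moreover have "map_pmf (\<lambda>x. st (fst x) 0 0 l) (trajectory_sum F K a i) = map_pmf (\<lambda>y. st (a + y) 0 0 l) sample"
    unfolding sample_def by (subst trajectory_sum_shift) (simp add: map_pmf_comp case_prod_unfold)
  ultimately have "exec I 17 M (Seq (While (Reg 8) (Seq visit_com (Seq move_com (dec 8)))) (clear 9)) (st a i K l)
      (map_pmf (\<lambda>y. st (a + y) 0 0 l) sample)"
    unfolding clear by simp
  then show ?thesis
    unfolding sample_com_def by (rule exec_Seq_det[OF 1 exec_Seq_det[OF 2]])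
qed

lemma exec_samples:
  assumes "\<bar>a\<bar> + int l * (int K * (2 * B * Q\<^sup>2)) \<le> M" "regs_bounded 17 M (st a 0 0 l)"
  shows "exec I 17 M (While (Reg 7) (Seq sample_com (dec 7))) (st a 0 0 l)
    (map_pmf (\<lambda>s. st s 0 0 0) (iid_sum sample l a))"
  using assms
proof (induction l arbitrary: a)
  case 0
  then show ?case
    using exec_While_false[of 17 M "st a 0 0 0" "Reg 7" I] by simp
next
  case (Suc l)
  let ?c = "int K * (2 * B * Q\<^sup>2)" and ?W = "While (Reg 7) (Seq sample_com (dec 7))"
  have c0: "0 \<le> int l * ?c"
    using B0 by simp
  have sum: "int (Suc l) * ?c = ?c + int l * ?c"
    by (simp add: algebra_simps)
  have "\<bar>a\<bar> + ?c \<le> M"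
    using Suc.prems(1) c0 unfolding sum by linarith
  note 1 = exec_sample[OF this Suc.prems(2)]
  have rb1: "regs_bounded 17 M (st (a + y) 0 0 (Suc l))" if "y \<in> set_pmf sample" for y
    by (rule exec_end[OF 1]) (use that in auto)
  have 2: "exec I 17 M (dec 7) (st (a + y) 0 0 (Suc l)) (return_pmf (st (a + y) 0 0 l))"
    if "y \<in> set_pmf sample" for y
  proof -
    have "int (Suc l) \<le> M"
      using rb1[OF that] unfolding regs_bounded_def by (auto dest!: spec[of _ 7])
    then show ?thesis
      by (intro det_Assign[OF rb1[OF that], where v = "int l"]) (simp_all add: st_upd)
  qed
  have "exec I 17 M (Seq sample_com (dec 7)) (st a 0 0 (Suc l))
      (map_pmf (\<lambda>y. (st (a + y) 0 0 (Suc l))(7 := int l)) sample)"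
    by (rule exec_Seq_map_det[OF 1]) (use 2 in \<open>simp add: st_upd\<close>)
  then have body: "exec I 17 M (Seq sample_com (dec 7)) (st a 0 0 (Suc l))
      (map_pmf (\<lambda>y. st (a + y) 0 0 l) sample)"
    by (simp only: st_upd)
  define \<nu> where "\<nu> s = map_pmf (\<lambda>s. st s 0 0 0) (iid_sum sample l (s 0))" for s :: store
  have "exec I 17 M ?W (st a 0 0 (Suc l)) (bind_pmf sample (\<lambda>y. \<nu> (st (a + y) 0 0 l)))"
  proof (rule exec_While_true[OF _ exec_Seq_map[OF body]])
    fix y assume y: "y \<in> set_pmf sample"
    have "\<bar>a + y\<bar> + int l * ?c \<le> M"
      using Suc.prems(1) sample_bound[OF y] unfolding sum by linarith
    moreover have "regs_bounded 17 M (st (a + y) 0 0 l)"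
      by (rule exec_end[OF body]) (use y in auto)
    ultimately show "exec I 17 M ?W (st (a + y) 0 0 l) (\<nu> (st (a + y) 0 0 l))"
      using Suc.IH by (simp add: \<nu>_def)
  qed simp
  then show ?case
    by (simp add: map_bind_pmf \<nu>_def)
qed

lemma exec_constants:
  defines "s \<equiv> (\<lambda>_. 0)(2 := int n, 3 := int m, 6 := int kg)"
  assumes rb: "regs_bounded 17 M s"
  shows "exec I 17 M constants_com s (return_pmf (st 0 0 0 N))"
proof -
  let ?D = "idegree (20 * m) i"
  have iM: "int i \<le> M"
    using i n_le_M by linarith
  have NM: "int N \<le> M"
    unfolding int_N using le_M[of "8 * (int kg + 1)" 16] by (simp add: algebra_simps)
  have DM: "\<bar>2 * int N * Q\<^sup>2\<bar> \<le> M"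
  proof -
    have eq: "2 * int N * Q\<^sup>2 = (16 * (int kg + 1)) * (B ^ 16 * B ^ (20 * 2))"
      unfolding int_N Q_def by (simp add: power_mult ac_simps)
    then have "2 * int N * Q\<^sup>2 = (16 * (int kg + 1)) * B ^ 56"
      unfolding power_add[symmetric] by simp
    also have "\<dots> \<le> M"
      by (rule le_M) auto
    finally show ?thesis by simp
  qed
  have B1: "B \<le> M"
    using pow_le_M[of 1] by simp
  have nB: "int n * B \<le> M"
  proof -
    have "int n * B \<le> B * B"
      using n_le B0 by (intro mult_right_mono) auto
    also have "\<dots> = B ^ 2" by (simp add: power2_eq_square)
    also have "\<dots> \<le> M" by (rule pow_le_M) simp
    finally show ?thesis .
  qed
  have s: "s 2 = int n" "s 3 = int m" "s 6 = int kg" "s 12 = 0" "s 13 = 0" "s 11 = 0" "s 9 = 0"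
    by (simp_all add: s_def)
  let ?s1 = "s(9 := int i)" let ?s2 = "s(9 := int i, 11 := ?D)"
  let ?s3 = "s(9 := int i, 11 := ?D, 10 := ?D)" let ?s4 = "s(9 := int i, 10 := ?D)"
  let ?s5 = "s(10 := ?D)" let ?s6 = "s(10 := ?D, 4 := int n * B)" let ?s7 = "s(10 := ?D, 4 := B)"
  let ?s8 = "s(10 := ?D, 4 := B, 7 := int N)"
  have 1: "exec I 17 M (Read 9 Index (Const 0)) s (return_pmf ?s1)"
    using iM by (intro det_Read[OF rb, where v = "int i"]) (simp_all add: I')
  have rb1: "regs_bounded 17 M ?s1" by (rule exec_end[OF 1]) simp
  have 2: "exec I 17 M (degree_com full_precision) ?s1 (return_pmf ?s2)"
    using degree_M by (intro exec_degree[OF rb1]) (auto simp: i s)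
  have rb2: "regs_bounded 17 M ?s2" by (rule exec_end[OF 2]) simp
  have 3: "exec I 17 M (Assign 10 (Reg 11)) ?s2 (return_pmf ?s3)"
    using idegree_le_M[OF i] by (intro det_Assign[OF rb2, where v = ?D]) simp_all
  have rb3: "regs_bounded 17 M ?s3" by (rule exec_end[OF 3]) simp
  have "?s4 = ?s3(11 := 0)" using s by auto
  then have 4: "exec I 17 M (clear 11) ?s3 (return_pmf ?s4)"
    using M0 by (intro det_Assign[OF rb3, where v = 0]) simp_all
  have rb4: "regs_bounded 17 M ?s4" by (rule exec_end[OF 4]) simp
  have "?s5 = ?s4(9 := 0)" using s by auto
  then have 5: "exec I 17 M (clear 9) ?s4 (return_pmf ?s5)"
    using M0 by (intro det_Assign[OF rb4, where v = 0]) simp_all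
  have rb5: "regs_bounded 17 M ?s5" by (rule exec_end[OF 5]) simp
  have 6: "exec I 17 M (Read 4 NumVertices (Reg 3)) ?s5 (return_pmf ?s6)"
  proof (rule det_Read[OF rb5])
    have "2 ^ nat (aval (Reg 3) ?s5) * source_val I ?s5 NumVertices = real_of_int (int n * B)"
      by (simp add: s I B_def)
    then show "\<lfloor>2 ^ nat (aval (Reg 3) ?s5) * source_val I ?s5 NumVertices\<rfloor> = int n * B"
      by (simp only: floor_of_int)
  qed (use nB B0 in simp_all)
  have rb6: "regs_bounded 17 M ?s6" by (rule exec_end[OF 6]) simp
  have 7: "exec I 17 M (Assign 4 (Div (Reg 4) (Reg 2))) ?s6 (return_pmf ?s7)"
    using B1 B0 n2 by (intro det_Assign[OF rb6, where v = B]) (simp_all add: s)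
  have rb7: "regs_bounded 17 M ?s7" by (rule exec_end[OF 7]) simp
  have 8: "exec I 17 M (Assign 7 (Times (Times (Const 8) (apow (Reg 4) 16)) (Plus (Reg 6) (Const 1)))) ?s7 (return_pmf ?s8)"
    using NM by (intro det_Assign[OF rb7, where v = "int N"]) (simp_all add: s int_N)
  have rb8: "regs_bounded 17 M ?s8" by (rule exec_end[OF 8]) simp
  have "st 0 0 0 N = ?s8(1 := 2 * int N * Q\<^sup>2)"
    by (auto simp: st_def s_def)
  then have 9: "exec I 17 M (Assign 1 (Times (Times (Const 2) (Reg 7)) (apow (apow (Reg 4) 20) 2))) ?s8 (return_pmf (st 0 0 0 N))"
    using DM by (intro det_Assign[OF rb8, where v = "2 * int N * Q\<^sup>2"]) (simp_all add: Q_def)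
  show ?thesis
    unfolding constants_com_def
    by (rule exec_Seq_det[OF 1 exec_Seq_det[OF 2 exec_Seq_det[OF 3 exec_Seq_det[OF 4 exec_Seq_det[OF 5
          exec_Seq_det[OF 6 exec_Seq_det[OF 7 exec_Seq_det[OF 8 9]]]]]]]])
qed

lemma exec_main:
  defines "s \<equiv> (\<lambda>_. 0)(2 := int n, 3 := int m, 6 := int kg)"
  assumes rb: "regs_bounded 17 M s"
  shows "exec I 17 M (Seq constants_com (While (Reg 7) (Seq sample_com (dec 7)))) s
    (map_pmf (\<lambda>s. st s 0 0 0) (iid_sum sample N 0))"
proof -
  note 1 = exec_constants[folded s_def, OF rb]
  have "regs_bounded 17 M (st 0 0 0 N)" by (rule exec_end[OF 1]) simp
  from exec_Seq_det[OF 1 exec_samples[OF _ this]] show ?thesis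
    using acc_le_M by simp
qed

lemma main_accuracy:
  "measure_pmf.prob (map_pmf (Pair Skip) (map_pmf (\<lambda>s. st s 0 0 0) (iid_sum sample N 0)))
    {cf. additive_approx eps ((pseudo_inverse (laplacian n w) *\<^sub>v b) $ i) (out_val cf)} \<ge> 1 - gam"
  using estimator_accuracy by (simp add: vimage_def out_val_def)

end

section \<open>The search for the parameters\<close>

context connected_weighted_graph
begin

lemma idegree_mono:
  assumes "p \<le> q" "v < n"
  shows "idegree p v \<le> idegree q v"
  unfolding idegree_def
proof (intro sum_mono floor_mono mult_right_mono)
  fix j assume "j \<in> {..<n}"
  then show "0 \<le> w v j / unit_weight"
    using w_nonneg[OF assms(2), of j] weight_unit_bounds(1) by simp
  show "(2::real) ^ p \<le> 2 ^ q"
    using assms(1) by (rule power_increasing) simp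
qed

text \<open>The unit is at most twice the largest weight, hence twice the largest degree, and the
  latter is at most \<open>deg_ratio n w * d v\<close>.\<close>

lemma deg_ratio_bounds:
  shows "1 \<le> deg_ratio n w" "\<And>v. v < n \<Longrightarrow> 1 \<le> 2 * deg_ratio n w * (d v / unit_weight)"
proof -
  let ?D = "d ` {..<n}"
  have fin: "finite ?D" "?D \<noteq> {}"
    using n2 by (auto simp: lessThan_empty_iff)
  have "Min ?D \<in> ?D" "Max ?D \<in> ?D"
    using fin by (auto intro: Min_in Max_in)
  then have min: "0 < Min ?D" and max: "0 < Max ?D"
    by (auto simp: d_pos)
  have "Min ?D \<le> Max ?D"
    using Min_le[OF fin(1) Max_in[OF fin]] .
  then show "1 \<le> deg_ratio n w"
    using min by (simp add: deg_ratio_def)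
  fix v assume v: "v < n"
  obtain a c where ac: "a < n" "c < n" "unit_weight \<le> 2 * w a c"
    using weight_unit_bounds(3) by blast
  have "w a c \<le> d a"
    unfolding deg_def using ac by (intro member_le_sum) (auto intro: w_nonneg)
  also have "d a \<le> Max ?D"
    using fin ac by (intro Max_ge) auto
  finally have U: "unit_weight \<le> 2 * Max ?D"
    using ac by linarith
  have "Min ?D \<le> d v"
    using fin v by (intro Min_le) auto
  then have "Max ?D \<le> deg_ratio n w * d v"
    using min max by (simp add: deg_ratio_def field_simps)
  then have "unit_weight \<le> 2 * deg_ratio n w * d v"
    using U by linarith
  then show "1 \<le> 2 * deg_ratio n w * (d v / unit_weight)"
    using weight_unit_bounds(1) by simp
qed

text \<open>Pigeonhole: if all \<open>n\<close> scaled weights were below 1, the scaled degree would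
  be below \<open>n\<close>, against \<open>deg_ratio_bounds\<close>. A single weight that survives
  truncation is enough.\<close>

lemma idegree_positive:
  assumes v: "v < n" and m: "2 * real n * deg_ratio n w \<le> 2 ^ m"
  shows "1 \<le> idegree m v"
proof -
  note U = weight_unit_bounds(1)
  have term0: "0 \<le> \<lfloor>2 ^ m * (w v j / unit_weight)\<rfloor>" if "j < n" for j
    using w_nonneg[OF v that] U by simp
  have "\<exists>j<n. 1 \<le> 2 ^ m * (w v j / unit_weight)"
  proof (rule ccontr)
    assume "\<not> ?thesis"
    then have "(\<Sum>j<n. 2 ^ m * (w v j / unit_weight)) < (\<Sum>j<n. 1)"
      using n2 by (intro sum_strict_mono) (auto simp: lessThan_empty_iff not_le)
    then have "2 ^ m * (d v / unit_weight) < real n"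
      by (simp add: deg_def sum_distrib_left sum_divide_distrib)
    moreover have "2 * real n * deg_ratio n w * (d v / unit_weight) \<le> 2 ^ m * (d v / unit_weight)"
      using m U d_pos[OF v] by (intro mult_right_mono) auto
    moreover have "real n * 1 \<le> real n * (2 * deg_ratio n w * (d v / unit_weight))"
      using deg_ratio_bounds(2)[OF v] by (intro mult_left_mono) auto
    ultimately show False
      by (simp add: ac_simps)
  qed
  then obtain j where j: "j < n" "1 \<le> 2 ^ m * (w v j / unit_weight)"
    by blast
  then have "1 \<le> \<lfloor>2 ^ m * (w v j / unit_weight)\<rfloor>"
    by (simp add: le_floor_iff)
  also have "\<dots> \<le> idegree m v"
    unfolding idegree_def using j(1) term0 by (intro member_le_sum) auto
  finally show ?thesis .
qed

end

section \<open>A priori bounds for the search, and the complete program\<close>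

locale laplacian_problem = connected_weighted_graph +
  fixes i :: nat and b :: "real Matrix.vec" and lam eps gam :: real
  assumes i: "i < n"
    and b: "b \<in> mat_image (laplacian n w)" "(\<Sum>v<n. (b $ v)\<^sup>2) = 1"
    and lam: "0 < lam" "lam \<le> lambda2 n w" "lam \<le> 2"
    and eps: "0 < eps" "eps \<le> 1" and gam: "0 < gam" "gam \<le> 1"
begin

definition Z :: real where "Z = real n * deg_ratio n w / (eps * lam)"
text \<open>The summand 5 keeps \<open>m1\<close> above the starting value of the search and also
  covers the factor 4 in \<open>Z_le_pow\<close>.\<close>

definition m1 :: nat where "m1 = nat \<lceil>log 2 Z\<rceil> + 5"
definition kg1 :: nat where "kg1 = nat \<lceil>log 2 (1 / gam)\<rceil>"
definition M :: int where "M = 16 * (int kg1 + 1) * 2 ^ (63 * m1)"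
definition I :: lap_input where
  "I = \<lparr>size_in = n, weight_in = w, gap_in = lam, index_in = i, rhs_in = b,
        prec_in = eps, err_in = gam\<rparr>"

sublocale laplacian_machine n w I M
  by unfold_locales (simp_all add: I_def)

lemma n_le_Z: "real n * deg_ratio n w \<le> 2 * Z" "real n / (eps * lam) \<le> Z" "1 \<le> Z"
proof -
  have el: "0 < eps * lam" "eps * lam \<le> 2"
    using eps lam mult_mono[of eps 1 lam 2] by auto
  have nd: "0 \<le> real n * deg_ratio n w" "real n \<le> real n * deg_ratio n w"
    using deg_ratio_bounds(1) mult_left_mono[OF deg_ratio_bounds(1), of "real n"] by auto
  have "real n * deg_ratio n w * (eps * lam) \<le> real n * deg_ratio n w * 2"
    using nd el by (intro mult_left_mono) auto
  then show "real n * deg_ratio n w \<le> 2 * Z"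
    using el by (simp add: Z_def field_simps)
  show "real n / (eps * lam) \<le> Z"
    unfolding Z_def using nd el by (intro divide_right_mono) auto
  have "2 / 2 \<le> real n / (eps * lam)"
    using n2 el by (intro frac_le) auto
  then show "1 \<le> Z"
    using \<open>real n / (eps * lam) \<le> Z\<close> by simp
qed

lemma m1_bound: "real m1 \<le> log 2 Z + 6"
proof -
  have "0 \<le> log 2 Z" using n_le_Z by simp
  then show ?thesis unfolding m1_def by simp linarith
qed

text \<open>The factor 4 is what \<open>idegree_positive\<close> asks for: its bound
  \<open>2 * n * deg_ratio n w\<close> can be as large as \<open>4 * Z\<close>, because
  \<open>eps * lam \<le> 2\<close>.\<close>

lemma Z_le_pow: "4 * Z \<le> 2 ^ m1"
proof -
  have "Z = 2 powr (log 2 Z)"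
    using n_le_Z(3) by simp
  also have "\<dots> \<le> 2 powr (real (nat \<lceil>log 2 Z\<rceil>))"
    by (intro powr_mono) linarith+
  also have "\<dots> = 2 ^ nat \<lceil>log 2 Z\<rceil>"
    by (simp add: powr_realpow)
  finally have "Z \<le> 2 ^ nat \<lceil>log 2 Z\<rceil>" .
  then show ?thesis
    unfolding m1_def power_add using n_le_Z(3) by simp
qed

lemma m1_properties:
  shows "1 \<le> 2 ^ m1 * lam" "1 \<le> 2 ^ m1 * eps" "n \<le> 2 ^ m1" "\<And>v. v < n \<Longrightarrow> 1 \<le> idegree m1 v"
proof -
  have Z: "Z \<le> 2 ^ m1"
    using Z_le_pow n_le_Z(3) by linarith
  \<comment> \<open>This one inequality gives the bounds for \<open>lam\<close>, \<open>eps\<close>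
    and \<open>n\<close>. The factor 2 lost through \<open>lam \<le> 2\<close> in the case of
    \<open>eps\<close> is made up by \<open>2 \<le> n\<close>.\<close>
  have nel: "real n \<le> Z * (eps * lam)"
    using n_le_Z(2) eps lam by (simp add: field_simps)
  have l: "Z * (eps * lam) \<le> Z * lam"
    using eps lam n_le_Z(3) by (intro mult_left_mono) (auto intro: mult_left_le_one_le)
  have e: "Z * (eps * lam) \<le> 2 * (Z * eps)"
    using eps lam n_le_Z(3) mult_left_mono[of lam 2 "Z * eps"] by (simp add: ac_simps)
  have "Z * lam \<le> 2 ^ m1 * lam" "Z * eps \<le> 2 ^ m1 * eps"
    using Z lam eps by (simp_all add: mult_right_mono)
  then show "1 \<le> 2 ^ m1 * lam" "1 \<le> 2 ^ m1 * eps"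
    using nel l e n2 by linarith+
  have "Z * (eps * lam) \<le> 2 * Z"
    using e eps n_le_Z(3) mult_left_mono[of eps 1 Z] by linarith
  then have "real n \<le> 2 ^ m1"
    using nel Z_le_pow n_le_Z(3) by linarith
  then show "n \<le> 2 ^ m1"
    by simp
  show "1 \<le> idegree m1 v" if "v < n" for v
    using Z_le_pow n_le_Z(1) by (intro idegree_positive[OF that]) linarith
qed

lemma kg1_properties:
  shows "1 \<le> 2 ^ kg1 * gam" "2 ^ kg1 * gam \<le> 2"
    "log 2 (real kg1 + 1) \<le> 2 + max 0 (log 2 (log 2 (1 / gam)))"
proof -
  let ?g = "log 2 (1 / gam)"
  have g0: "0 \<le> ?g"
    using gam by simp
  have kg: "?g \<le> real kg1" "real kg1 \<le> ?g + 1"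
    unfolding kg1_def using g0 by linarith+
  have "1 / gam = 2 powr ?g"
    using gam by simp
  also have "\<dots> \<le> 2 powr real kg1"
    using kg by (intro powr_mono) auto
  finally have "1 / gam \<le> 2 ^ kg1"
    by (simp add: powr_realpow)
  then show "1 \<le> 2 ^ kg1 * gam"
    using gam by (simp add: field_simps)
  have "2 ^ kg1 = 2 powr real kg1"
    by (simp add: powr_realpow)
  also have "\<dots> \<le> 2 powr (?g + 1)"
    using kg by (intro powr_mono) auto
  also have "\<dots> = 2 / gam"
    using gam by (simp add: powr_add)
  finally show "2 ^ kg1 * gam \<le> 2"
    using gam by (simp add: field_simps)
  have l4: "log 2 (4::real) = 2"
    using log_powr_cancel[of 2 2] by simp
  show "log 2 (real kg1 + 1) \<le> 2 + max 0 (log 2 ?g)"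
  \<comment> \<open>For \<open>gam \<ge> 1 / 2\<close> the iterated logarithm is no help, its
    argument being at most 1 and even 0 at \<open>gam = 1\<close>; but then
    \<open>kg1 \<le> 2\<close> and the constant suffices.\<close>
  proof (cases "?g \<le> 1")
    case True
    then have "log 2 (real kg1 + 1) \<le> log 2 4"
      using kg by simp
    then show ?thesis using l4 by linarith
  next
    case False
    then have "log 2 (real kg1 + 1) \<le> log 2 (4 * ?g)"
      using kg by simp
    also have "\<dots> = log 2 4 + log 2 ?g"
      using False by (intro log_mult_pos) auto
    also have "\<dots> = 2 + log 2 ?g"
      by (simp only: l4)
    finally show ?thesis by simp
  qed
qed

lemma le_M:
  assumes "c \<le> 16 * (int kg1 + 1)" "0 \<le> c" "k \<le> 63"
  shows "c * (2 ^ m1) ^ k \<le> M"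
proof -
  have "c * (2 ^ m1) ^ k \<le> (16 * (int kg1 + 1)) * (2 ^ m1) ^ 63"
    using assms by (intro mult_mono power_increasing) auto
  then show ?thesis
    by (simp add: M_def power_mult[symmetric] mult.commute)
qed

lemma n_le_pow: "int n \<le> 2 ^ m1"
  using m1_properties(3) by simp

lemma small_le_M:
  shows "int m1 \<le> M" "int kg1 \<le> M" "int n \<le> M" "2 * 2 ^ m1 \<le> M" "int n * 2 ^ m1 \<le> M" "5 \<le> M"
proof -
  have p1: "2 ^ m1 \<le> M" and p2: "2 ^ m1 * 2 ^ m1 \<le> M"
    using le_M[of 1 1] le_M[of 1 2] by (simp_all add: power2_eq_square)
  have "int m1 \<le> 2 ^ m1"
    using less_exp[of m1] by (simp add: less_imp_le)
  then show "int m1 \<le> M"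
    using p1 by (rule order_trans)
  show "int kg1 \<le> M" using le_M[of "int kg1" 0] by simp
  show "int n \<le> M"
    using n_le_pow p1 by (rule order_trans)
  show "2 * 2 ^ m1 \<le> M" using le_M[of 2 1] by simp
  have "int n * 2 ^ m1 \<le> 2 ^ m1 * 2 ^ m1"
    by (rule mult_right_mono[OF n_le_pow]) simp
  then show "int n * 2 ^ m1 \<le> M"
    using p2 by (rule order_trans)
  show "5 \<le> M" using le_M[of 5 0] by simp
qed

lemma n_pow_le_M: "m \<le> m1 \<Longrightarrow> int n * 2 ^ m \<le> M"
  using small_le_M(5) mult_left_mono[of "2 ^ m" "2 ^ m1" "int n"] power_increasing[of m m1 "2::int"]
  by simp

lemma exec_search_Read:
  assumes rb: "regs_bounded 17 M s" and s: "s 3 = int m0" "s 11 = 0"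
    and m: "m0 \<le> m'" "1 \<le> 2 ^ m' * r" "2 ^ m' * r \<le> of_int M" "int m' \<le> M" and r: "0 \<le> r"
    and src: "\<And>s. source_val I s src = r"
  shows "\<exists>m. m0 \<le> m \<and> m \<le> m' \<and> 1 \<le> 2 ^ m * r \<and>
    exec I 17 M (search_com (Read 11 src (Reg 3))) s (return_pmf (s(3 := int m)))"
proof -
  have "\<exists>m. m0 \<le> m \<and> m \<le> m' \<and> 0 < \<lfloor>2 ^ m * r\<rfloor> \<and>
    exec I 17 M (search_com (Read 11 src (Reg 3))) s (return_pmf (s(3 := int m)))"
  proof (rule exec_search[OF s m(1) _ m(4) rb])
    fix m x
    assume m': "m \<le> m'" and rb': "regs_bounded 17 M (s(3 := int m, 11 := x))"
    have "2 ^ m * r \<le> 2 ^ m' * r"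
      using m' r by (intro mult_right_mono power_increasing) auto
    then have "\<lfloor>2 ^ m * r\<rfloor> \<le> M" "0 \<le> \<lfloor>2 ^ m * r\<rfloor>"
      using m(3) r by (simp_all add: floor_le_iff)
    then show "exec I 17 M (Read 11 src (Reg 3)) (s(3 := int m, 11 := x))
        (return_pmf (s(3 := int m, 11 := \<lfloor>2 ^ m * r\<rfloor>)))"
      by (intro det_Read[OF rb', where v = "\<lfloor>2 ^ m * r\<rfloor>"]) (simp_all add: src)
  qed (use m in simp)
  then show ?thesis
    by (simp add: zero_less_floor)
qed

lemma exec_search_size:
  assumes rb: "regs_bounded 17 M s" and s: "s 2 = int n" "s 3 = int m0" "s 11 = 0" and m: "m0 \<le> m1"
  shows "\<exists>m. m0 \<le> m \<and> m \<le> m1 \<and> n \<le> 2 ^ m \<and>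
    exec I 17 M (search_com size_test_com) s (return_pmf (s(3 := int m)))"
proof -
  have "\<exists>m. m0 \<le> m \<and> m \<le> m1 \<and> 0 < 2 ^ m + (1 - int n) \<and>
    exec I 17 M (search_com size_test_com) s (return_pmf (s(3 := int m)))"
  proof (rule exec_search[OF s(2,3) m _ small_le_M(1) rb])
    show "0 < 2 ^ m1 + (1 - int n)"
      using n_le_pow by linarith
    fix m x
    assume m: "m \<le> m1" and rb': "regs_bounded 17 M (s(3 := int m, 11 := x))"
    show "exec I 17 M size_test_com (s(3 := int m, 11 := x))
        (return_pmf (s(3 := int m, 11 := 2 ^ m + (1 - int n))))"
      unfolding size_test_com_def
    proof (rule det_Seq)
      let ?s = "s(3 := int m, 11 := x)" and ?s1 = "s(3 := int m, 11 := int n * 2 ^ m)"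
      have "2 ^ nat (aval (Reg 3) ?s) * source_val I ?s NumVertices = real_of_int (int n * 2 ^ m)"
        by (simp add: I_def)
      then show "exec I 17 M (Read 11 NumVertices (Reg 3)) ?s (return_pmf ?s1)"
        using n_pow_le_M[OF m] by (intro det_Read[OF rb', where v = "int n * 2 ^ m"])
          (simp_all only: floor_of_int, simp_all)
      assume rb1: "regs_bounded 17 M ?s1"
      have "2 ^ m \<le> int n * 2 ^ m"
        using n2 mult_right_mono[of 1 "int n" "2 ^ m"] by simp
      then have "\<bar>2 ^ m + (1 - int n)\<bar> \<le> M"
        unfolding abs_le_iff using n_pow_le_M[OF m] small_le_M(3) n2 zero_less_power[of "2::int" m]
        by linarith
      then show "exec I 17 M (Assign 11 (Plus (Div (Reg 11) (Reg 2)) (Minus (Const 1) (Reg 2)))) ?s1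
          (return_pmf (s(3 := int m, 11 := 2 ^ m + (1 - int n))))"
        using n2 by (intro det_Assign[OF rb1, where v = "2 ^ m + (1 - int n)"]) (simp_all add: s)
    qed
  qed
  then obtain m where "m0 \<le> m" "m \<le> m1" "0 < 2 ^ m + (1 - int n)"
    "exec I 17 M (search_com size_test_com) s (return_pmf (s(3 := int m)))"
    by blast
  moreover from this(3) have "int n \<le> 2 ^ m"
    by linarith
  then have "n \<le> 2 ^ m"
    by simp
  ultimately show ?thesis by blast
qed

text \<open>Each vertex inherits the counter left by the one before, hence the induction generalises
  over the starting value \<open>m0\<close>.\<close>

lemma exec_degrees:
  assumes "regs_bounded 17 M s" "s 9 = int v" "v \<le> n" "s 2 = int n" "s 3 = int m0" "m0 \<le> m1"
    "s 11 = 0" "s 12 = 0" "s 13 = 0"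
  shows "\<exists>m. m0 \<le> m \<and> m \<le> m1 \<and> (\<forall>u<v. 1 \<le> idegree m u) \<and>
    exec I 17 M degrees_com s (return_pmf (s(3 := int m, 9 := 0)))"
  using assms
proof (induction v arbitrary: s m0)
  case 0
  have eq: "s(3 := int m0, 9 := 0) = s"
    using 0 by auto
  have "exec I 17 M degrees_com s (return_pmf (s(3 := int m0, 9 := 0)))"
    unfolding eq unfolding degrees_com_def using 0 by (intro exec_While_false) auto
  moreover have "\<forall>u<0. 1 \<le> idegree m0 u"
    by simp
  ultimately show ?case
    using \<open>m0 \<le> m1\<close> by blast
next
  case (Suc v)
  note rb = Suc.prems(1) and s = Suc.prems(2-)
  have v: "v < n" using s(2) by simp
  have 1: "exec I 17 M (dec 9) s (return_pmf (s(9 := int v)))"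
    using s(1) v small_le_M(3) by (intro det_Assign[OF rb, where v = "int v"]) simp_all
  have rb1: "regs_bounded 17 M (s(9 := int v))" by (rule exec_end[OF 1]) simp
  have "\<exists>m. m0 \<le> m \<and> m \<le> m1 \<and> 0 < idegree m v \<and>
    exec I 17 M (search_com (degree_com (Reg 3))) (s(9 := int v)) (return_pmf ((s(9 := int v))(3 := int m)))"
  proof (rule exec_search[OF _ _ s(5) _ small_le_M(1) rb1])
    show "0 < idegree m1 v"
      using m1_properties(4)[OF v] by simp
    fix m x
    assume m: "m \<le> m1" and rb': "regs_bounded 17 M (s(9 := int v, 3 := int m, 11 := x))"
    have "exec I 17 M (degree_com (Reg 3)) (s(9 := int v, 3 := int m, 11 := x))
        (return_pmf (s(9 := int v, 3 := int m, 11 := x, 11 := idegree m v)))"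
      by (rule exec_degree[OF rb' _ _ _ _ v _ n_pow_le_M[OF m]]) (simp_all add: s)
    then show "exec I 17 M (degree_com (Reg 3)) (s(9 := int v, 3 := int m, 11 := x))
        (return_pmf (s(9 := int v, 3 := int m, 11 := idegree m v)))"
      by simp
  qed (simp_all add: s)
  then obtain m' where m': "m0 \<le> m'" "m' \<le> m1" "0 < idegree m' v" and
    2: "exec I 17 M (search_com (degree_com (Reg 3))) (s(9 := int v)) (return_pmf (s(9 := int v, 3 := int m')))"
    by auto
  let ?s2 = "s(9 := int v, 3 := int m')"
  have rb2: "regs_bounded 17 M ?s2" by (rule exec_end[OF 2]) simp
  have "\<exists>m. m' \<le> m \<and> m \<le> m1 \<and> (\<forall>u<v. 1 \<le> idegree m u) \<and>
    exec I 17 M degrees_com ?s2 (return_pmf (?s2(3 := int m, 9 := 0)))"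
    by (rule Suc.IH[OF rb2]) (use s v m' in simp_all)
  then obtain m where m: "m' \<le> m" "m \<le> m1" "\<forall>u<v. 1 \<le> idegree m u" and
    3: "exec I 17 M degrees_com ?s2 (return_pmf (?s2(3 := int m, 9 := 0)))"
    by blast
  have eq: "?s2(3 := int m, 9 := 0) = s(3 := int m, 9 := 0)"
    by auto
  have "exec I 17 M degrees_com s (return_pmf (s(3 := int m, 9 := 0)))"
    unfolding degrees_com_def
  proof (rule exec_While_true)
    show "exec I 17 M (Seq (Seq (dec 9) (search_com (degree_com (Reg 3))))
      (While (Reg 9) (Seq (dec 9) (search_com (degree_com (Reg 3)))))) s (return_pmf (s(3 := int m, 9 := 0)))"
      using exec_Seq_det[OF exec_Seq_det[OF 1 2] 3] unfolding degrees_com_def eq .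
  qed (simp add: s)
  moreover have "1 \<le> idegree m v"
    using idegree_mono[OF m(1) v] m'(3) by simp
  then have "\<forall>u<Suc v. 1 \<le> idegree m u"
    using m(3) by (simp add: less_Suc_eq)
  ultimately show ?case
    using m(1,2) m'(1) order_trans by blast
qed

text \<open>The stopping points lie below \<open>kg1\<close> and \<open>m1\<close>. Since
  \<open>M\<close> is built from these upper bounds, it dominates the requirement of the sampling
  phase for whatever values are found.\<close>

lemma exec_setup:
  "\<exists>m kg. laplacian_run n w i b lam eps gam m kg I M \<and>
    exec I 17 M setup_com (\<lambda>_. 0) (return_pmf ((\<lambda>_. 0)(2 := int n, 3 := int m, 6 := int kg)))"
proof -
  have M0: "0 \<le> M" using small_le_M(6) by simp
  let ?z = "(\<lambda>_. 0) :: store"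
  have rb0: "regs_bounded 17 M ?z"
    using M0 by (simp add: regs_bounded_def)
  let ?s1 = "?z(2 := int n)"
  have 1: "exec I 17 M (Read 2 NumVertices (Const 0)) ?z (return_pmf ?s1)"
    using small_le_M(3) by (intro det_Read[OF rb0, where v = "int n"]) (simp_all add: I_def)
  have rb1: "regs_bounded 17 M ?s1" by (rule exec_end[OF 1]) simp
  have "\<exists>kg. 0 \<le> kg \<and> kg \<le> kg1 \<and> 1 \<le> 2 ^ kg * gam \<and>
    exec I 17 M (search_com (Read 11 ErrorProb (Reg 3))) ?s1 (return_pmf (?s1(3 := int kg)))"
  proof (rule exec_search_Read[OF rb1])
    show "2 ^ kg1 * gam \<le> of_int M"
      using kg1_properties(2) small_le_M(6) by linarith
  qed (use kg1_properties(1) small_le_M(2) gam in \<open>simp_all add: I_def\<close>)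
  then obtain kg where kg: "kg \<le> kg1" "1 \<le> 2 ^ kg * gam" and
    2: "exec I 17 M (search_com (Read 11 ErrorProb (Reg 3))) ?s1 (return_pmf (?s1(3 := int kg)))"
    by blast
  let ?s2 = "?s1(3 := int kg)" let ?s3 = "?s2(6 := int kg)" let ?s4 = "?z(2 := int n, 6 := int kg, 3 := int 5)"
  have rb2: "regs_bounded 17 M ?s2" by (rule exec_end[OF 2]) simp
  have 3: "exec I 17 M (Assign 6 (Reg 3)) ?s2 (return_pmf ?s3)"
    using kg small_le_M(2) by (intro det_Assign[OF rb2, where v = "int kg"]) simp_all
  have rb3: "regs_bounded 17 M ?s3" by (rule exec_end[OF 3]) simp
  have "?s4 = ?s3(3 := 5)" by auto
  then have 4: "exec I 17 M (Assign 3 (Const 5)) ?s3 (return_pmf ?s4)"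
    using small_le_M(6) by (intro det_Assign[OF rb3, where v = 5]) simp_all
  have rb4: "regs_bounded 17 M ?s4" by (rule exec_end[OF 4]) simp
  let ?t = "\<lambda>m. ?z(2 := int n, 6 := int kg, 3 := int m)"
  have upd: "(?t m)(3 := int m') = ?t m'" for m m'
    by simp
  have twoM: "2 * 2 ^ m1 \<le> real_of_int M"
  proof -
    have "real_of_int (2 * 2 ^ m1) \<le> real_of_int M"
      using small_le_M(4) by (simp only: of_int_le_iff)
    then show ?thesis
      unfolding of_int_mult of_int_power of_int_numeral .
  qed
  have "\<exists>m. 5 \<le> m \<and> m \<le> m1 \<and> 1 \<le> 2 ^ m * lam \<and>
    exec I 17 M (search_com (Read 11 GapBound (Reg 3))) (?t 5) (return_pmf ((?t 5)(3 := int m)))"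
  proof (rule exec_search_Read[OF rb4])
    show "2 ^ m1 * lam \<le> of_int M"
    proof -
      have "2 ^ m1 * lam \<le> 2 ^ m1 * 2"
        using lam(3) by (intro mult_left_mono) auto
      with twoM show ?thesis by linarith
    qed
  qed (use m1_properties(1) small_le_M(1) lam in \<open>simp_all add: I_def m1_def\<close>)
  then obtain ma where ma: "5 \<le> ma" "ma \<le> m1" "1 \<le> 2 ^ ma * lam" and
    5: "exec I 17 M (search_com (Read 11 GapBound (Reg 3))) (?t 5) (return_pmf (?t ma))"
    unfolding upd by blast
  have rb5: "regs_bounded 17 M (?t ma)" by (rule exec_end[OF 5]) simp
  have "\<exists>m. ma \<le> m \<and> m \<le> m1 \<and> 1 \<le> 2 ^ m * eps \<and>
    exec I 17 M (search_com (Read 11 Precision (Reg 3))) (?t ma) (return_pmf ((?t ma)(3 := int m)))"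
  proof (rule exec_search_Read[OF rb5])
    have "2 ^ m1 * eps \<le> 2 * 2 ^ m1"
      using mult_left_mono[OF eps(2), of "2 ^ m1"] by simp
    with twoM show "2 ^ m1 * eps \<le> of_int M" by linarith
  qed (use m1_properties(2) small_le_M(1) eps ma in \<open>simp_all add: I_def\<close>)
  then obtain mb where mb: "ma \<le> mb" "mb \<le> m1" "1 \<le> 2 ^ mb * eps" and
    6: "exec I 17 M (search_com (Read 11 Precision (Reg 3))) (?t ma) (return_pmf (?t mb))"
    unfolding upd by blast
  have rb6: "regs_bounded 17 M (?t mb)" by (rule exec_end[OF 6]) simp
  have "\<exists>m. mb \<le> m \<and> m \<le> m1 \<and> n \<le> 2 ^ m \<and>
    exec I 17 M (search_com size_test_com) (?t mb) (return_pmf ((?t mb)(3 := int m)))"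
    by (rule exec_search_size[OF rb6]) (use mb in simp_all)
  then obtain mc where mc: "mb \<le> mc" "mc \<le> m1" "n \<le> 2 ^ mc" and
    7: "exec I 17 M (search_com size_test_com) (?t mb) (return_pmf (?t mc))"
    unfolding upd by blast
  have rb7: "regs_bounded 17 M (?t mc)" by (rule exec_end[OF 7]) simp
  let ?s8 = "(?t mc)(9 := int n)"
  have 8: "exec I 17 M (Assign 9 (Reg 2)) (?t mc) (return_pmf ?s8)"
    using small_le_M(3) by (intro det_Assign[OF rb7, where v = "int n"]) simp_all
  have rb8: "regs_bounded 17 M ?s8" by (rule exec_end[OF 8]) simp
  have "\<exists>m. mc \<le> m \<and> m \<le> m1 \<and> (\<forall>u<n. 1 \<le> idegree m u) \<and>
    exec I 17 M degrees_com ?s8 (return_pmf (?s8(3 := int m, 9 := 0)))"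
    by (rule exec_degrees[OF rb8]) (use mc in simp_all)
  then obtain m where m: "mc \<le> m" "m \<le> m1" "\<forall>u<n. 1 \<le> idegree m u" and
    9: "exec I 17 M degrees_com ?s8 (return_pmf (?s8(3 := int m, 9 := 0)))"
    by blast
  have final: "?s8(3 := int m, 9 := 0) = ?z(2 := int n, 3 := int m, 6 := int kg)"
    by auto
  have "exec I 17 M setup_com ?z (return_pmf (?z(2 := int n, 3 := int m, 6 := int kg)))"
    unfolding setup_com_def final[symmetric]
    by (rule exec_Seq_det[OF 1 exec_Seq_det[OF 2 exec_Seq_det[OF 3 exec_Seq_det[OF 4
      exec_Seq_det[OF 5 exec_Seq_det[OF 6 exec_Seq_det[OF 7 exec_Seq_det[OF 8 9]]]]]]]])
  moreover have "laplacian_run n w i b lam eps gam m kg I M"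
  proof -
    have pow: "(2::real) ^ ma \<le> 2 ^ m" "(2::real) ^ mb \<le> 2 ^ m" "(2::nat) ^ mc \<le> 2 ^ m"
      using m mc mb by (auto intro: power_increasing)
    have "2 ^ ma * lam \<le> 2 ^ m * lam" "2 ^ mb * eps \<le> 2 ^ m * eps"
      using pow lam eps by (simp_all add: mult_right_mono)
    then have le: "1 \<le> 2 ^ m * lam" "1 \<le> 2 ^ m * eps"
      using ma mb by linarith+
    have n: "n \<le> 2 ^ m"
      using pow mc by linarith
    interpret lp: laplacian_parameters n w i b lam eps gam m kg
      by unfold_locales (use i b lam kg le n m mc mb ma in auto)
    have "16 * (int kg + 1) * lp.B ^ 63 \<le> 16 * (int kg1 + 1) * (2 ^ m1) ^ 63"
      unfolding lp.B_def using kg m by (intro mult_mono power_mono power_increasing) auto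
    also have "\<dots> = M"
      by (simp add: M_def power_mult[symmetric] mult.commute)
    finally show ?thesis
      by unfold_locales (simp_all add: I_def)
  qed
  ultimately show ?thesis by blast
qed

text \<open>With \<open>x\<close> the iterated logarithm cut at 0 and \<open>y = log 2 Z\<close>,
  the bit count is at most \<open>17 * (1 + 4 + (2 + x) + 63 * (y + 6)) = 6545 + 17 * x + 1071 *
  y\<close>; 10000 is a round bound for all three coefficients.\<close>

lemma space_bound: "real_of_int (int 17 * bitlen M)
    \<le> 10000 * (1 + log 2 Z + max 0 (log 2 (log 2 (1 / gam))))"
proof -
  define x where "x = max 0 (log 2 (log 2 (1 / gam)))"
  define y where "y = log 2 Z"
  define z where "z = log 2 (real kg1 + 1)"
  have M0: "0 < M" using small_le_M(6) by simp
  have l16: "log 2 (16::real) = 4"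
    using log_powr_cancel[of 2 4] by simp
  have "real_of_int M = 16 * (real kg1 + 1) * 2 ^ (63 * m1)"
    by (simp add: M_def)
  then have "log 2 (real_of_int M) = log 2 (16 * (real kg1 + 1)) + log 2 (2 ^ (63 * m1))"
    by (simp add: log_mult_pos)
  also have "log 2 (16 * (real kg1 + 1)) = 4 + z"
    using log_mult_pos[of 16 "real kg1 + 1" 2] by (simp add: l16 z_def)
  also have "log 2 (2 ^ (63 * m1)) = 63 * real m1"
    by (simp add: log_nat_power)
  finally have M: "log 2 (real_of_int M) = 4 + z + 63 * real m1" .
  have bit: "real_of_int (bitlen M) \<le> log 2 (real_of_int M) + 1"
    using M0 by (simp add: bitlen_alt_def)
  have "0 \<le> y" "0 \<le> x" "z \<le> 2 + x" "real m1 \<le> y + 6"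
    using n_le_Z(3) kg1_properties(3) m1_bound by (simp_all add: x_def y_def z_def)
  moreover have "17 * c \<le> 10000 + 10000 * y + 10000 * x"
    if "c \<le> l + 1" "l = 4 + z + 63 * r" "0 \<le> y" "0 \<le> x" "z \<le> 2 + x" "r \<le> y + 6"
    for c l r :: real
    using that by linarith
  ultimately have "17 * real_of_int (bitlen M) \<le> 10000 + 10000 * y + 10000 * x"
    using bit M by blast
  then show ?thesis by (simp add: x_def y_def distrib_left)
qed

lemma program_correct:
  "(\<exists>t. halts_by I program t \<and>
      measure_pmf.prob (run I program t)
        {cf. additive_approx eps ((pseudo_inverse (laplacian n w) *\<^sub>v b) $ i) (out_val cf)} \<ge> 1 - gam) \<and>
   space_bounded I program (10000 * (1 + log 2 Z + max 0 (log 2 (log 2 (1 / gam)))))"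
proof -
  obtain m kg where "laplacian_run n w i b lam eps gam m kg I M" and
    1: "exec I 17 M setup_com (\<lambda>_. 0) (return_pmf ((\<lambda>_. 0)(2 := int n, 3 := int m, 6 := int kg)))"
    using exec_setup by blast
  then interpret lr: laplacian_run n w i b lam eps gam m kg I M by simp
  have "regs_bounded 17 M ((\<lambda>_. 0)(2 := int n, 3 := int m, 6 := int kg))"
    by (rule exec_end[OF 1]) simp
  from exec_Seq_det[OF 1 lr.exec_main[OF this]]
  have exec: "exec I 17 M program (\<lambda>_. 0) (map_pmf (\<lambda>s. lr.st s 0 0 0) (iid_sum lr.sample lr.N 0))"
    unfolding program_def .
  from exec_program(1)[OF this] lr.main_accuracy exec_program(2)[OF exec space_bound]
  show ?thesis by auto
qed

end

text \<open>The summand 1 and the cut at 0 express the O-notation by a single constant: the first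
  logarithm can be 0, and the iterated one is negative for \<open>gam\<close> strictly between
  \<open>1 / 2\<close> and 1.\<close>

theorem theorem4:
  shows "\<exists>(P :: com) (C :: real).
    \<forall>(n :: nat) (w :: nat \<Rightarrow> nat \<Rightarrow> real) (lam :: real) (i :: nat)
      (b :: real Matrix.vec) (eps :: real) (gam :: real).
      2 \<le> n \<and> weighted_graph n w \<and> connected_graph n w \<and>
      0 < lam \<and> lam \<le> 2 \<and> lam \<le> lambda2 n w \<and>
      i < n \<and>
      b \<in> mat_image (laplacian n w) \<and> sqrt (scalar_prod b b) = 1 \<and>
      0 < eps \<and> eps \<le> 1 \<and> 0 < gam \<and> gam \<le> 1 \<longrightarrow>
      (let I = \<lparr>size_in = n, weight_in = w, gap_in = lam, index_in = i, rhs_in = b,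
                prec_in = eps, err_in = gam\<rparr> in
       (\<exists>t. halts_by I P t \<and>
            measure_pmf.prob (run I P t)
              {cf. additive_approx eps (vec_index (pseudo_inverse (laplacian n w) *\<^sub>v b) i)
                     (out_val cf)} \<ge> 1 - gam) \<and>
       space_bounded I P
         (C * (1 + log 2 (real n * deg_ratio n w / (eps * lam))
                 + max 0 (log 2 (log 2 (1 / gam))))))"
proof (intro exI[of _ program] exI[of _ 10000] allI impI)
  fix n w lam i and b :: "real Matrix.vec" and eps gam :: real
  assume A: "2 \<le> n \<and> weighted_graph n w \<and> connected_graph n w \<and>
      0 < lam \<and> lam \<le> 2 \<and> lam \<le> lambda2 n w \<and> i < n \<and>
      b \<in> mat_image (laplacian n w) \<and> sqrt (scalar_prod b b) = 1 \<and>
      0 < eps \<and> eps \<le> 1 \<and> 0 < gam \<and> gam \<le> 1"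
  then interpret connected_weighted_graph n w
    by unfold_locales auto
  have "dim_vec b = n"
    using A by (auto simp: mat_image_def carrier_matD[OF laplacian_carrier])
  then have "scalar_prod b b = (\<Sum>v<n. (b $ v)\<^sup>2)"
    by (simp add: scalar_prod_def lessThan_atLeast0 power2_eq_square)
  with A have "(\<Sum>v<n. (b $ v)\<^sup>2) = 1"
    by simp
  with A interpret laplacian_problem n w i b lam eps gam
    by unfold_locales auto
  show "let I = \<lparr>size_in = n, weight_in = w, gap_in = lam, index_in = i, rhs_in = b,
                prec_in = eps, err_in = gam\<rparr> in
       (\<exists>t. halts_by I program t \<and>
            measure_pmf.prob (run I program t)
              {cf. additive_approx eps (vec_index (pseudo_inverse (laplacian n w) *\<^sub>v b) i)
                     (out_val cf)} \<ge> 1 - gam) \<and>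
       space_bounded I program
         (10000 * (1 + log 2 (real n * deg_ratio n w / (eps * lam))
                 + max 0 (log 2 (log 2 (1 / gam)))))"
    using program_correct unfolding Let_def I_def Z_def .
qed

end
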